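(* Let $1<p<\infty$ and let $X=(X,d,\mu)$ be an unbounded metric measure space such that $\mu$ is globally doubling and supports a global $p$-Poincaré inequality with dilation constant $\lambda$. If $X$ is sequentially annularly chainable around some point $x_0\in X$, and $u$ is a quasiharmonic function on $X$ with finite energy, then $u$ is constant.
   Context: Throughout, $1<p<\infty$ and $X=(X,d,\mu)$ is a metric space with a positive complete Borel measure $\mu$ such that $0<\mu(B)<\infty$ for all balls $B\subset X$. $X$ need not be complete. Balls are open and come with a prescribed centre and radius $r_B$; $\lambda B$ is the concentric ball with radius $\lambda r_B$. Write $B_r=B(x_0,r)$. Upper gradients. Curves are nonconstant, compact and rectifiable, parameterized by arc length $ds$. A property holds for $p$-almost every curve if for the family $\Gamma$ of curves for which it fails there is a Borel function $0\le\rho\in L^p(X)$ with $\int_\gamma\rho\,ds=\infty$ for all $\gamma\in\Gamma$. A measurable $g:X\to[0,\infty]$ is a $p$-weak upper gradient of $u:X\to[-\infty,\infty]$ if for $p$-almost every curve $\gamma:[0,l_\gamma]\to X$, $|u(\gamma(0))-u(\gamma(l_\gamma))|\le\int_\gamma g\,ds$ (left-hand side $\infty$ if a term is $\pm\infty$). If $u$ has a $p$-weak upper gradient in $L^p_{\rm loc}$, then $g_u$ denotes the minimal one (a.e. smallest). For measurable $u$, $\|u\|_{N^{1,p}(X)}^p=\int_X|u|^p\,d\mu+\inf_g\int_Xg^p\,d\mu$, infimum over $p$-weak upper gradients $g$ of $u$, and $N^{1,p}(X)=\{u:\|u\|_{N^{1,p}(X)}<\infty\}$ (functions defined everywhere);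 $N^{1,p}(E)$ is defined by regarding a measurable set $E$ as a metric measure space in its own right. Doubling and Poincaré. $\mu$ is globally doubling if there is $C>0$ with $\mu(2B)\le C\mu(B)$ for all balls $B$. $\mu$ supports a global $p$-Poincaré inequality with dilation constant $\lambda\ge1$ if there is $C>0$ such that for all balls $B$, all integrable $u$ on $\lambda B$ and all $p$-weak upper gradients $g$ of $u$, $\frac1{\mu(B)}\int_B|u-u_B|\,d\mu\le Cr_B\bigl(\frac1{\mu(\lambda B)}\int_{\lambda B}g^p\,d\mu\bigr)^{1/p}$, where $u_B=\frac1{\mu(B)}\int_Bu\,d\mu$. Quasiharmonic functions on $X$. A function $u$ on $X$ with $u\in N^{1,p}(G)$ for every bounded open $G\subset X$ is a quasiminimizer on $X$ if there is $Q\ge1$ with $\int_{\{\varphi\ne0\}}g_u^p\,d\mu\le Q\int_{\{\varphi\ne0\}}g_{u+\varphi}^p\,d\mu$ for all $\varphi$ in the closure in $N^{1,p}(X)$ of the functions in $N^{1,p}(X)$ vanishing outside some bounded open set (this closure is $N^{1,p}(X)$). A continuous (real-valued) quasiminimizer is called quasiharmonic. Finite energy means $\int_Xg_u^p\,d\mu<\infty$. Chainability. $X$ is sequentially annularly chainable around $x_0$ if there are a constant $\Lambda>1$ and a sequence of radii $r_j\nearrow\infty$ such that for every $j$ and $x,y\in\partial B_{r_j}$ there is a chain of points $x=x_1,\ldots,x_m=y$ in $B_{\Lambda r_j}\setminus B_{r_j/\Lambda}$ satisfying $d(x_k,x_{k+1})<r_j/(8\lambda\Lambda)$ for $k=1,\ldots,m-1$,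 where $\lambda$ is the dilation constant of the global $p$-Poincaré inequality. *)

theory Defs
  imports "HOL-Analysis.Analysis"
begin

text \<open>
  A metric measure space is a measure \<open>M\<close> on a metric space type. The notions below that
  also make sense for subsets (curves, upper gradients, Newtonian spaces) refer to
  \<open>space M\<close>, so that they apply to a measurable subset \<open>E\<close>, viewed as a
  metric measure space in its own right, via \<^term>\<open>restrict_space M E\<close>.
  Functions with values in $[0,\infty]$ have type \<^typ>\<open>ennreal\<close>, functions with values in
  $[-\infty,\infty]$ have type \<^typ>\<open>ereal\<close>.
\<close>

text \<open>
  A complete Borel measure lives on the completion of the Borel \<open>\<sigma>\<close>-algebra.
\<close>

definition metric_measure_space :: "'a::metric_space measure \<Rightarrow> bool" where
  "metric_measure_space M \<longleftrightarrow>
     (\<exists>N. sets N = sets borel \<and> M = completion N) \<and>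
     (\<forall>x r. 0 < r \<longrightarrow> 0 < emeasure M (ball x r) \<and> emeasure M (ball x r) < \<infinity>)"

definition globally_doubling :: "'a::metric_space measure \<Rightarrow> bool" where
  "globally_doubling M \<longleftrightarrow>
     (\<exists>C::real. 0 < C \<and>
       (\<forall>x r. 0 < r \<longrightarrow> emeasure M (ball x (2 * r)) \<le> ennreal C * emeasure M (ball x r)))"

text \<open>The power $a^p$ for $a \in [0,\infty]$ and $p > 0$.\<close>

definition epow :: "ennreal \<Rightarrow> real \<Rightarrow> ennreal" where
  "epow a p = (if a = \<infinity> then \<infinity> else ennreal (enn2real a powr p))"

definition eabs :: "ereal \<Rightarrow> ennreal" where
  "eabs a = e2ennreal \<bar>a\<bar>"


subsection \<open>Curves and weak upper gradients\<close>

definition curve_length :: "(real \<Rightarrow> 'a::metric_space) \<Rightarrow> real \<Rightarrow> real \<Rightarrow> ennreal" where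
  "curve_length \<gamma> s t =
     (SUP ts \<in> {ts. sorted ts \<and> set ts \<subseteq> {s..t}}.
        \<Sum>i<length ts - 1. ennreal (dist (\<gamma> (ts ! i)) (\<gamma> (ts ! Suc i))))"

text \<open>
  Nonconstant compact rectifiable curves $\gamma : [0,l] \to E$ parameterized by arc length.
  Rectifiability and continuity are consequences of the arc length parameterization, and
  $\gamma$ is nonconstant since $l > 0$. Values of \<open>\<gamma>\<close> outside $[0,l]$ are irrelevant.
\<close>

definition arc_length_curve :: "'a::metric_space set \<Rightarrow> (real \<Rightarrow> 'a) \<Rightarrow> real \<Rightarrow> bool" where
  "arc_length_curve E \<gamma> l \<longleftrightarrow>
     0 < l \<and> \<gamma> ` {0..l} \<subseteq> E \<and>
     (\<forall>s t. 0 \<le> s \<and> s \<le> t \<and> t \<le> l \<longrightarrow> curve_length \<gamma> s t = ennreal (t - s))"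

definition curve_integral :: "(real \<Rightarrow> 'a) \<Rightarrow> real \<Rightarrow> ('a \<Rightarrow> ennreal) \<Rightarrow> ennreal" where
  "curve_integral \<gamma> l g = (\<integral>\<^sup>+t\<in>{0..l}. g (\<gamma> t) \<partial>lebesgue)"

definition almost_every_curve ::
    "'a::metric_space measure \<Rightarrow> real \<Rightarrow> ((real \<Rightarrow> 'a) \<Rightarrow> real \<Rightarrow> bool) \<Rightarrow> bool" where
  "almost_every_curve M p P \<longleftrightarrow>
     (\<exists>\<rho> \<in> borel_measurable (restrict_space borel (space M)).
        (\<integral>\<^sup>+x. epow (\<rho> x) p \<partial>M) < \<infinity> \<and>
        (\<forall>\<gamma> l. arc_length_curve (space M) \<gamma> l \<and> \<not> P \<gamma> l \<longrightarrow> curve_integral \<gamma> l \<rho> = \<infinity>))"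

text \<open>
  In \<^typ>\<open>ereal\<close> one has \<open>\<bar>a - b\<bar> = \<infinity>\<close> as soon as \<open>a\<close> or \<open>b\<close> is infinite
  (also for \<open>\<infinity> - \<infinity>\<close>), which is the usual convention for upper gradients.
\<close>

definition weak_upper_gradient ::
    "'a::metric_space measure \<Rightarrow> real \<Rightarrow> ('a \<Rightarrow> ereal) \<Rightarrow> ('a \<Rightarrow> ennreal) \<Rightarrow> bool" where
  "weak_upper_gradient M p u g \<longleftrightarrow>
     g \<in> borel_measurable M \<and>
     almost_every_curve M p (\<lambda>\<gamma> l. eabs (u (\<gamma> 0) - u (\<gamma> l)) \<le> curve_integral \<gamma> l g)"

definition Lp_loc :: "'a::metric_space measure \<Rightarrow> real \<Rightarrow> ('a \<Rightarrow> ennreal) \<Rightarrow> bool" where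
  "Lp_loc M p g \<longleftrightarrow>
     g \<in> borel_measurable M \<and>
     (\<forall>x\<in>space M. \<exists>r>0. (\<integral>\<^sup>+y\<in>ball x r. epow (g y) p \<partial>M) < \<infinity>)"

definition minimal_weak_upper_gradient ::
    "'a::metric_space measure \<Rightarrow> real \<Rightarrow> ('a \<Rightarrow> ereal) \<Rightarrow> ('a \<Rightarrow> ennreal) \<Rightarrow> bool" where
  "minimal_weak_upper_gradient M p u g \<longleftrightarrow>
     weak_upper_gradient M p u g \<and> Lp_loc M p g \<and>
     (\<forall>h. weak_upper_gradient M p u h \<and> Lp_loc M p h \<longrightarrow> (AE x in M. g x \<le> h x))"

text \<open>
  The function $g_u$, which is unique up to modification on null sets, so that the integrals
  of $g_u^p$ do not depend on the choice.
\<close>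

definition min_wug :: "'a::metric_space measure \<Rightarrow> real \<Rightarrow> ('a \<Rightarrow> ereal) \<Rightarrow> 'a \<Rightarrow> ennreal" where
  "min_wug M p u = (SOME g. minimal_weak_upper_gradient M p u g)"


subsection \<open>Newtonian spaces\<close>

definition newtonian_norm :: "'a::metric_space measure \<Rightarrow> real \<Rightarrow> ('a \<Rightarrow> ereal) \<Rightarrow> ennreal" where
  "newtonian_norm M p u =
     epow ((\<integral>\<^sup>+x. epow (eabs (u x)) p \<partial>M) +
           (INF g \<in> {g. weak_upper_gradient M p u g}. \<integral>\<^sup>+x. epow (g x) p \<partial>M)) (1 / p)"

definition newtonian :: "'a::metric_space measure \<Rightarrow> real \<Rightarrow> ('a \<Rightarrow> ereal) set" where
  "newtonian M p = {u \<in> borel_measurable M. newtonian_norm M p u < \<infinity>}"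

text \<open>
  The closure in the Newtonian space of the functions vanishing outside a bounded open set.
  The differences \<open>\<phi> x - \<psi> x\<close> are genuine wherever one of the terms is finite; at the
  remaining points (a set of zero capacity) they take the value \<open>\<infinity>\<close> or \<open>-\<infinity>\<close>.
\<close>

definition newtonian_bounded_support_closure ::
    "'a::metric_space measure \<Rightarrow> real \<Rightarrow> ('a \<Rightarrow> ereal) set" where
  "newtonian_bounded_support_closure M p =
     {\<phi> \<in> newtonian M p. \<forall>\<epsilon>>0. \<exists>\<psi> \<in> newtonian M p.
        (\<exists>G. open G \<and> bounded G \<and> (\<forall>x. x \<notin> G \<longrightarrow> \<psi> x = 0)) \<and>
        newtonian_norm M p (\<lambda>x. \<phi> x - \<psi> x) < ennreal \<epsilon>}"


subsection \<open>Poincare inequality\<close>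

definition integrable_ereal_on :: "'a measure \<Rightarrow> 'a set \<Rightarrow> ('a \<Rightarrow> ereal) \<Rightarrow> bool" where
  "integrable_ereal_on M A u \<longleftrightarrow>
     u \<in> borel_measurable (restrict_space M A) \<and> (\<integral>\<^sup>+x\<in>A. eabs (u x) \<partial>M) < \<infinity>"

text \<open>For integrable \<open>u\<close>, which is finite almost everywhere, this is the mean value $u_A$.\<close>

definition mean_value :: "'a measure \<Rightarrow> 'a set \<Rightarrow> ('a \<Rightarrow> ereal) \<Rightarrow> real" where
  "mean_value M A u = (LINT x:A|M. real_of_ereal (u x)) / measure M A"

text \<open>
  The functions \<open>u\<close> and \<open>g\<close> are defined on the whole space, and \<open>g\<close> is a weak upper
  gradient of \<open>u\<close> there, while \<open>u\<close> need only be integrable on the dilated ball.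
\<close>

definition global_poincare :: "'a::metric_space measure \<Rightarrow> real \<Rightarrow> real \<Rightarrow> bool" where
  "global_poincare M p lam \<longleftrightarrow>
     1 \<le> lam \<and>
     (\<exists>C::real. 0 < C \<and>
       (\<forall>x r u g. 0 < r \<and> integrable_ereal_on M (ball x (lam * r)) u \<and> weak_upper_gradient M p u g \<longrightarrow>
          (\<integral>\<^sup>+y\<in>ball x r. eabs (u y - ereal (mean_value M (ball x r) u)) \<partial>M)
              / emeasure M (ball x r)
          \<le> ennreal (C * r) *
            epow ((\<integral>\<^sup>+y\<in>ball x (lam * r). epow (g y) p \<partial>M) / emeasure M (ball x (lam * r))) (1 / p)))"


subsection \<open>Quasiharmonic functions on the whole space\<close>

definition quasiminimizer :: "'a::metric_space measure \<Rightarrow> real \<Rightarrow> ('a \<Rightarrow> ereal) \<Rightarrow> bool" where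
  "quasiminimizer M p u \<longleftrightarrow>
     (\<forall>G. open G \<and> bounded G \<longrightarrow> u \<in> newtonian (restrict_space M G) p) \<and>
     (\<exists>Q::real. 1 \<le> Q \<and>
       (\<forall>\<phi> \<in> newtonian_bounded_support_closure M p.
          (\<integral>\<^sup>+x\<in>{x. \<phi> x \<noteq> 0}. epow (min_wug M p u x) p \<partial>M)
          \<le> ennreal Q * (\<integral>\<^sup>+x\<in>{x. \<phi> x \<noteq> 0}. epow (min_wug M p (\<lambda>y. u y + \<phi> y) x) p \<partial>M)))"

definition quasiharmonic :: "'a::metric_space measure \<Rightarrow> real \<Rightarrow> ('a \<Rightarrow> real) \<Rightarrow> bool" where
  "quasiharmonic M p u \<longleftrightarrow> continuous_on UNIV u \<and> quasiminimizer M p (\<lambda>x. ereal (u x))"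

definition finite_energy :: "'a::metric_space measure \<Rightarrow> real \<Rightarrow> ('a \<Rightarrow> real) \<Rightarrow> bool" where
  "finite_energy M p u \<longleftrightarrow> (\<integral>\<^sup>+x. epow (min_wug M p (\<lambda>x. ereal (u x)) x) p \<partial>M) < \<infinity>"


subsection \<open>Chainability\<close>

text \<open>The parameter \<open>lam\<close> is the dilation constant of the Poincare inequality.\<close>

definition sequentially_annularly_chainable :: "real \<Rightarrow> 'a::metric_space \<Rightarrow> bool" where
  "sequentially_annularly_chainable lam x\<^sub>0 \<longleftrightarrow>
     (\<exists>\<Lambda>>1. \<exists>r::nat \<Rightarrow> real.
        (\<forall>j. 0 < r j) \<and> incseq r \<and> filterlim r at_top sequentially \<and>
        (\<forall>j. \<forall>x \<in> frontier (ball x\<^sub>0 (r j)). \<forall>y \<in> frontier (ball x\<^sub>0 (r j)).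
           \<exists>xs. xs \<noteq> [] \<and> hd xs = x \<and> last xs = y \<and>
             set xs \<subseteq> ball x\<^sub>0 (\<Lambda> * r j) - ball x\<^sub>0 (r j / \<Lambda>) \<and>
             (\<forall>k. Suc k < length xs \<longrightarrow> dist (xs ! k) (xs ! Suc k) < r j / (8 * lam * \<Lambda>))))"

end

theory Submission
  imports Defs
begin

text \<open>
  Write $E(A) = \int_A g_u^p\,d\mu$ and $B_r = B(x_0,r)$. The theorem follows from one estimate:
  there is a constant $C$ such that, for each of the radii $r = r_j$ in the chainability condition,
  \[ E(B_r) \le C\, E(X \setminus B_{r/(2\Lambda)}). \]
  Since $E(X) < \infty$, the right-hand side tends to $0$ along the sequence, so $E(X) = 0$ and the
  Poincare inequality makes the continuous function $u$ constant.

  The estimate comes from a single test function. Put $\rho = r/(8\lambda\Lambda)$ and let $\eta$ be $1$ on $B_r$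
  and, outside $B_r$, decrease linearly in the distance to $\partial B_r$ until it vanishes at
  distance $\rho$. For a constant $c$ take $\varphi = -\eta(u-c)$. Then $u+\varphi$ equals $c$ on $B_r$ and thus
  carries no energy there, so that only the collar of points outside $B_r$ within distance $\rho$ of
  $\partial B_r$ remains. There $g_u + |u-c|/\rho$ is a weak upper gradient of $u + \varphi$
  (lemma \<open>quasiminimizer_energy_ball_le_collar\<close>), because a curve can leave $B_r$ only through
  $\partial B_r$, so that $\eta$ has Lipschitz constant $1/\rho$ along every curve.
  The quasiminimizing inequality only sees the set where $\varphi \ne 0$, so $c$ is chosen such
  that $\{u = c\} \cap B_r$ is a null set, which excludes at most countably many values.

  It remains to bound $\int |u-c|^p$ over the collar by $C r^p E(X \setminus B_{r/(2\Lambda)})$ (lemma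
  \<open>annular_poincare\<close>). Along a chain with steps shorter than $\rho$, the means of $u$ over
  balls of radius $2\rho$ change by a controlled amount from one point to the next. A chain without
  shortcuts has boundedly many points, because every second one belongs to a $\rho$-separated set and
  $\mu$ is doubling. Hence all means over balls centred on $\partial B_r$ are close to a single number $c_0$.
  From means to values of $u$ one telescopes over the balls $B(x, 4^{-i}\rho)$; this bounds
  $|u(x) - u_{B(x,\rho)}|^p$ by a series of weighted averages of $g_u^p$ over small balls around $x$,
  which can be integrated in $x$ with the help of separated nets (lemma \<open>ball_averages_majorant\<close>).

  All this presupposes that the function $g_u$, which is defined by a choice operator, really is
  minimal, for $u$ and for $u + \varphi$. Everything about minimality reduces to a statement on
  functions of one real variable (lemma \<open>increment_le_min_on_open\<close>): if the increments of $f$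
  are bounded by integrals of $H$, and inside an open set also by integrals of $G$, then $G$ may replace
  $H$ wherever it is smaller in that set. Composed with curves, it shows that weak upper gradients form
  a lattice, and that they may be put to $0$ on an open set where the function is constant.
\<close>

section \<open>Powers of extended nonnegative numbers\<close>

lemma epow_top [simp]: "epow \<infinity> p = \<infinity>" "epow top p = top"
  by (simp_all add: epow_def)

lemma epow_ennreal: "0 \<le> a \<Longrightarrow> epow (ennreal a) p = ennreal (a powr p)"
  by (simp add: epow_def)

lemma epow_0 [simp]: "epow 0 p = 0"
  by (simp add: epow_def)

lemma epow_less_top_iff: "epow a p < \<infinity> \<longleftrightarrow> a < \<infinity>"
  by (cases a) (auto simp: epow_def)

lemma epow_mono: "0 < p \<Longrightarrow> a \<le> b \<Longrightarrow> epow a p \<le> epow b p"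
  by (cases a; cases b) (auto simp: epow_ennreal top_unique intro!: ennreal_leI powr_mono2)

lemma epow_measurable [measurable]: "(\<lambda>a. epow a p) \<in> borel_measurable borel"
  unfolding epow_def by measurable

lemma epow_max: "0 < p \<Longrightarrow> epow (max a b) p = max (epow a p) (epow b p)"
  by (metis epow_mono linorder_linear max.absorb1 max.absorb2)

lemma epow_add_le: 
  assumes "0 < p" shows "epow (a + b) p \<le> ennreal (2 powr p) * (epow a p + epow b p)"
proof -
  have dbl: "epow (c + c) p \<le> ennreal (2 powr p) * epow c p" for c
  proof (cases c)
    case (real x)
    then have "c + c = ennreal (2 * x)" by (simp flip: ennreal_plus)
    then show ?thesis using real assms
      by (simp add: epow_ennreal powr_mult flip: ennreal_mult)
  qed (simp add: ennreal_mult_top)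
  have "epow (a + b) p \<le> epow (max a b + max a b) p"
    using assms by (intro epow_mono add_mono) auto
  also have "\<dots> \<le> ennreal (2 powr p) * epow (max a b) p" by (rule dbl)
  also have "\<dots> \<le> ennreal (2 powr p) * (epow a p + epow b p)"
    using assms by (intro mult_left_mono) (auto simp: epow_max max_def)
  finally show ?thesis .
qed

lemma epow_mult_ennreal:
  assumes "0 \<le> c" "0 < p" 
  shows "epow (ennreal c * a) p = ennreal (c powr p) * epow a p"
proof (cases a)
  case (real x)
  then show ?thesis using assms
    by (simp add: epow_ennreal powr_mult flip: ennreal_mult)
next
  case top
  then show ?thesis using assms
    by (cases "c = 0") (auto simp: ennreal_mult_top ennreal_eq_0_iff)
qed

lemma eabs_ereal [simp]: "eabs (ereal a) = ennreal \<bar>a\<bar>"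
  by (simp add: eabs_def)

section \<open>Curves parameterized by arc length\<close>

lemma arc_length_curve_dist_le:
  assumes "arc_length_curve E \<gamma> l" "0 \<le> s" "s \<le> t" "t \<le> l"
  shows "dist (\<gamma> s) (\<gamma> t) \<le> t - s"
proof -
  have "ennreal (dist (\<gamma> s) (\<gamma> t)) = (\<Sum>i<length [s,t] - 1. ennreal (dist (\<gamma> ([s,t] ! i)) (\<gamma> ([s,t] ! Suc i))))"
    by simp
  also have "\<dots> \<le> curve_length \<gamma> s t"
    unfolding curve_length_def by (intro SUP_upper) (use assms in auto)
  also have "\<dots> = ennreal (t - s)" using assms by (auto simp: arc_length_curve_def)
  finally show ?thesis using assms by simp
qed

lemma curve_length_shift:
  "curve_length (\<lambda>\<tau>. \<gamma> (s + \<tau>)) a b = curve_length \<gamma> (s + a) (s + b)"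
proof -
  let ?S = "\<lambda>a b. {ts. sorted ts \<and> set ts \<subseteq> {a..b::real}}"
  have le: "curve_length (\<lambda>\<tau>. \<gamma> (s + \<tau>)) a b \<le> curve_length \<gamma> (s + a) (s + b)" for \<gamma> :: "real \<Rightarrow> 'a" and s a b
    unfolding curve_length_def
  proof (rule SUP_least)
    fix ts assume ts: "ts \<in> ?S a b"
    then have "map ((+) s) ts \<in> ?S (s + a) (s + b)" by (auto simp: sorted_iff_nth_mono)
    moreover have "(\<Sum>i<length ts - 1. ennreal (dist (\<gamma> (s + ts ! i)) (\<gamma> (s + ts ! Suc i)))) =
      (\<Sum>i<length (map ((+) s) ts) - 1. ennreal (dist (\<gamma> (map ((+) s) ts ! i)) (\<gamma> (map ((+) s) ts ! Suc i))))"
      by (intro sum.cong) auto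
    ultimately show "(\<Sum>i<length ts - 1. ennreal (dist (\<gamma> (s + ts ! i)) (\<gamma> (s + ts ! Suc i))))
       \<le> (SUP ts \<in> ?S (s + a) (s + b). \<Sum>i<length ts - 1. ennreal (dist (\<gamma> (ts ! i)) (\<gamma> (ts ! Suc i))))"
      by (auto intro!: SUP_upper2)
  qed
  show ?thesis
    using le[of \<gamma> s a b] le[of "\<lambda>\<tau>. \<gamma> (s + \<tau>)" "-s" "s + a" "s + b"] by simp
qed

lemma arc_length_subcurve:
  assumes "arc_length_curve E \<gamma> l" "0 \<le> s" "s < t" "t \<le> l"
  shows "arc_length_curve E (\<lambda>\<tau>. \<gamma> (s + \<tau>)) (t - s)"
  using assms unfolding arc_length_curve_def curve_length_shift by (auto simp: image_subset_iff)

text \<open>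
  Values outside the parameter interval are irrelevant; choosing them continuously makes
  compositions with Borel functions Borel on the whole line.
\<close>
lemma arc_length_curve_extend:
  fixes \<gamma> :: "real \<Rightarrow> 'a::metric_space"
  assumes "arc_length_curve E \<gamma> l"
  obtains \<gamma>' where "continuous_on UNIV \<gamma>'" "\<And>t. t \<in> {0..l} \<Longrightarrow> \<gamma>' t = \<gamma> t"
    "\<gamma>' \<in> borel_measurable borel"
proof
  let ?\<gamma>' = "\<lambda>t. \<gamma> (max 0 (min l t))"
  have l: "0 < l" using assms by (simp add: arc_length_curve_def)
  have "1-lipschitz_on {0..l} \<gamma>"
  proof (rule lipschitz_onI)
    fix s t assume "s \<in> {0..l}" "t \<in> {0..l}"
    then show "dist (\<gamma> s) (\<gamma> t) \<le> 1 * dist s t"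
      using arc_length_curve_dist_le[OF assms, of s t] arc_length_curve_dist_le[OF assms, of t s]
      by (cases "s \<le> t") (auto simp: dist_real_def dist_commute)
  qed simp
  then have "continuous_on {0..l} \<gamma>" by (rule lipschitz_on_continuous_on)
  then show *: "continuous_on UNIV ?\<gamma>'"
    by (rule continuous_on_compose2) (use l in \<open>auto intro!: continuous_intros\<close>)
  show "?\<gamma>' \<in> borel_measurable borel" using * by (rule borel_measurable_continuous_onI)
qed auto

lemma nn_integral_along_cong:
  fixes k :: "'a \<Rightarrow> ennreal" and s t l :: real
  assumes "\<And>t. t \<in> {0..l} \<Longrightarrow> \<gamma>' t = \<gamma> t" "0 \<le> s" "t \<le> l"
  shows "(\<integral>\<^sup>+\<tau>\<in>{s..t}. k (\<gamma> \<tau>) \<partial>lborel) = (\<integral>\<^sup>+\<tau>\<in>{s..t}. k (\<gamma>' \<tau>) \<partial>lborel)"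
  using assms by (intro nn_integral_cong) (auto simp: indicator_def)

lemma curve_integral_borel:
  assumes \<gamma>: "arc_length_curve E \<gamma> l" and g: "g \<in> borel_measurable borel"
  shows "curve_integral \<gamma> l g = (\<integral>\<^sup>+t\<in>{0..l}. g (\<gamma> t) \<partial>lborel)"
    and "(\<lambda>t. g (\<gamma> t) * indicator {0..l} t) \<in> borel_measurable borel"
proof -
  obtain \<gamma>' where \<gamma>': "\<And>t. t \<in> {0..l} \<Longrightarrow> \<gamma>' t = \<gamma> t" and [measurable]: "\<gamma>' \<in> borel_measurable borel"
    using arc_length_curve_extend[OF \<gamma>] by metis
  note g[measurable]
  have eq: "(\<lambda>t. g (\<gamma> t) * indicator {0..l} t) = (\<lambda>t. g (\<gamma>' t) * indicator {0..l} t)"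
    using \<gamma>' by (auto simp: indicator_def)
  show "(\<lambda>t. g (\<gamma> t) * indicator {0..l} t) \<in> borel_measurable borel"
    unfolding eq by measurable
  then show "curve_integral \<gamma> l g = (\<integral>\<^sup>+t\<in>{0..l}. g (\<gamma> t) \<partial>lborel)"
    unfolding curve_integral_def by (simp add: nn_integral_completion)
qed

lemma curve_integral_mono:
  assumes "\<And>t. t \<in> {0..l} \<Longrightarrow> g (\<gamma> t) \<le> h (\<gamma> t)"
  shows "curve_integral \<gamma> l g \<le> curve_integral \<gamma> l h"
  unfolding curve_integral_def
  by (intro nn_integral_mono) (use assms in \<open>auto simp: indicator_def\<close>)

lemma curve_integral_subcurve:
  assumes \<gamma>: "arc_length_curve E \<gamma> l" and st: "0 \<le> s" "s < t" "t \<le> l" and g: "g \<in> borel_measurable borel"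
  shows "curve_integral (\<lambda>\<tau>. \<gamma> (s + \<tau>)) (t - s) g = (\<integral>\<^sup>+\<tau>\<in>{s..t}. g (\<gamma> \<tau>) \<partial>lborel)"
proof -
  obtain \<gamma>' where \<gamma>': "\<And>t. t \<in> {0..l} \<Longrightarrow> \<gamma>' t = \<gamma> t" and [measurable]: "\<gamma>' \<in> borel_measurable borel"
    using arc_length_curve_extend[OF \<gamma>] by metis
  note g[measurable]
  have eq: "(\<lambda>\<tau>. g (\<gamma> \<tau>) * indicator {s..t} \<tau>) = (\<lambda>\<tau>. g (\<gamma>' \<tau>) * indicator {s..t} \<tau>)"
    using \<gamma>' st by (auto simp: indicator_def)
  have "curve_integral (\<lambda>\<tau>. \<gamma> (s + \<tau>)) (t - s) g = (\<integral>\<^sup>+\<tau>\<in>{0..t-s}. g (\<gamma> (s + \<tau>)) \<partial>lborel)"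
    by (rule curve_integral_borel(1)[OF arc_length_subcurve[OF \<gamma> st] g])
  also have "\<dots> = (\<integral>\<^sup>+\<tau>. g (\<gamma>' (s + 1 * \<tau>)) * indicator {s..t} (s + 1 * \<tau>) \<partial>lborel)"
    using \<gamma>' st by (intro nn_integral_cong) (auto simp: indicator_def)
  also have "\<dots> = (\<integral>\<^sup>+\<tau>. g (\<gamma>' \<tau>) * indicator {s..t} \<tau> \<partial>lborel)"
    by (subst (2) nn_integral_real_affine[where c = 1 and t = s]) auto
  finally show ?thesis unfolding eq .
qed

section \<open>Increments bounded by integrals\<close>

lemma nn_integral_interval_split:
  fixes G :: "real \<Rightarrow> ennreal"
  assumes "G \<in> borel_measurable borel" "s \<le> m" "m \<le> t"
  shows "(\<integral>\<^sup>+\<tau>\<in>{s..t}. G \<tau> \<partial>lborel) = (\<integral>\<^sup>+\<tau>\<in>{s..m}. G \<tau> \<partial>lborel) + (\<integral>\<^sup>+\<tau>\<in>{m..t}. G \<tau> \<partial>lborel)"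
proof -
  note assms(1)[measurable]
  have "(\<integral>\<^sup>+\<tau>\<in>{s..m}. G \<tau> \<partial>lborel) + (\<integral>\<^sup>+\<tau>\<in>{m..t}. G \<tau> \<partial>lborel) =
     (\<integral>\<^sup>+\<tau>. G \<tau> * indicator {s..m} \<tau> + G \<tau> * indicator {m..t} \<tau> \<partial>lborel)"
    by (subst nn_integral_add) auto
  also have "\<dots> = (\<integral>\<^sup>+\<tau>\<in>{s..t}. G \<tau> \<partial>lborel)"
    using assms AE_lborel_singleton[of m]
    by (intro nn_integral_cong_AE) (auto simp: indicator_def elim!: eventually_mono)
  finally show ?thesis by simp
qed

text \<open>
  Both sides behave well when an interval is cut: increments are subadditive and integrals additive.
\<close>
lemma increment_le_of_small_intervals:
  fixes G :: "real \<Rightarrow> ennreal" and f :: "real \<Rightarrow> real"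
  assumes G: "G \<in> borel_measurable borel" and "0 < \<delta>"
    and small: "\<And>s t. a \<le> s \<Longrightarrow> s \<le> t \<Longrightarrow> t \<le> b \<Longrightarrow> t - s < \<delta> \<Longrightarrow> ennreal \<bar>f s - f t\<bar> \<le> (\<integral>\<^sup>+\<tau>\<in>{s..t}. G \<tau> \<partial>lborel)"
    and st: "a \<le> s" "s \<le> t" "t \<le> b"
  shows "ennreal \<bar>f s - f t\<bar> \<le> (\<integral>\<^sup>+\<tau>\<in>{s..t}. G \<tau> \<partial>lborel)"
proof -
  have "ennreal \<bar>f s - f t\<bar> \<le> (\<integral>\<^sup>+\<tau>\<in>{s..t}. G \<tau> \<partial>lborel)"
    if "a \<le> s" "s \<le> t" "t \<le> b" "t - s < real n * (\<delta>/2)" for n s t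
    using that
  proof (induction n arbitrary: t)
    case (Suc n)
    show ?case
    proof (cases "t - s < \<delta>")
      case True then show ?thesis using small Suc.prems by auto
    next
      case False
      let ?m = "t - \<delta>/2"
      have m: "s \<le> ?m" "?m \<le> t" using False \<open>0 < \<delta>\<close> by auto
      have 1: "ennreal \<bar>f s - f ?m\<bar> \<le> (\<integral>\<^sup>+\<tau>\<in>{s..?m}. G \<tau> \<partial>lborel)"
        using Suc.prems m \<open>0 < \<delta>\<close> by (intro Suc.IH) (auto simp: algebra_simps)
      have 2: "ennreal \<bar>f ?m - f t\<bar> \<le> (\<integral>\<^sup>+\<tau>\<in>{?m..t}. G \<tau> \<partial>lborel)"
        using Suc.prems m \<open>0 < \<delta>\<close> by (intro small) auto
      have "ennreal \<bar>f s - f t\<bar> \<le> ennreal (\<bar>f s - f ?m\<bar> + \<bar>f ?m - f t\<bar>)" by (intro ennreal_leI) auto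
      also have "\<dots> = ennreal \<bar>f s - f ?m\<bar> + ennreal \<bar>f ?m - f t\<bar>" by simp
      finally show ?thesis
        using add_mono[OF 1 2] unfolding nn_integral_interval_split[OF G m] by (rule order_trans)
    qed
  qed auto
  moreover obtain n :: nat where "t - s < real n * (\<delta>/2)"
    using reals_Archimedean3[of "\<delta>/2"] \<open>0 < \<delta>\<close> by (meson half_gt_zero)
  ultimately show ?thesis using st by blast
qed

text \<open>
  On the set $A \subseteq V$ where $G < H$ one wants to use $G$, elsewhere $H$. By regularity of the
  finite measure $(G+H)\,dt$ there are a compact $K$ and an open $U$ with
  $K \subseteq A \subseteq U$ whose difference is negligible. A short interval that meets $K$ lies in
  $U \cap V$ and one applies the bound with $G$; all other short intervals avoid $K$ and one applies the
  bound with $H$. So $1_U G + (1 - 1_K) H$ controls small increments, hence all of them, and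
  it exceeds the desired integrand only on the negligible sets.
\<close>
lemma increment_le_min_on_open:
  fixes G H :: "real \<Rightarrow> ennreal" and f :: "real \<Rightarrow> real"
  assumes G: "G \<in> borel_measurable borel" and H: "H \<in> borel_measurable borel" and "open V" and "a \<le> b"
    and finG: "(\<integral>\<^sup>+\<tau>\<in>{a..b}. G \<tau> \<partial>lborel) < \<infinity>" and finH: "(\<integral>\<^sup>+\<tau>\<in>{a..b}. H \<tau> \<partial>lborel) < \<infinity>"
    and fH: "\<And>s t. a \<le> s \<Longrightarrow> s \<le> t \<Longrightarrow> t \<le> b \<Longrightarrow> ennreal \<bar>f s - f t\<bar> \<le> (\<integral>\<^sup>+\<tau>\<in>{s..t}. H \<tau> \<partial>lborel)"
    and fG: "\<And>s t. a \<le> s \<Longrightarrow> s \<le> t \<Longrightarrow> t \<le> b \<Longrightarrow> {s..t} \<subseteq> V \<Longrightarrow> ennreal \<bar>f s - f t\<bar> \<le> (\<integral>\<^sup>+\<tau>\<in>{s..t}. G \<tau> \<partial>lborel)"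
  shows "ennreal \<bar>f a - f b\<bar> \<le> (\<integral>\<^sup>+\<tau>\<in>{a..b}. (if \<tau> \<in> V then min (G \<tau>) (H \<tau>) else H \<tau>) \<partial>lborel)"
proof -
  note G[measurable] H[measurable]
  have [measurable]: "V \<in> sets borel" using \<open>open V\<close> by auto
  define A where "A = {\<tau>. \<tau> \<in> V \<and> G \<tau> < H \<tau>}"
  have A[measurable]: "A \<in> sets borel" unfolding A_def by measurable
  define \<nu> where "\<nu> = density lborel (\<lambda>\<tau>. (G \<tau> + H \<tau>) * indicator {a..b} \<tau>)"
  have sets\<nu>: "sets \<nu> = sets borel" by (simp add: \<nu>_def)
  have em: "emeasure \<nu> S = (\<integral>\<^sup>+\<tau>\<in>S. (G \<tau> + H \<tau>) * indicator {a..b} \<tau> \<partial>lborel)" if "S \<in> sets borel" for S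
    unfolding \<nu>_def using that by (subst emeasure_density) auto
  have fin: "emeasure \<nu> (space \<nu>) \<noteq> \<infinity>"
  proof -
    have "emeasure \<nu> (space \<nu>) = (\<integral>\<^sup>+\<tau>. G \<tau> * indicator {a..b} \<tau> + H \<tau> * indicator {a..b} \<tau> \<partial>lborel)"
      using em[of UNIV] sets_eq_imp_space_eq[OF sets\<nu>] by (simp add: distrib_right)
    also have "\<dots> = (\<integral>\<^sup>+\<tau>\<in>{a..b}. G \<tau> \<partial>lborel) + (\<integral>\<^sup>+\<tau>\<in>{a..b}. H \<tau> \<partial>lborel)"
      by (subst nn_integral_add) auto
    finally show ?thesis using finG finH by (simp add: less_top)
  qed
  interpret \<nu>: finite_measure \<nu> by standard (use fin in auto)
  define I where "I = (\<integral>\<^sup>+\<tau>\<in>{a..b}. (if \<tau> \<in> V then min (G \<tau>) (H \<tau>) else H \<tau>) \<partial>lborel)"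
  have *: "ennreal \<bar>f a - f b\<bar> \<le> I + ennreal (2 * \<epsilon>)" if "0 < \<epsilon>" for \<epsilon> :: real
  proof -
    have "emeasure \<nu> A < emeasure \<nu> A + ennreal \<epsilon>" 
      using that by (simp add: \<nu>.emeasure_eq_measure flip: ennreal_plus) (simp add: ennreal_lessI add_nonneg_pos)
    then obtain U where U: "A \<subseteq> U" "open U" "emeasure \<nu> U < emeasure \<nu> A + ennreal \<epsilon>"
      using outer_regular[OF sets\<nu> fin A] by (auto simp: INF_less_iff)
    have "\<exists>K. K \<subseteq> A \<and> compact K \<and> measure \<nu> A < measure \<nu> K + \<epsilon>"
    proof (cases "measure \<nu> A = 0")
      case True
      then show ?thesis using that by (intro exI[of _ "{}"]) auto
    next
      case False
      then have "ennreal (measure \<nu> A - \<epsilon>) < emeasure \<nu> A"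
        using that unfolding \<nu>.emeasure_eq_measure by (intro ennreal_lessI) (auto simp: less_le)
      then obtain K where K: "K \<subseteq> A" "compact K" "ennreal (measure \<nu> A - \<epsilon>) < emeasure \<nu> K"
        unfolding inner_regular[OF sets\<nu> fin A] by (auto simp: less_SUP_iff)
      from K(3) have "measure \<nu> A - \<epsilon> < measure \<nu> K"
        unfolding \<nu>.emeasure_eq_measure by (metis ennreal_leI linorder_not_less)
      then show ?thesis using K by (intro exI[of _ K]) auto
    qed
    then obtain K where K: "K \<subseteq> A" "compact K" "measure \<nu> A < measure \<nu> K + \<epsilon>" by auto
    have [measurable]: "K \<in> sets borel" "U \<in> sets borel" 
      using K U by (auto intro: borel_compact)
    have [simp]: "S \<in> sets \<nu> \<longleftrightarrow> S \<in> sets borel" for S using sets\<nu> by simp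
    from U(3) have "measure \<nu> U < measure \<nu> A + \<epsilon>"
      using that unfolding \<nu>.emeasure_eq_measure
      by (metis ennreal_leI ennreal_plus linorder_not_less measure_nonneg less_imp_le)
    then have UA: "measure \<nu> (U - A) \<le> \<epsilon>"
      using U by (subst \<nu>.finite_measure_Diff) auto
    have AK: "measure \<nu> (A - K) \<le> \<epsilon>"
      using K by (subst \<nu>.finite_measure_Diff) auto
    have "K \<inter> - (U \<inter> V) = {}" using K U by (auto simp: A_def)
    then obtain d where d: "0 < d" "\<And>x y. x \<in> K \<Longrightarrow> y \<in> - (U \<inter> V) \<Longrightarrow> d \<le> dist x y"
      using separate_compact_closed[of K "- (U \<inter> V)"] K U \<open>open V\<close> by (metis closed_Compl open_Int)
    define F where "F = (\<lambda>\<tau>. indicator U \<tau> * G \<tau> + indicator (- K) \<tau> * H \<tau>)"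
    have [measurable]: "F \<in> borel_measurable borel" unfolding F_def by measurable
    have "ennreal \<bar>f a - f b\<bar> \<le> (\<integral>\<^sup>+\<tau>\<in>{a..b}. F \<tau> \<partial>lborel)"
    proof (rule increment_le_of_small_intervals[where a = a and b = b and \<delta> = d])
      fix s t assume st: "a \<le> s" "s \<le> t" "t \<le> b" "t - s < d"
      show "ennreal \<bar>f s - f t\<bar> \<le> (\<integral>\<^sup>+\<tau>\<in>{s..t}. F \<tau> \<partial>lborel)"
      proof (cases "{s..t} \<inter> K = {}")
        case True
        have "(\<integral>\<^sup>+\<tau>\<in>{s..t}. H \<tau> \<partial>lborel) \<le> (\<integral>\<^sup>+\<tau>\<in>{s..t}. F \<tau> \<partial>lborel)"
          using True by (intro nn_integral_mono) (auto simp: F_def indicator_def)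
        then show ?thesis using fH[OF st(1-3)] by (rule order_trans[rotated])
      next
        case False
        then obtain x where x: "x \<in> K" "x \<in> {s..t}" by blast
        have sub: "{s..t} \<subseteq> U \<inter> V"
        proof
          fix y assume "y \<in> {s..t}"
          then have "dist x y < d" using x st by (auto simp: dist_real_def)
          then show "y \<in> U \<inter> V" using d(2)[OF x(1), of y] by auto
        qed
        have "(\<integral>\<^sup>+\<tau>\<in>{s..t}. G \<tau> \<partial>lborel) \<le> (\<integral>\<^sup>+\<tau>\<in>{s..t}. F \<tau> \<partial>lborel)"
          using sub by (intro nn_integral_mono) (auto simp: F_def indicator_def)
        then show ?thesis using fG[OF st(1-3)] sub by (meson Int_subset_iff order_trans)
      qed
    qed (use \<open>a \<le> b\<close> d in auto)
    also have "\<dots> \<le> (\<integral>\<^sup>+\<tau>. (if \<tau> \<in> V then min (G \<tau>) (H \<tau>) else H \<tau>) * indicator {a..b} \<tau> +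
       ((G \<tau> + H \<tau>) * indicator {a..b} \<tau> * indicator (U - A) \<tau> + (G \<tau> + H \<tau>) * indicator {a..b} \<tau> * indicator (A - K) \<tau>) \<partial>lborel)"
      using K(1) U(1) by (intro nn_integral_mono) (auto simp: F_def A_def indicator_def min_def)
    also have "\<dots> = I + (emeasure \<nu> (U - A) + emeasure \<nu> (A - K))"
      unfolding I_def by (simp add: nn_integral_add em)
    also have "\<dots> \<le> I + ennreal (2 * \<epsilon>)"
      unfolding \<nu>.emeasure_eq_measure using UA AK
      by (intro add_left_mono) (auto simp flip: ennreal_plus intro!: ennreal_leI)
    finally show ?thesis .
  qed
  then have "ennreal \<bar>f a - f b\<bar> \<le> I + ennreal \<epsilon>" if "0 < \<epsilon>" for \<epsilon>
    using *[of "\<epsilon> / 2"] that by simp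
  then have "ennreal \<bar>f a - f b\<bar> \<le> I"
    by (rule ennreal_le_epsilon)
  then show ?thesis unfolding I_def .
qed

lemma epow_inverse: "0 < p \<Longrightarrow> epow (epow a (1 / p)) p = a"
  by (cases a) (auto simp: epow_ennreal powr_powr)

lemma epow_inverse': "0 < p \<Longrightarrow> epow (epow a p) (1 / p) = a"
  by (cases a) (auto simp: epow_ennreal powr_powr)

lemma epow_SUP_le_suminf:
  assumes "0 < p" shows "epow (SUP n::nat. a n) p \<le> (\<Sum>n. epow (a n) p)"
proof -
  let ?S = "\<Sum>n. epow (a n) p"
  have "a n \<le> epow ?S (1 / p)" for n
  proof -
    have "epow (a n) p = (\<Sum>k\<in>{n}. epow (a k) p)" by simp
    also have "\<dots> \<le> ?S" by (rule sum_le_suminf) auto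
    finally have "epow (epow (a n) p) (1 / p) \<le> epow ?S (1 / p)" using assms by (intro epow_mono) auto
    then show ?thesis using assms by (simp add: epow_inverse')
  qed
  then have "epow (SUP n. a n) p \<le> epow (epow ?S (1 / p)) p"
    using assms by (intro epow_mono SUP_least)
  then show ?thesis using assms by (simp add: epow_inverse)
qed

section \<open>Properties of almost every curve\<close>

lemma almost_every_curve_UNIV:
  assumes "space M = UNIV"
  shows "almost_every_curve M p P \<longleftrightarrow>
     (\<exists>\<rho> \<in> borel_measurable borel. (\<integral>\<^sup>+x. epow (\<rho> x) p \<partial>M) < \<infinity> \<and>
        (\<forall>\<gamma> l. arc_length_curve UNIV \<gamma> l \<and> \<not> P \<gamma> l \<longrightarrow> curve_integral \<gamma> l \<rho> = \<infinity>))"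
proof -
  have "borel_measurable (restrict_space borel (UNIV::'a set)) = (borel_measurable borel :: ('a \<Rightarrow> ennreal) set)"
    by (intro measurable_cong_sets) (auto simp: sets_restrict_space)
  then show ?thesis unfolding almost_every_curve_def assms by simp
qed

text \<open>
  The inequality for all subcurves is what can be cut and glued; it holds along almost every curve,
  see \<open>weak_upper_gradient_iff_along\<close> below.
\<close>
definition upper_gradient_along :: "('a \<Rightarrow> real) \<Rightarrow> ('a \<Rightarrow> ennreal) \<Rightarrow> (real \<Rightarrow> 'a) \<Rightarrow> real \<Rightarrow> bool" where
  "upper_gradient_along w g \<gamma> l \<longleftrightarrow>
     (\<forall>s t. 0 \<le> s \<and> s \<le> t \<and> t \<le> l \<longrightarrow>
        ennreal \<bar>w (\<gamma> s) - w (\<gamma> t)\<bar> \<le> (\<integral>\<^sup>+\<tau>\<in>{s..t}. g (\<gamma> \<tau>) \<partial>lborel))"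

lemma almost_every_curve_mono:
  assumes "almost_every_curve M p P" "\<And>\<gamma> l. arc_length_curve (space M) \<gamma> l \<Longrightarrow> P \<gamma> l \<Longrightarrow> Q \<gamma> l"
  shows "almost_every_curve M p Q"
  using assms unfolding almost_every_curve_def by blast

locale metric_measure =
  fixes M :: "'a::metric_space measure" and p :: real
  assumes mms: "metric_measure_space M" and p_gt_1: "1 < p"
begin

abbreviation ae_curve :: "((real \<Rightarrow> 'a) \<Rightarrow> real \<Rightarrow> bool) \<Rightarrow> bool" where
  "ae_curve \<equiv> almost_every_curve M p"

abbreviation real_gradient :: "('a \<Rightarrow> real) \<Rightarrow> ('a \<Rightarrow> ennreal) \<Rightarrow> bool" where
  "real_gradient w \<equiv> weak_upper_gradient M p (\<lambda>x. ereal (w x))"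

lemma p_pos [simp]: "0 < p" using p_gt_1 by simp

lemma space_M [simp]: "space M = UNIV"
proof -
  obtain N where "sets N = sets borel" "M = completion N"
    using mms unfolding metric_measure_space_def by auto
  then show ?thesis using sets_eq_imp_space_eq[of N borel] by simp
qed

lemma sets_M_borel: "A \<in> sets borel \<Longrightarrow> A \<in> sets M"
  using mms unfolding metric_measure_space_def by auto

lemma borel_imp_measurable_M: "f \<in> borel_measurable borel \<Longrightarrow> f \<in> borel_measurable M"
  using sets_M_borel by (auto simp: measurable_def)

lemma ball_sets [measurable]: "ball x r \<in> sets M" 
  by (rule sets_M_borel) simp

text \<open>
  Enlarging a weak upper gradient trivially preserves its defining property, so the Borel
  representative is chosen from above, with value $\infty$ on the exceptional null set.
\<close>
lemma ex_borel_majorant: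
  fixes g :: "'a \<Rightarrow> ennreal"
  assumes g: "g \<in> borel_measurable M"
  obtains g' where "g' \<in> borel_measurable borel" "\<And>x. g x \<le> g' x" "AE x in M. g x = g' x"
proof -
  obtain N where N: "sets N = sets borel" "M = completion N"
    using mms unfolding metric_measure_space_def by auto
  obtain g1 where g1: "g1 \<in> borel_measurable N" "AE x in N. g x = g1 x"
    using completion_ex_borel_measurable[OF g[unfolded N(2)]] by blast
  obtain Z where Z: "{x \<in> space N. \<not> g x = g1 x} \<subseteq> Z" "emeasure N Z = 0" "Z \<in> sets N"
    using g1(2) by (rule AE_E)
  define g' where "g' = (\<lambda>x. if x \<in> Z then \<infinity> else g1 x)"
  have eq: "borel_measurable N = (borel_measurable borel :: ('a \<Rightarrow> ennreal) set)"
    by (rule measurable_cong_sets) (simp_all add: N)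
  have sp: "space N = UNIV" using sets_eq_imp_space_eq[OF N(1)] by simp
  have "g' \<in> borel_measurable N" unfolding g'_def using g1 Z by measurable
  moreover have "g x \<le> g' x" for x using Z(1) sp by (cases "x \<in> Z") (force simp: g'_def subset_iff)+
  moreover have "AE x in N. g x = g' x"
  proof -
    have "AE x in N. x \<notin> Z" using Z by (intro AE_not_in) auto
    then show ?thesis using g1(2) by eventually_elim (auto simp: g'_def)
  qed
  then have "AE x in M. g x = g' x" unfolding N(2) by (rule AE_completion)
  ultimately show ?thesis using that eq by blast
qed

lemmas almost_every_curve_iff = almost_every_curve_UNIV[OF space_M]

text \<open>
  The witnesses $\rho_n$ are scaled so that $\int (c_n\rho_n)^p \le 2^{-n}$ and combined by a supremum:
  the power of the supremum is at most $\sum_n (c_n\rho_n)^p$, which is integrable.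
\<close>
lemma almost_every_curve_all_nat:
  assumes "\<And>n::nat. ae_curve (P n)"
  shows "ae_curve (\<lambda>\<gamma> l. \<forall>n. P n \<gamma> l)"
proof -
  have "\<forall>n. \<exists>\<rho> \<in> borel_measurable borel. (\<integral>\<^sup>+x. epow (\<rho> x) p \<partial>M) < \<infinity> \<and>
        (\<forall>\<gamma> l. arc_length_curve UNIV \<gamma> l \<and> \<not> P n \<gamma> l \<longrightarrow> curve_integral \<gamma> l \<rho> = \<infinity>)"
    using assms unfolding almost_every_curve_iff by blast
  then obtain \<rho> :: "nat \<Rightarrow> 'a \<Rightarrow> ennreal" where \<rho>: "\<And>n. \<rho> n \<in> borel_measurable borel" "\<And>n. (\<integral>\<^sup>+x. epow (\<rho> n x) p \<partial>M) < \<infinity>"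
    "\<And>n \<gamma> l. arc_length_curve UNIV \<gamma> l \<Longrightarrow> \<not> P n \<gamma> l \<Longrightarrow> curve_integral \<gamma> l (\<rho> n) = \<infinity>"
    by metis
  note [measurable] = \<rho>(1) \<rho>(1)[THEN borel_imp_measurable_M]
  define I where "I n = enn2real (\<integral>\<^sup>+x. epow (\<rho> n x) p \<partial>M)" for n
  have I: "(\<integral>\<^sup>+x. epow (\<rho> n x) p \<partial>M) = ennreal (I n)" "0 \<le> I n" for n
    using \<rho>(2)[of n] by (simp_all add: I_def)
  \<comment> \<open>The summand 1 covers the case of vanishing energy.\<close>
  define c where "c n = ((1/2) ^ n / (1 + I n)) powr (1/p)" for n
  have c: "0 < c n" "c n powr p = (1/2) ^ n / (1 + I n)" for n
    using I(2)[of n] p_pos by (simp_all add: c_def powr_powr add_pos_nonneg del: p_pos) 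
  define R where "R x = (SUP n. ennreal (c n) * \<rho> n x)" for x
  have R[measurable]: "R \<in> borel_measurable borel" unfolding R_def by measurable
  have "(\<integral>\<^sup>+x. epow (R x) p \<partial>M) \<le> (\<integral>\<^sup>+x. (\<Sum>n. epow (ennreal (c n) * \<rho> n x) p) \<partial>M)"
    unfolding R_def by (intro nn_integral_mono epow_SUP_le_suminf) simp
  also have "\<dots> = (\<Sum>n. \<integral>\<^sup>+x. epow (ennreal (c n) * \<rho> n x) p \<partial>M)"
    by (intro nn_integral_suminf) measurable
  also have "\<dots> = (\<Sum>n. ennreal (c n powr p * I n))"
    using c(1) I by (intro suminf_cong) (simp add: epow_mult_ennreal less_imp_le nn_integral_cmult ennreal_mult)
  also have "\<dots> \<le> (\<Sum>n. ennreal ((1/2) ^ n))"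
  proof (intro suminf_le ennreal_leI)
    fix n 
    have "I n / (1 + I n) \<le> 1" using I(2)[of n] by simp
    then show "c n powr p * I n \<le> (1/2) ^ n" unfolding c(2)
      by (metis mult.commute mult.right_neutral mult_left_mono times_divide_eq_left times_divide_eq_right zero_le_divide_1_iff zero_le_numeral zero_le_power)
  qed auto
  also have "\<dots> = ennreal (\<Sum>n. (1/2) ^ n)"
    by (intro suminf_ennreal2) auto
  also have "\<dots> < \<infinity>" by simp
  finally have fin: "(\<integral>\<^sup>+x. epow (R x) p \<partial>M) < \<infinity>" .
  have "curve_integral \<gamma> l R = \<infinity>" if \<gamma>: "arc_length_curve UNIV \<gamma> l" and P: "\<not> P n \<gamma> l" for \<gamma> l n
  proof -
    have "\<infinity> = ennreal (c n) * curve_integral \<gamma> l (\<rho> n)"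
      using \<rho>(3)[OF \<gamma> P] c(1)[of n] by (simp add: ennreal_mult_top)
    also have "\<dots> = (\<integral>\<^sup>+t. ennreal (c n) * (\<rho> n (\<gamma> t) * indicator {0..l} t) \<partial>lborel)"
      unfolding curve_integral_borel(1)[OF \<gamma> \<rho>(1)] 
      by (rule nn_integral_cmult[symmetric]) (use curve_integral_borel(2)[OF \<gamma> \<rho>(1)] in simp)
    also have "\<dots> \<le> (\<integral>\<^sup>+t\<in>{0..l}. R (\<gamma> t) \<partial>lborel)"
      unfolding R_def by (intro nn_integral_mono) (auto simp: indicator_def intro!: SUP_upper)
    finally show ?thesis unfolding curve_integral_borel(1)[OF \<gamma> R] by (simp add: top_unique)
  qed
  then show ?thesis unfolding almost_every_curve_iff using R fin by blast
qed

lemma almost_every_curve_conj: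
  assumes "ae_curve P" "ae_curve Q"
  shows "ae_curve (\<lambda>\<gamma> l. P \<gamma> l \<and> Q \<gamma> l)"
proof -
  have "ae_curve (\<lambda>\<gamma> l. \<forall>n::nat. (if n = 0 then P else Q) \<gamma> l)"
    using assms by (intro almost_every_curve_all_nat) auto
  then show ?thesis by (rule almost_every_curve_mono) (metis zero_neq_one)
qed

text \<open>
  If the integral of the witness is infinite along a subcurve, it is infinite along the whole curve.
\<close>
lemma almost_every_curve_subcurves:
  assumes "ae_curve P"
  shows "ae_curve (\<lambda>\<gamma> l. \<forall>s t. 0 \<le> s \<and> s < t \<and> t \<le> l \<longrightarrow> P (\<lambda>\<tau>. \<gamma> (s + \<tau>)) (t - s))"
proof -
  obtain \<rho> where \<rho>: "\<rho> \<in> borel_measurable borel" "(\<integral>\<^sup>+x. epow (\<rho> x) p \<partial>M) < \<infinity>"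
     "\<And>\<gamma> l. arc_length_curve UNIV \<gamma> l \<Longrightarrow> \<not> P \<gamma> l \<Longrightarrow> curve_integral \<gamma> l \<rho> = \<infinity>"
    using assms unfolding almost_every_curve_iff by blast
  have "curve_integral \<gamma> l \<rho> = \<infinity>"
    if \<gamma>: "arc_length_curve UNIV \<gamma> l" and st: "0 \<le> s" "s < t" "t \<le> l" and P: "\<not> P (\<lambda>\<tau>. \<gamma> (s + \<tau>)) (t - s)" for \<gamma> l s t
  proof -
    have "\<infinity> = curve_integral (\<lambda>\<tau>. \<gamma> (s + \<tau>)) (t - s) \<rho>"
      using \<rho>(3)[OF arc_length_subcurve[OF \<gamma> st] P] by simp
    also have "\<dots> = (\<integral>\<^sup>+\<tau>\<in>{s..t}. \<rho> (\<gamma> \<tau>) \<partial>lborel)" by (rule curve_integral_subcurve[OF \<gamma> st \<rho>(1)])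
    also have "\<dots> \<le> (\<integral>\<^sup>+\<tau>\<in>{0..l}. \<rho> (\<gamma> \<tau>) \<partial>lborel)"
      using st by (intro nn_integral_mono) (auto simp: indicator_def)
    finally show ?thesis unfolding curve_integral_borel(1)[OF \<gamma> \<rho>(1)] by (simp add: top_unique)
  qed
  then show ?thesis unfolding almost_every_curve_iff using \<rho>(1,2) by blast
qed

lemma almost_every_curve_finite_integral:
  assumes "g \<in> borel_measurable borel" "(\<integral>\<^sup>+x. epow (g x) p \<partial>M) < \<infinity>"
  shows "ae_curve (\<lambda>\<gamma> l. curve_integral \<gamma> l g < \<infinity>)"
  unfolding almost_every_curve_iff using assms by (intro bexI[of _ g]) (auto simp: not_less top_unique)

section \<open>Operations on weak upper gradients\<close>

lemma weak_upper_gradient_iff_along: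
  assumes g: "g \<in> borel_measurable borel"
  shows "real_gradient w g \<longleftrightarrow> ae_curve (upper_gradient_along w g)"
proof
  assume "real_gradient w g"
  then have "ae_curve (\<lambda>\<gamma> l. ennreal \<bar>w (\<gamma> 0) - w (\<gamma> l)\<bar> \<le> curve_integral \<gamma> l g)"
    by (simp add: weak_upper_gradient_def)
  from almost_every_curve_subcurves[OF this] show "ae_curve (upper_gradient_along w g)"
  proof (rule almost_every_curve_mono)
    fix \<gamma> l assume \<gamma>: "arc_length_curve (space M) \<gamma> l" and 
      *: "\<forall>s t. 0 \<le> s \<and> s < t \<and> t \<le> l \<longrightarrow>
              ennreal \<bar>w (\<gamma> (s + 0)) - w (\<gamma> (s + (t - s)))\<bar> \<le> curve_integral (\<lambda>\<tau>. \<gamma> (s + \<tau>)) (t - s) g"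
    show "upper_gradient_along w g \<gamma> l"
      unfolding upper_gradient_along_def
    proof (intro allI impI)
      fix s t assume st: "0 \<le> s \<and> s \<le> t \<and> t \<le> l"
      show "ennreal \<bar>w (\<gamma> s) - w (\<gamma> t)\<bar> \<le> (\<integral>\<^sup>+\<tau>\<in>{s..t}. g (\<gamma> \<tau>) \<partial>lborel)"
      proof (cases "s = t")
        case False
        then show ?thesis using *[rule_format, of s t] st curve_integral_subcurve[OF \<gamma>, of s t g] g by auto
      qed simp
    qed
  qed
next
  assume *: "ae_curve (upper_gradient_along w g)"
  have "ae_curve (\<lambda>\<gamma> l. ennreal \<bar>w (\<gamma> 0) - w (\<gamma> l)\<bar> \<le> curve_integral \<gamma> l g)"
    using *
  proof (rule almost_every_curve_mono)
    fix \<gamma> l assume \<gamma>: "arc_length_curve (space M) \<gamma> l" and *: "upper_gradient_along w g \<gamma> l"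
    then have "0 \<le> l" by (simp add: arc_length_curve_def)
    then show "ennreal \<bar>w (\<gamma> 0) - w (\<gamma> l)\<bar> \<le> curve_integral \<gamma> l g"
      using * unfolding curve_integral_borel(1)[OF \<gamma> g] upper_gradient_along_def by auto
  qed
  then show "real_gradient w g"
    using g by (simp add: weak_upper_gradient_def borel_imp_measurable_M)
qed

lemma weak_upper_gradient_majorant:
  assumes "weak_upper_gradient M p w g" "g' \<in> borel_measurable borel" "\<And>x. g x \<le> g' x"
  shows "weak_upper_gradient M p w g'"
proof -
  have "ae_curve (\<lambda>\<gamma> l. eabs (w (\<gamma> 0) - w (\<gamma> l)) \<le> curve_integral \<gamma> l g)"
    using assms(1) by (simp add: weak_upper_gradient_def)
  then have "ae_curve (\<lambda>\<gamma> l. eabs (w (\<gamma> 0) - w (\<gamma> l)) \<le> curve_integral \<gamma> l g')"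
    by (rule almost_every_curve_mono) (meson assms(3) curve_integral_mono order_trans)
  then show ?thesis using assms(2) by (simp add: weak_upper_gradient_def borel_imp_measurable_M)
qed

text \<open>
  Along a good curve this is \<open>increment_le_min_on_open\<close>, applied to the preimage of \<open>V\<close>.
\<close>
lemma weak_upper_gradient_min_on_open:
  assumes g[measurable]: "g \<in> borel_measurable borel" and h[measurable]: "h \<in> borel_measurable borel" and V: "open V"
    and wh: "real_gradient w h"
    and wg: "ae_curve (\<lambda>\<gamma> l. \<forall>s t. 0 \<le> s \<and> s \<le> t \<and> t \<le> l \<and> \<gamma> ` {s..t} \<subseteq> V \<longrightarrow>
        ennreal \<bar>w (\<gamma> s) - w (\<gamma> t)\<bar> \<le> (\<integral>\<^sup>+\<tau>\<in>{s..t}. g (\<gamma> \<tau>) \<partial>lborel))"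
    and fing: "ae_curve (\<lambda>\<gamma> l. curve_integral \<gamma> l g < \<infinity>)"
    and finh: "ae_curve (\<lambda>\<gamma> l. curve_integral \<gamma> l h < \<infinity>)"
  shows "real_gradient w (\<lambda>x. if x \<in> V then min (g x) (h x) else h x)"
proof -
  have [measurable]: "V \<in> sets borel" using V by auto
  have m: "(\<lambda>x. if x \<in> V then min (g x) (h x) else h x) \<in> borel_measurable borel" by measurable
  have "ae_curve (upper_gradient_along w h)"
    using wh by (simp add: weak_upper_gradient_iff_along)
  from almost_every_curve_conj[OF this almost_every_curve_conj[OF wg almost_every_curve_conj[OF fing finh]]]
  have "ae_curve (upper_gradient_along w (\<lambda>x. if x \<in> V then min (g x) (h x) else h x))"
  proof (rule almost_every_curve_mono, elim conjE)
    fix \<gamma> l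
    assume \<gamma>: "arc_length_curve (space M) \<gamma> l" and 1: "upper_gradient_along w h \<gamma> l"
      and 2: "\<forall>s t. 0 \<le> s \<and> s \<le> t \<and> t \<le> l \<and> \<gamma> ` {s..t} \<subseteq> V \<longrightarrow>
        ennreal \<bar>w (\<gamma> s) - w (\<gamma> t)\<bar> \<le> (\<integral>\<^sup>+\<tau>\<in>{s..t}. g (\<gamma> \<tau>) \<partial>lborel)"
      and 3: "curve_integral \<gamma> l g < \<infinity>" "curve_integral \<gamma> l h < \<infinity>"
    obtain \<gamma>' where \<gamma>': "continuous_on UNIV \<gamma>'" "\<And>t. t \<in> {0..l} \<Longrightarrow> \<gamma>' t = \<gamma> t"
      and [measurable]: "\<gamma>' \<in> borel_measurable borel"
      using arc_length_curve_extend[OF \<gamma>] by metis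
    note eq = nn_integral_along_cong[of l \<gamma>' \<gamma>, OF \<gamma>'(2)]
    show "upper_gradient_along w (\<lambda>x. if x \<in> V then min (g x) (h x) else h x) \<gamma> l"
      unfolding upper_gradient_along_def
    proof (intro allI impI, elim conjE)
      fix a b assume ab: "0 \<le> a" "a \<le> b" "b \<le> l"
      have fin: "(\<integral>\<^sup>+\<tau>\<in>{a..b}. k (\<gamma>' \<tau>) \<partial>lborel) < \<infinity>"
        if k: "k \<in> borel_measurable borel" "curve_integral \<gamma> l k < \<infinity>" for k :: "'a \<Rightarrow> ennreal"
      proof -
        have "(\<integral>\<^sup>+\<tau>\<in>{a..b}. k (\<gamma>' \<tau>) \<partial>lborel) \<le> (\<integral>\<^sup>+\<tau>\<in>{0..l}. k (\<gamma>' \<tau>) \<partial>lborel)"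
          using ab by (intro nn_integral_mono) (auto simp: indicator_def)
        also have "\<dots> = curve_integral \<gamma> l k"
          using curve_integral_borel(1)[OF \<gamma> k(1)] eq[of 0 l k] by simp
        finally show ?thesis using k(2) by simp
      qed
      have "ennreal \<bar>w (\<gamma>' a) - w (\<gamma>' b)\<bar> \<le>
         (\<integral>\<^sup>+\<tau>\<in>{a..b}. (if \<tau> \<in> \<gamma>' -` V then min (g (\<gamma>' \<tau>)) (h (\<gamma>' \<tau>)) else h (\<gamma>' \<tau>)) \<partial>lborel)"
      proof (rule increment_le_min_on_open[where f = "\<lambda>\<tau>. w (\<gamma>' \<tau>)"])
        show "open (\<gamma>' -` V)" using V \<gamma>'(1) by (simp add: open_vimage)
        show "(\<integral>\<^sup>+\<tau>\<in>{a..b}. g (\<gamma>' \<tau>) \<partial>lborel) < \<infinity>" "(\<integral>\<^sup>+\<tau>\<in>{a..b}. h (\<gamma>' \<tau>) \<partial>lborel) < \<infinity>"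
          using fin g h 3 by auto
        show "ennreal \<bar>w (\<gamma>' s) - w (\<gamma>' t)\<bar> \<le> (\<integral>\<^sup>+\<tau>\<in>{s..t}. h (\<gamma>' \<tau>) \<partial>lborel)"
          if "a \<le> s" "s \<le> t" "t \<le> b" for s t
          using 1[unfolded upper_gradient_along_def, rule_format, of s t] that ab eq[of s t h] \<gamma>'(2)[of s] \<gamma>'(2)[of t] by auto
        show "ennreal \<bar>w (\<gamma>' s) - w (\<gamma>' t)\<bar> \<le> (\<integral>\<^sup>+\<tau>\<in>{s..t}. g (\<gamma>' \<tau>) \<partial>lborel)"
          if "a \<le> s" "s \<le> t" "t \<le> b" "{s..t} \<subseteq> \<gamma>' -` V" for s t
        proof -
          have "\<gamma> ` {s..t} \<subseteq> V" using that ab \<gamma>'(2) by (force simp: subset_iff)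
          then show ?thesis using 2[rule_format, of s t] that ab eq[of s t g] \<gamma>'(2)[of s] \<gamma>'(2)[of t] by auto
        qed
      qed (use ab in auto)
      then show "ennreal \<bar>w (\<gamma> a) - w (\<gamma> b)\<bar> \<le>
         (\<integral>\<^sup>+\<tau>\<in>{a..b}. (if \<gamma> \<tau> \<in> V then min (g (\<gamma> \<tau>)) (h (\<gamma> \<tau>)) else h (\<gamma> \<tau>)) \<partial>lborel)"
        using ab eq[of a b "\<lambda>x. if x \<in> V then min (g x) (h x) else h x"] \<gamma>'(2)[of a] \<gamma>'(2)[of b] by simp
    qed
  qed
  then show ?thesis using weak_upper_gradient_iff_along[OF m] by simp
qed

corollary weak_upper_gradient_min:
  assumes g[measurable]: "g \<in> borel_measurable borel" and h[measurable]: "h \<in> borel_measurable borel"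
    and wg: "real_gradient w g"
    and wh: "real_gradient w h"
    and fing: "ae_curve (\<lambda>\<gamma> l. curve_integral \<gamma> l g < \<infinity>)"
    and finh: "ae_curve (\<lambda>\<gamma> l. curve_integral \<gamma> l h < \<infinity>)"
  shows "real_gradient w (\<lambda>x. min (g x) (h x))"
proof -
  have "ae_curve (upper_gradient_along w g)"
    using wg by (simp add: weak_upper_gradient_iff_along)
  then have "ae_curve (\<lambda>\<gamma> l. \<forall>s t. 0 \<le> s \<and> s \<le> t \<and> t \<le> l \<and> \<gamma> ` {s..t} \<subseteq> UNIV \<longrightarrow>
        ennreal \<bar>w (\<gamma> s) - w (\<gamma> t)\<bar> \<le> (\<integral>\<^sup>+\<tau>\<in>{s..t}. g (\<gamma> \<tau>) \<partial>lborel))"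
    by (rule almost_every_curve_mono) (auto simp: upper_gradient_along_def)
  from weak_upper_gradient_min_on_open[OF g h open_UNIV wh this fing finh] show ?thesis by simp
qed

corollary weak_upper_gradient_zero_on_open:
  assumes h[measurable]: "h \<in> borel_measurable borel" and "open V"
    and wh: "real_gradient w h"
    and finh: "ae_curve (\<lambda>\<gamma> l. curve_integral \<gamma> l h < \<infinity>)"
    and c: "\<And>x. x \<in> V \<Longrightarrow> w x = c"
  shows "real_gradient w (\<lambda>x. if x \<in> V then 0 else h x)"
proof -
  have 1: "ae_curve (\<lambda>\<gamma> l. \<forall>s t. 0 \<le> s \<and> s \<le> t \<and> t \<le> l \<and> \<gamma> ` {s..t} \<subseteq> V \<longrightarrow>
        ennreal \<bar>w (\<gamma> s) - w (\<gamma> t)\<bar> \<le> (\<integral>\<^sup>+\<tau>\<in>{s..t}. 0 \<partial>lborel))"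
    using finh by (rule almost_every_curve_mono) (auto simp: c image_subset_iff)
  have 2: "ae_curve (\<lambda>\<gamma> l. curve_integral \<gamma> l (\<lambda>_. 0) < \<infinity>)"
    using finh by (rule almost_every_curve_mono) (simp add: curve_integral_def)
  from weak_upper_gradient_min_on_open[OF _ h \<open>open V\<close> wh 1 2 finh] show ?thesis
    by (simp add: min_def cong: if_cong)
qed



text \<open>
  By separability countably many balls with $\int g^p < \infty$ cover the space; almost every curve has
  finite integral of $g$ in each of them, and being compact it is covered by finitely many.
\<close>
lemma almost_every_curve_finite_integral_Lp_loc:
  assumes D: "countable D" "closure D = (UNIV :: 'a set)" and g[measurable]: "g \<in> borel_measurable borel" and loc: "Lp_loc M p g"
  shows "ae_curve (\<lambda>\<gamma> l. curve_integral \<gamma> l g < \<infinity>)"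
proof -
  define b :: "'a \<times> nat \<Rightarrow> 'a set" where "b z = ball (fst z) (1 / real (Suc (snd z)))" for z
  define B where "B = {z \<in> D \<times> UNIV. (\<integral>\<^sup>+y\<in>b z. epow (g y) p \<partial>M) < \<infinity>}"
  have cB: "countable B" unfolding B_def using D(1) by (auto intro: countable_subset[of _ "D \<times> UNIV"])
  have cover: "\<exists>z\<in>B. x \<in> b z" for x
  proof -
    obtain r where r: "0 < r" "(\<integral>\<^sup>+y\<in>ball x r. epow (g y) p \<partial>M) < \<infinity>"
      using loc by (auto simp: Lp_loc_def)
    obtain n where n: "1 / real (Suc n) < r / 2" using nat_approx_posE[of "r/2"] r by auto
    have "x \<in> closure D" using D(2) by simp
    then obtain q where q: "q \<in> D" "dist q x < 1 / real (Suc n)"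
      unfolding closure_approachable by (meson divide_pos_pos of_nat_0_less_iff zero_less_Suc zero_less_one)
    have "b (q, n) \<subseteq> ball x r"
    proof
      fix y assume "y \<in> b (q, n)"
      then have "dist q y < 1 / real (Suc n)" by (simp add: b_def)
      then have "dist x y < r" using dist_triangle[of x y q] q(2) n by (simp add: dist_commute)
      then show "y \<in> ball x r" by simp
    qed
    then have "(\<integral>\<^sup>+y\<in>b (q, n). epow (g y) p \<partial>M) \<le> (\<integral>\<^sup>+y\<in>ball x r. epow (g y) p \<partial>M)"
      by (intro nn_integral_mono) (auto simp: indicator_def)
    then have "(q, n) \<in> B" using q r unfolding B_def by auto
    moreover have "x \<in> b (q, n)" using q by (simp add: b_def)
    ultimately show ?thesis by blast
  qed
  then have neB: "B \<noteq> {}" by blast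
  have bm[measurable]: "b z \<in> sets borel" for z by (simp add: b_def)
  have *: "ae_curve (\<lambda>\<gamma> l. curve_integral \<gamma> l (\<lambda>x. g x * indicator (b z) x) < \<infinity>)" if "z \<in> B" for z
  proof (rule almost_every_curve_finite_integral)
    have "(\<integral>\<^sup>+x. epow (g x * indicator (b z) x) p \<partial>M) = (\<integral>\<^sup>+y\<in>b z. epow (g y) p \<partial>M)"
      by (intro nn_integral_cong) (auto simp: indicator_def)
    then show "(\<integral>\<^sup>+x. epow (g x * indicator (b z) x) p \<partial>M) < \<infinity>" using that by (simp add: B_def)
  qed measurable
  have "ae_curve (\<lambda>\<gamma> l. \<forall>n. curve_integral \<gamma> l (\<lambda>x. g x * indicator (b (from_nat_into B n)) x) < \<infinity>)"
    by (intro almost_every_curve_all_nat * from_nat_into neB)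
  then show ?thesis
  proof (rule almost_every_curve_mono)
    fix \<gamma> l assume \<gamma>: "arc_length_curve (space M) \<gamma> l"
      and fin: "\<forall>n. curve_integral \<gamma> l (\<lambda>x. g x * indicator (b (from_nat_into B n)) x) < \<infinity>"
    have fin': "curve_integral \<gamma> l (\<lambda>x. g x * indicator (b z) x) < \<infinity>" if "z \<in> B" for z
      using fin from_nat_into_surj[OF cB that] by metis
    obtain \<gamma>' where \<gamma>': "continuous_on UNIV \<gamma>'" "\<And>t. t \<in> {0..l} \<Longrightarrow> \<gamma>' t = \<gamma> t"
      using arc_length_curve_extend[OF \<gamma>] by metis
    have "compact (\<gamma>' ` {0..l})" 
      by (rule compact_continuous_image) (use continuous_on_subset[OF \<gamma>'(1)] in auto)
    then obtain F where F: "F \<subseteq> B" "finite F" "\<gamma>' ` {0..l} \<subseteq> \<Union> (b ` F)"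
      using compactE_image[of "\<gamma>' ` {0..l}" B b] cover by (metis UN_I b_def open_ball subsetI)
    have "curve_integral \<gamma> l g = (\<integral>\<^sup>+t\<in>{0..l}. g (\<gamma> t) \<partial>lborel)"
      by (rule curve_integral_borel[OF \<gamma>]) simp
    also have "\<dots> \<le> (\<integral>\<^sup>+t. (\<Sum>z\<in>F. g (\<gamma> t) * indicator (b z) (\<gamma> t) * indicator {0..l} t) \<partial>lborel)"
    proof (rule nn_integral_mono)
      fix t
      show "g (\<gamma> t) * indicator {0..l} t \<le> (\<Sum>z\<in>F. g (\<gamma> t) * indicator (b z) (\<gamma> t) * indicator {0..l} t)"
      proof (cases "t \<in> {0..l}")
        case True
        then obtain z where z: "z \<in> F" "\<gamma> t \<in> b z" using F(3) \<gamma>'(2)[OF True] by force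
        then have "g (\<gamma> t) * indicator {0..l} t = g (\<gamma> t) * indicator (b z) (\<gamma> t) * indicator {0..l} t" by simp
        also have "\<dots> \<le> (\<Sum>z\<in>F. g (\<gamma> t) * indicator (b z) (\<gamma> t) * indicator {0..l} t)"
          using z F(2) by (intro member_le_sum) auto
        finally show ?thesis .
      qed auto
    qed
    also have "\<dots> = (\<Sum>z\<in>F. \<integral>\<^sup>+t. g (\<gamma> t) * indicator (b z) (\<gamma> t) * indicator {0..l} t \<partial>lborel)"
      by (intro nn_integral_sum) (use curve_integral_borel(2)[OF \<gamma>, of "\<lambda>x. g x * indicator (b _) x"] in simp)
    also have "\<dots> = (\<Sum>z\<in>F. curve_integral \<gamma> l (\<lambda>x. g x * indicator (b z) x))"
      by (intro sum.cong refl curve_integral_borel(1)[OF \<gamma>, symmetric]) measurable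
    also have "\<dots> < \<infinity>" using fin' F(1,2) by (auto simp: less_top)
    finally show "curve_integral \<gamma> l g < \<infinity>" .
  qed
qed

lemma Lp_loc_of_balls:
  assumes "g \<in> borel_measurable M" "\<And>n::nat. (\<integral>\<^sup>+y\<in>ball x0 (real n). epow (g y) p \<partial>M) < \<infinity>"
  shows "Lp_loc M p g"
  unfolding Lp_loc_def
proof (intro conjI ballI assms(1))
  fix x
  obtain n where n: "dist x0 x + 1 < real n" using reals_Archimedean2 by blast
  have "(\<integral>\<^sup>+y\<in>ball x 1. epow (g y) p \<partial>M) \<le> (\<integral>\<^sup>+y\<in>ball x0 (real n). epow (g y) p \<partial>M)"
  proof (intro nn_integral_mono)
    fix y
    have "dist x y < 1 \<Longrightarrow> dist x0 y < real n" using n dist_triangle[of x0 y x] by simp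
    then show "epow (g y) p * indicator (ball x 1) y \<le> epow (g y) p * indicator (ball x0 (real n)) y"
      by (auto simp: indicator_def)
  qed
  then show "\<exists>r>0. (\<integral>\<^sup>+y\<in>ball x r. epow (g y) p \<partial>M) < \<infinity>"
    using assms(2)[of n] by (intro exI[of _ 1]) auto
qed

lemma weak_upper_gradient_restrict_extend:
  assumes G: "open G" and wug: "weak_upper_gradient (restrict_space M G) p (\<lambda>x. ereal (w x)) g"
    and fin: "(\<integral>\<^sup>+x. epow (g x) p \<partial>restrict_space M G) < \<infinity>"
  obtains g' where "g' \<in> borel_measurable borel" "(\<integral>\<^sup>+x. epow (g' x) p \<partial>M) < \<infinity>"
    "ae_curve (\<lambda>\<gamma> l. \<forall>s t. 0 \<le> s \<and> s \<le> t \<and> t \<le> l \<and> \<gamma> ` {s..t} \<subseteq> G \<longrightarrow>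
        ennreal \<bar>w (\<gamma> s) - w (\<gamma> t)\<bar> \<le> (\<integral>\<^sup>+\<tau>\<in>{s..t}. g' (\<gamma> \<tau>) \<partial>lborel))"
proof -
  have G_M: "G \<in> sets M" using G by (simp add: sets_M_borel)
  have sp: "space (restrict_space M G) = G" by (simp add: space_restrict_space)
  define g1 where "g1 x = g x * indicator G x" for x
  have "g1 \<in> borel_measurable M"
    using wug G_M unfolding g1_def weak_upper_gradient_def
    by (subst (asm) borel_measurable_restrict_space_iff_ennreal) (auto simp: mult.commute)
  then obtain g' where g': "g' \<in> borel_measurable borel" "\<And>x. g1 x \<le> g' x" "AE x in M. g1 x = g' x"
    using ex_borel_majorant by metis
  have "(\<integral>\<^sup>+x. epow (g' x) p \<partial>M) = (\<integral>\<^sup>+x. epow (g1 x) p \<partial>M)"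
    using g'(3) by (intro nn_integral_cong_AE) auto
  also have "\<dots> = (\<integral>\<^sup>+x. epow (g x) p \<partial>restrict_space M G)"
    using G_M by (subst nn_integral_restrict_space) (auto simp: g1_def indicator_def intro!: nn_integral_cong)
  finally have fin': "(\<integral>\<^sup>+x. epow (g' x) p \<partial>M) < \<infinity>" using fin by simp
  obtain \<rho> where \<rho>: "\<rho> \<in> borel_measurable (restrict_space borel G)" "(\<integral>\<^sup>+x. epow (\<rho> x) p \<partial>restrict_space M G) < \<infinity>"
    "\<And>\<gamma> l. arc_length_curve G \<gamma> l \<Longrightarrow> \<not> eabs (ereal (w (\<gamma> 0)) - ereal (w (\<gamma> l))) \<le> curve_integral \<gamma> l g \<Longrightarrow> curve_integral \<gamma> l \<rho> = \<infinity>"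
    using wug unfolding weak_upper_gradient_def almost_every_curve_def sp by blast
  define \<rho>1 where "\<rho>1 x = \<rho> x * indicator G x" for x
  have \<rho>1: "\<rho>1 \<in> borel_measurable borel"
    using \<rho>(1) G unfolding \<rho>1_def 
    by (subst (asm) borel_measurable_restrict_space_iff_ennreal) (auto simp: mult.commute)
  have "(\<integral>\<^sup>+x. epow (\<rho>1 x) p \<partial>M) = (\<integral>\<^sup>+x. epow (\<rho> x) p \<partial>restrict_space M G)"
    using G_M by (subst nn_integral_restrict_space) (auto simp: \<rho>1_def indicator_def intro!: nn_integral_cong)
  then have \<rho>1_fin: "(\<integral>\<^sup>+x. epow (\<rho>1 x) p \<partial>M) < \<infinity>" using \<rho>(2) by simp
  have cong: "curve_integral \<gamma> l f = curve_integral \<gamma> l (\<lambda>x. f x * indicator G x)" if "arc_length_curve G \<gamma> l" 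
    for \<gamma> l and f :: "'a \<Rightarrow> ennreal"
    unfolding curve_integral_def using that by (intro nn_integral_cong) (auto simp: indicator_def arc_length_curve_def image_subset_iff)
  have "ae_curve (\<lambda>\<gamma> l. \<gamma> ` {0..l} \<subseteq> G \<longrightarrow> ennreal \<bar>w (\<gamma> 0) - w (\<gamma> l)\<bar> \<le> curve_integral \<gamma> l g')"
    unfolding almost_every_curve_iff
  proof (intro bexI[of _ \<rho>1] conjI \<rho>1 \<rho>1_fin allI impI, elim conjE)
    fix \<gamma> l assume \<gamma>: "arc_length_curve UNIV \<gamma> l" "\<not> (\<gamma> ` {0..l} \<subseteq> G \<longrightarrow> ennreal \<bar>w (\<gamma> 0) - w (\<gamma> l)\<bar> \<le> curve_integral \<gamma> l g')"
    then have \<gamma>G: "arc_length_curve G \<gamma> l" by (auto simp: arc_length_curve_def)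
    have "curve_integral \<gamma> l g = curve_integral \<gamma> l g1" using cong[OF \<gamma>G, of g] by (simp add: g1_def[abs_def])
    also have "\<dots> \<le> curve_integral \<gamma> l g'" using g'(2) by (intro curve_integral_mono)
    finally have "curve_integral \<gamma> l \<rho> = \<infinity>"
      using \<gamma>(2) by (intro \<rho>(3)[OF \<gamma>G]) auto
    then show "curve_integral \<gamma> l \<rho>1 = \<infinity>"
      using cong[OF \<gamma>G, of \<rho>] by (simp add: \<rho>1_def[abs_def])
  qed
  from almost_every_curve_subcurves[OF this]
  have "ae_curve (\<lambda>\<gamma> l. \<forall>s t. 0 \<le> s \<and> s \<le> t \<and> t \<le> l \<and> \<gamma> ` {s..t} \<subseteq> G \<longrightarrow>
        ennreal \<bar>w (\<gamma> s) - w (\<gamma> t)\<bar> \<le> (\<integral>\<^sup>+\<tau>\<in>{s..t}. g' (\<gamma> \<tau>) \<partial>lborel))"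
  proof (rule almost_every_curve_mono, intro allI impI, elim conjE)
    fix \<gamma> l s t
    assume \<gamma>: "arc_length_curve (space M) \<gamma> l" and st: "0 \<le> s" "s \<le> t" "t \<le> l" "\<gamma> ` {s..t} \<subseteq> G"
      and *: "\<forall>s t. 0 \<le> s \<and> s < t \<and> t \<le> l \<longrightarrow> (\<lambda>\<tau>. \<gamma> (s + \<tau>)) ` {0..t - s} \<subseteq> G \<longrightarrow>
            ennreal \<bar>w (\<gamma> (s + 0)) - w (\<gamma> (s + (t - s)))\<bar> \<le> curve_integral (\<lambda>\<tau>. \<gamma> (s + \<tau>)) (t - s) g'"
    show "ennreal \<bar>w (\<gamma> s) - w (\<gamma> t)\<bar> \<le> (\<integral>\<^sup>+\<tau>\<in>{s..t}. g' (\<gamma> \<tau>) \<partial>lborel)"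
    proof (cases "s = t")
      case False
      have "(\<lambda>\<tau>. \<gamma> (s + \<tau>)) ` {0..t - s} \<subseteq> G" using st by (auto simp: image_subset_iff)
      then show ?thesis
        using *[rule_format, of s t] st False curve_integral_subcurve[OF \<gamma>, of s t g'] g' by auto
    qed simp
  qed
  then show thesis by (rule that[OF g'(1) fin'])
qed

text \<open>
  Let \<open>m x\<close> be the integer part of the distance of \<open>x\<close> to the centre. A piece of a curve of length
  less than $1$ that starts at a point with $m = k$ stays in the ball of radius $k + 2$, and $m$ takes only the
  values $k-1$, $k$ and $k+1$ on it. So the gradient for radius $k+2$ occurs in the maximum of those for
  radii $m+1$, $m+2$ and $m+3$ at every point of the piece.
\<close>
lemma weak_upper_gradient_glue:
  fixes x0 :: 'a
  assumes "\<And>n::nat. \<exists>g. weak_upper_gradient (restrict_space M (ball x0 (real n))) p (\<lambda>x. ereal (w x)) g \<and>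
      (\<integral>\<^sup>+x. epow (g x) p \<partial>restrict_space M (ball x0 (real n))) < \<infinity>"
  obtains g where "g \<in> borel_measurable borel" "real_gradient w g"
    "\<And>n::nat. (\<integral>\<^sup>+x\<in>ball x0 (real n). epow (g x) p \<partial>M) < \<infinity>"
proof -
  \<comment> \<open>A Borel function on the whole space that is a gradient inside the ball of radius \<open>n\<close>.\<close>
  define good where "good n g' \<longleftrightarrow> g' \<in> borel_measurable borel \<and> (\<integral>\<^sup>+x. epow (g' x) p \<partial>M) < \<infinity> \<and>
    ae_curve (\<lambda>\<gamma> l. \<forall>s t. 0 \<le> s \<and> s \<le> t \<and> t \<le> l \<and> \<gamma> ` {s..t} \<subseteq> ball x0 (real n) \<longrightarrow>
        ennreal \<bar>w (\<gamma> s) - w (\<gamma> t)\<bar> \<le> (\<integral>\<^sup>+\<tau>\<in>{s..t}. g' (\<gamma> \<tau>) \<partial>lborel))" for n :: nat and g'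
  have "\<exists>g'. good n g'" for n
  proof -
    obtain h where h: "weak_upper_gradient (restrict_space M (ball x0 (real n))) p (\<lambda>x. ereal (w x)) h"
      "(\<integral>\<^sup>+x. epow (h x) p \<partial>restrict_space M (ball x0 (real n))) < \<infinity>"
      using assms[of n] by blast
    show ?thesis unfolding good_def by (rule weak_upper_gradient_restrict_extend[OF open_ball h], intro exI conjI)
  qed
  then obtain G where "\<And>n. good n (G n)" by metis
  then have G: "\<And>n. G n \<in> borel_measurable borel" "\<And>n. (\<integral>\<^sup>+x. epow (G n x) p \<partial>M) < \<infinity>"
    "\<And>n. ae_curve (\<lambda>\<gamma> l. \<forall>s t. 0 \<le> s \<and> s \<le> t \<and> t \<le> l \<and> \<gamma> ` {s..t} \<subseteq> ball x0 (real n) \<longrightarrow>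
        ennreal \<bar>w (\<gamma> s) - w (\<gamma> t)\<bar> \<le> (\<integral>\<^sup>+\<tau>\<in>{s..t}. G n (\<gamma> \<tau>) \<partial>lborel))"
    unfolding good_def by simp_all
  note [measurable] = G(1) G(1)[THEN borel_imp_measurable_M]
  define m where "m x = nat \<lfloor>dist x0 x\<rfloor>" for x :: 'a
  have mm[measurable]: "m \<in> measurable borel (count_space UNIV)"
  proof -
    have "(\<lambda>x. dist x0 x) \<in> borel_measurable borel"
      by (intro borel_measurable_continuous_onI continuous_intros)
    then show ?thesis unfolding m_def by measurable
  qed
  have m_bd: "real (m x) \<le> dist x0 x" "dist x0 x < real (m x) + 1" for x
    unfolding m_def by simp_all
  define g where "g x = max (G (m x + 1) x) (max (G (m x + 2) x) (G (m x + 3) x))" for x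
  have g_ge: "G (m x + 1) x \<le> g x" "G (m x + 2) x \<le> g x" "G (m x + 3) x \<le> g x" for x
    unfolding g_def by (simp_all only: max.cobounded1 max.cobounded2 max.coboundedI2)
  have Gm: "(\<lambda>x. G (m x + k) x) \<in> borel_measurable borel" for k
    by (rule measurable_compose_countable'[where g = m and I = UNIV and f = "\<lambda>i x. G (i + k) x"]) auto
  have g[measurable]: "g \<in> borel_measurable borel" unfolding g_def by (intro borel_measurable_max Gm)
  have "ae_curve (upper_gradient_along w g)"
    using almost_every_curve_all_nat[OF G(3)]
  proof (rule almost_every_curve_mono)
    fix \<gamma> l assume \<gamma>: "arc_length_curve (space M) \<gamma> l" and 
      *: "\<forall>n s t. 0 \<le> s \<and> s \<le> t \<and> t \<le> l \<and> \<gamma> ` {s..t} \<subseteq> ball x0 (real n) \<longrightarrow>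
        ennreal \<bar>w (\<gamma> s) - w (\<gamma> t)\<bar> \<le> (\<integral>\<^sup>+\<tau>\<in>{s..t}. G n (\<gamma> \<tau>) \<partial>lborel)"
    obtain \<gamma>' where \<gamma>': "continuous_on UNIV \<gamma>'" "\<And>t. t \<in> {0..l} \<Longrightarrow> \<gamma>' t = \<gamma> t"
      and [measurable]: "\<gamma>' \<in> borel_measurable borel"
      using arc_length_curve_extend[OF \<gamma>] by metis
    note eq = nn_integral_along_cong[of l \<gamma>' \<gamma>, OF \<gamma>'(2)]
    have small: "ennreal \<bar>w (\<gamma>' s) - w (\<gamma>' t)\<bar> \<le> (\<integral>\<^sup>+\<tau>\<in>{s..t}. g (\<gamma>' \<tau>) \<partial>lborel)"
      if st: "0 \<le> s" "s \<le> t" "t \<le> l" "t - s < 1" for s t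
    proof -
      let ?k = "m (\<gamma> s)"
      have d: "dist (\<gamma> s) (\<gamma> \<tau>) < 1" if "\<tau> \<in> {s..t}" for \<tau>
        using arc_length_curve_dist_le[OF \<gamma>, of s \<tau>] that st by auto
      have d': "\<bar>dist x0 (\<gamma> s) - dist x0 (\<gamma> \<tau>)\<bar> < 1" if "\<tau> \<in> {s..t}" for \<tau>
        using d[OF that] dist_triangle[of x0 "\<gamma> \<tau>" "\<gamma> s"] dist_triangle[of x0 "\<gamma> s" "\<gamma> \<tau>"] 
        by (simp add: dist_commute abs_less_iff)
      have "\<gamma> ` {s..t} \<subseteq> ball x0 (real (?k + 2))"
      proof (rule image_subsetI)
        fix \<tau> assume "\<tau> \<in> {s..t}"
        then show "\<gamma> \<tau> \<in> ball x0 (real (?k + 2))" using d'[of \<tau>] m_bd[of "\<gamma> s"] by auto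
      qed
      then have "ennreal \<bar>w (\<gamma> s) - w (\<gamma> t)\<bar> \<le> (\<integral>\<^sup>+\<tau>\<in>{s..t}. G (?k + 2) (\<gamma> \<tau>) \<partial>lborel)"
        using *[rule_format, of s t "?k + 2"] st by auto
      also have "\<dots> \<le> (\<integral>\<^sup>+\<tau>\<in>{s..t}. g (\<gamma> \<tau>) \<partial>lborel)"
      proof (rule nn_integral_mono)
        fix \<tau>
        show "G (?k + 2) (\<gamma> \<tau>) * indicator {s..t} \<tau> \<le> g (\<gamma> \<tau>) * indicator {s..t} \<tau>"
        proof (cases "\<tau> \<in> {s..t}")
          case True
          have k: "?k + 2 = m (\<gamma> \<tau>) + 1 \<or> ?k + 2 = m (\<gamma> \<tau>) + 2 \<or> ?k + 2 = m (\<gamma> \<tau>) + 3"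
            using d'[OF True] m_bd[of "\<gamma> s"] m_bd[of "\<gamma> \<tau>"] by linarith
          have "G (?k + 2) (\<gamma> \<tau>) \<le> g (\<gamma> \<tau>)" using k g_ge[of "\<gamma> \<tau>"] by (elim disjE) (simp_all only:)
          then show ?thesis using True by simp
        qed simp
      qed
      finally show ?thesis using st \<gamma>'(2) eq[of s t g] by simp
    qed
    show "upper_gradient_along w g \<gamma> l"
      unfolding upper_gradient_along_def
    proof (intro allI impI, elim conjE)
      fix s t assume st: "0 \<le> s" "s \<le> t" "t \<le> l"
      have "ennreal \<bar>w (\<gamma>' s) - w (\<gamma>' t)\<bar> \<le> (\<integral>\<^sup>+\<tau>\<in>{s..t}. g (\<gamma>' \<tau>) \<partial>lborel)"
        by (rule increment_le_of_small_intervals[where f = "\<lambda>\<tau>. w (\<gamma>' \<tau>)" and a = 0 and b = l, OF _ zero_less_one small st]) simp_all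
      then show "ennreal \<bar>w (\<gamma> s) - w (\<gamma> t)\<bar> \<le> (\<integral>\<^sup>+\<tau>\<in>{s..t}. g (\<gamma> \<tau>) \<partial>lborel)"
        using st \<gamma>'(2) eq[of s t g] by simp
    qed
  qed
  then have 1: "real_gradient w g" using weak_upper_gradient_iff_along[OF g] by simp
  have 2: "(\<integral>\<^sup>+x\<in>ball x0 (real n). epow (g x) p \<partial>M) < \<infinity>" for n :: nat
  proof -
    have "(\<integral>\<^sup>+x\<in>ball x0 (real n). epow (g x) p \<partial>M) \<le> (\<integral>\<^sup>+x. (\<Sum>k\<le>n+3. epow (G k x) p) \<partial>M)"
    proof (rule nn_integral_mono)
      fix x
      show "epow (g x) p * indicator (ball x0 (real n)) x \<le> (\<Sum>k\<le>n+3. epow (G k x) p)"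
      proof (cases "x \<in> ball x0 (real n)")
        case True
        then have mn: "m x < n" using m_bd[of x] by auto
        obtain k where k: "k \<le> m x + 3" "g x = G k x"
        proof -
          have "g x = G (m x + 1) x \<or> g x = G (m x + 2) x \<or> g x = G (m x + 3) x"
            unfolding g_def max_def by argo
          then show thesis using that[of "m x + 1"] that[of "m x + 2"] that[of "m x + 3"] by auto
        qed
        have "epow (G k x) p \<le> (\<Sum>k\<le>n+3. epow (G k x) p)"
          using k mn by (intro member_le_sum) auto
        then show ?thesis using True k by simp
      qed simp
    qed
    also have "\<dots> = (\<Sum>k\<le>n+3. \<integral>\<^sup>+x. epow (G k x) p \<partial>M)" by (intro nn_integral_sum) measurable
    also have "\<dots> < \<infinity>" using G(2) by (auto simp: less_top)
    finally show ?thesis .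
  qed
  show thesis by (rule that[OF g 1 2])
qed

end

section \<open>Existence of minimal weak upper gradients\<close>

lemma AE_le_of_nn_integral_le:
  assumes [measurable]: "f \<in> borel_measurable M" "g \<in> borel_measurable M"
    and "\<And>x. g x \<le> f x" "(\<integral>\<^sup>+x. f x \<partial>M) \<le> (\<integral>\<^sup>+x. g x \<partial>M)" "(\<integral>\<^sup>+x. f x \<partial>M) < \<infinity>"
  shows "AE x in M. f x \<le> g x"
proof -
  have "(\<integral>\<^sup>+x. g x \<partial>M) \<le> (\<integral>\<^sup>+x. f x \<partial>M)" by (intro nn_integral_mono assms)
  then have "(\<integral>\<^sup>+x. g x \<partial>M) \<noteq> \<infinity>" using assms(5) by (auto dest: le_less_trans)
  then have "(\<integral>\<^sup>+x. f x - g x \<partial>M) = (\<integral>\<^sup>+x. f x \<partial>M) - (\<integral>\<^sup>+x. g x \<partial>M)"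
    using assms by (intro nn_integral_diff) auto
  also have "\<dots> = 0" using assms(4) by (simp add: diff_eq_0_ennreal assms(5)[simplified])
  finally have "AE x in M. f x - g x = 0" by (subst (asm) nn_integral_0_iff_AE) auto
  then show ?thesis by eventually_elim (rule ennreal_minus_eq_0)
qed

context metric_measure begin

text \<open>
  A decreasing limit passes under the curve integral by dominated convergence.
\<close>
lemma weak_upper_gradient_INF:
  fixes m :: "nat \<Rightarrow> 'a \<Rightarrow> ennreal"
  assumes m[measurable]: "\<And>i. m i \<in> borel_measurable borel" and dec: "decseq m"
    and wug: "\<And>i. real_gradient w (m i)"
    and fin: "ae_curve (\<lambda>\<gamma> l. curve_integral \<gamma> l (m 0) < \<infinity>)"
  shows "real_gradient w (\<lambda>x. INF i. m i x)"
proof -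
  have meas: "(\<lambda>x. INF i. m i x) \<in> borel_measurable borel" by measurable
  have "ae_curve (\<lambda>\<gamma> l. \<forall>i. ennreal \<bar>w (\<gamma> 0) - w (\<gamma> l)\<bar> \<le> curve_integral \<gamma> l (m i))"
    using wug by (intro almost_every_curve_all_nat) (simp add: weak_upper_gradient_def)
  from almost_every_curve_conj[OF this fin]
  have "ae_curve (\<lambda>\<gamma> l. ennreal \<bar>w (\<gamma> 0) - w (\<gamma> l)\<bar> \<le> curve_integral \<gamma> l (\<lambda>x. INF i. m i x))"
  proof (rule almost_every_curve_mono, elim conjE)
    fix \<gamma> l assume \<gamma>: "arc_length_curve (space M) \<gamma> l" 
      and le: "\<forall>i. ennreal \<bar>w (\<gamma> 0) - w (\<gamma> l)\<bar> \<le> curve_integral \<gamma> l (m i)" and fin: "curve_integral \<gamma> l (m 0) < \<infinity>"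
    have "curve_integral \<gamma> l (\<lambda>x. INF i. m i x) = (\<integral>\<^sup>+t. (INF i. m i (\<gamma> t) * indicator {0..l} t) \<partial>lborel)"
      unfolding curve_integral_borel(1)[OF \<gamma> meas] by (intro nn_integral_cong) (auto simp: indicator_def)
    also have "\<dots> = (INF i. \<integral>\<^sup>+t. m i (\<gamma> t) * indicator {0..l} t \<partial>lborel)"
    proof (rule nn_integral_monotone_convergence_INF_decseq)
      show "decseq (\<lambda>i t. m i (\<gamma> t) * indicator {0..l} t)"
        by (rule decseq_SucI) (auto intro!: le_funI mult_right_mono le_funD[OF decseq_SucD[OF dec]])
      show "(\<lambda>t. m i (\<gamma> t) * indicator {0..l} t) \<in> borel_measurable lborel" for i
        using curve_integral_borel(2)[OF \<gamma> m] by simp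
      show "(\<integral>\<^sup>+t. m 0 (\<gamma> t) * indicator {0..l} t \<partial>lborel) < \<infinity>"
        using fin curve_integral_borel(1)[OF \<gamma> m] by simp
    qed
    also have "\<dots> = (INF i. curve_integral \<gamma> l (m i))" using curve_integral_borel(1)[OF \<gamma> m] by simp
    finally show "ennreal \<bar>w (\<gamma> 0) - w (\<gamma> l)\<bar> \<le> curve_integral \<gamma> l (\<lambda>x. INF i. m i x)"
      using le by (auto intro: INF_greatest)
  qed
  then show ?thesis using meas by (simp add: weak_upper_gradient_def borel_imp_measurable_M)
qed

text \<open>
  Among the gradients below \<open>g0\<close>, minimize the energy in each ball of integer radius. Countably many minimizing
  sequences are combined by minima into one decreasing sequence, whose limit \<open>h\<close> minimizes the
  energy in all these balls at once. For any other gradient \<open>f\<close>, the minimum of \<open>f\<close> and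
  \<open>h\<close> competes with \<open>h\<close> and has no smaller energy, whence $h \le f$ almost everywhere.
\<close>
theorem minimal_weak_upper_gradient_exists:
  fixes x0 :: 'a
  assumes D: "countable D" "closure D = (UNIV :: 'a set)" and g0: "g0 \<in> borel_measurable borel"
    and wug0: "real_gradient w g0" 
    and fin0: "\<And>n::nat. (\<integral>\<^sup>+x\<in>ball x0 (real n). epow (g0 x) p \<partial>M) < \<infinity>"
  shows "\<exists>g. minimal_weak_upper_gradient M p (\<lambda>x. ereal (w x)) g"
proof -
  let ?wug = "real_gradient w"
  define F where "F = {g. g \<in> borel_measurable borel \<and> ?wug g \<and> (\<forall>x. g x \<le> g0 x)}"
  have g0F: "g0 \<in> F" using g0 wug0 by (simp add: F_def)
  define J where "J n g = (\<integral>\<^sup>+x\<in>ball x0 (real n). epow (g x) p \<partial>M)" for n :: nat and g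
  have J_mono: "J n g \<le> J n h" if "\<And>x. g x \<le> h x" for n g h
    unfolding J_def using that by (intro nn_integral_mono mult_right_mono epow_mono) auto
  have fin: "J n g < \<infinity>" if "g \<in> F" for n g
    using J_mono[of g g0 n] fin0[of n] that by (auto simp: F_def J_def intro: le_less_trans)
  have loc: "Lp_loc M p g" if "g \<in> F" for g
    using fin[OF that] that by (intro Lp_loc_of_balls[of _ x0]) (auto simp: F_def J_def borel_imp_measurable_M)
  have curve_fin: "ae_curve (\<lambda>\<gamma> l. curve_integral \<gamma> l g < \<infinity>)" if "g \<in> F" for g
    using that loc by (intro almost_every_curve_finite_integral_Lp_loc[OF D]) (auto simp: F_def)
  have min_F: "(\<lambda>x. min (g x) (h x)) \<in> F" if "g \<in> F" "h \<in> F" for g h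
    using that weak_upper_gradient_min[of g h w] curve_fin by (auto simp: F_def min_le_iff_disj)
  have "\<exists>g\<in>F. J n g \<le> (INF g\<in>F. J n g) + ennreal (1 / real (Suc k))" for n k
  proof -
    have "(INF g\<in>F. J n g) \<le> J n g0" by (rule INF_lower[OF g0F])
    then have "(INF g\<in>F. J n g) < \<infinity>" using fin[OF g0F] by (rule le_less_trans)
    then have "(INF g\<in>F. J n g) < (INF g\<in>F. J n g) + ennreal (1 / real (Suc k))"
      by (cases "INF g\<in>F. J n g") (auto simp flip: ennreal_plus simp: ennreal_less_iff)
    then show ?thesis unfolding INF_less_iff by (auto intro: less_imp_le)
  qed
  then obtain G where G: "\<And>n k. G n k \<in> F" "\<And>n k. J n (G n k) \<le> (INF g\<in>F. J n g) + ennreal (1 / real (Suc k))"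
    by metis
  \<comment> \<open>One sequence running through the minimizing sequences of all balls.\<close>
  define a where "a i = G (fst (prod_decode i)) (snd (prod_decode i))" for i
  define m where "m = rec_nat (a 0) (\<lambda>i f x. min (f x) (a (Suc i) x))"
  have m0: "m 0 = a 0" and mS: "m (Suc i) = (\<lambda>x. min (m i x) (a (Suc i) x))" for i by (simp_all add: m_def)
  have aF: "a i \<in> F" for i using G(1) by (simp add: a_def)
  have mF: "m i \<in> F" for i by (induction i) (auto simp: m0 mS aF intro: min_F)
  have dec: "decseq m" by (rule decseq_SucI) (auto simp: mS le_fun_def)
  have m_le: "m i x \<le> a i x" for i x by (cases i) (auto simp: m0 mS)
  define h where "h x = (INF i. m i x)" for x
  have h_le: "h x \<le> a i x" for i x unfolding h_def using m_le by (rule INF_lower2[OF UNIV_I])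
  have hF: "h \<in> F"
  proof -
    have "?wug h" unfolding h_def[abs_def]
      using mF curve_fin[OF mF] dec by (intro weak_upper_gradient_INF) (auto simp: F_def)
    moreover have "h \<in> borel_measurable borel" 
      using mF unfolding h_def[abs_def] F_def by (intro borel_measurable_INF) auto
    moreover have "h x \<le> g0 x" for x using h_le[of x 0] aF[of 0] by (auto simp: F_def intro: order_trans)
    ultimately show ?thesis by (simp add: F_def)
  qed
  have J_h: "J n h \<le> J n g" if "g \<in> F" for n g
  proof -
    have "J n h \<le> (INF g\<in>F. J n g) + ennreal e" if "0 < e" for e
    proof -
      obtain k where k: "1 / real (Suc k) < e" using nat_approx_posE[OF \<open>0 < e\<close>] by auto
      have "J n h \<le> J n (a (prod_encode (n, k)))" by (intro J_mono h_le)
      also have "\<dots> = J n (G n k)" by (simp add: a_def)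
      also have "\<dots> \<le> (INF g\<in>F. J n g) + ennreal (1 / real (Suc k))" by (rule G)
      also have "\<dots> \<le> (INF g\<in>F. J n g) + ennreal e" using k by (intro add_left_mono ennreal_leI) auto
      finally show ?thesis .
    qed
    then have "J n h \<le> (INF g\<in>F. J n g)" by (rule ennreal_le_epsilon)
    then show ?thesis using INF_lower[OF that] by (rule order_trans)
  qed
  have "minimal_weak_upper_gradient M p (\<lambda>x. ereal (w x)) h"
    unfolding minimal_weak_upper_gradient_def
  proof (intro conjI allI impI)
    show "?wug h" using hF by (simp add: F_def)
    show "Lp_loc M p h" by (rule loc[OF hF])
    fix f assume f: "?wug f \<and> Lp_loc M p f"
    then have "f \<in> borel_measurable M" by (simp add: Lp_loc_def)
    then obtain f' where f': "f' \<in> borel_measurable borel" "\<And>x. f x \<le> f' x" "AE x in M. f x = f' x"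
      using ex_borel_majorant by blast
    have "?wug f'" using weak_upper_gradient_majorant f f' by blast
    have "Lp_loc M p f'"
    proof -
      have "(\<integral>\<^sup>+y\<in>ball x r. epow (f' y) p \<partial>M) = (\<integral>\<^sup>+y\<in>ball x r. epow (f y) p \<partial>M)" for x r
        using f'(3) by (intro nn_integral_cong_AE) auto
      then show ?thesis using f f'(1) by (simp add: Lp_loc_def borel_imp_measurable_M)
    qed
    have "?wug (\<lambda>x. min (f' x) (h x))"
      using hF f'(1) \<open>?wug f'\<close> almost_every_curve_finite_integral_Lp_loc[OF D f'(1) \<open>Lp_loc M p f'\<close>] curve_fin[OF hF]
      by (intro weak_upper_gradient_min) (auto simp: F_def)
    then have mF: "(\<lambda>x. min (f' x) (h x)) \<in> F"
      using hF f'(1) by (auto simp: F_def min_le_iff_disj)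
    have [measurable]: "h \<in> borel_measurable M" "f' \<in> borel_measurable M"
      using hF f' by (auto simp: F_def borel_imp_measurable_M)
    have "AE x in M. epow (h x) p * indicator (ball x0 (real n)) x \<le> epow (min (f' x) (h x)) p * indicator (ball x0 (real n)) x" for n
    proof (rule AE_le_of_nn_integral_le)
      show "(\<integral>\<^sup>+x. epow (h x) p * indicator (ball x0 (real n)) x \<partial>M) \<le> (\<integral>\<^sup>+x. epow (min (f' x) (h x)) p * indicator (ball x0 (real n)) x \<partial>M)"
        using J_h[OF mF, of n] by (simp add: J_def)
      show "(\<integral>\<^sup>+x. epow (h x) p * indicator (ball x0 (real n)) x \<partial>M) < \<infinity>"
        using fin[OF hF, of n] by (simp add: J_def)
      show "epow (min (f' x) (h x)) p * indicator (ball x0 (real n)) x \<le> epow (h x) p * indicator (ball x0 (real n)) x" for x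
        by (intro mult_right_mono epow_mono) auto
    qed measurable
    then have "AE x in M. \<forall>n. epow (h x) p * indicator (ball x0 (real n)) x \<le> epow (min (f' x) (h x)) p * indicator (ball x0 (real n)) x"
      by (simp add: AE_all_countable)
    then show "AE x in M. h x \<le> f x" using f'(3)
    proof eventually_elim
      case (elim x)
      obtain n where "dist x0 x < real n" using reals_Archimedean2 by blast
      then have "epow (h x) p \<le> epow (min (f' x) (h x)) p" using elim(1)[rule_format, of n] by simp
      then have "epow (epow (h x) p) (1/p) \<le> epow (epow (min (f' x) (h x)) p) (1/p)"
        by (rule epow_mono[rotated]) simp
      then have "h x \<le> min (f' x) (h x)" unfolding epow_inverse'[OF p_pos] .
      then show ?case using elim(2) by simp
    qed
  qed
  then show ?thesis by blast
qed

section \<open>The test function for the quasiminimizing property\<close>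

text \<open>
  The Leibniz rule along curves: on a short piece $w$ is almost constant, so the increment of
  $\theta w$ is at most that of $w$ plus $|w|$ times that of $\theta$. The error is uniform and
  is removed by refining the partition.
\<close>
lemma weak_upper_gradient_product:
  assumes g[measurable]: "g \<in> borel_measurable borel" and wug: "real_gradient w g"
    and w: "continuous_on UNIV w" and L: "0 \<le> L" and \<theta>: "\<And>x. \<bar>\<theta> x\<bar> \<le> 1"
    and \<theta>L: "\<And>\<gamma> l s t. arc_length_curve UNIV \<gamma> l \<Longrightarrow> 0 \<le> s \<Longrightarrow> s \<le> t \<Longrightarrow> t \<le> l \<Longrightarrow> \<bar>\<theta> (\<gamma> s) - \<theta> (\<gamma> t)\<bar> \<le> L * (t - s)"
  shows "weak_upper_gradient M p (\<lambda>x. ereal (\<theta> x * w x)) (\<lambda>x. g x + ennreal (L * \<bar>w x\<bar>))"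
proof -
  have [measurable]: "w \<in> borel_measurable borel" using w by (rule borel_measurable_continuous_onI)
  have meas: "(\<lambda>x. g x + ennreal (L * \<bar>w x\<bar>)) \<in> borel_measurable borel" by measurable
  have "ae_curve (upper_gradient_along w g)"
    using wug by (simp add: weak_upper_gradient_iff_along)
  then have "ae_curve (upper_gradient_along (\<lambda>x. \<theta> x * w x) (\<lambda>x. g x + ennreal (L * \<bar>w x\<bar>)))"
  proof (rule almost_every_curve_mono)
    fix \<gamma> l assume \<gamma>: "arc_length_curve (space M) \<gamma> l" and along: "upper_gradient_along w g \<gamma> l"
    obtain \<gamma>' where \<gamma>': "continuous_on UNIV \<gamma>'" "\<And>t. t \<in> {0..l} \<Longrightarrow> \<gamma>' t = \<gamma> t"
      and [measurable]: "\<gamma>' \<in> borel_measurable borel"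
      using arc_length_curve_extend[OF \<gamma>] by metis
    note eq = nn_integral_along_cong[of l \<gamma>' \<gamma>, OF \<gamma>'(2)]
    define f where "f \<tau> = w (\<gamma>' \<tau>)" for \<tau>
    have f[measurable]: "f \<in> borel_measurable borel" unfolding f_def by measurable
    have "continuous_on {0..l} f" unfolding f_def
      by (rule continuous_on_compose2[OF w continuous_on_subset[OF \<gamma>'(1)]]) auto
    then have uc: "uniformly_continuous_on {0..l} f" by (intro compact_uniformly_continuous) auto
    show "upper_gradient_along (\<lambda>x. \<theta> x * w x) (\<lambda>x. g x + ennreal (L * \<bar>w x\<bar>)) \<gamma> l"
      unfolding upper_gradient_along_def
    proof (intro allI impI, elim conjE)
      fix a b assume ab: "0 \<le> a" "a \<le> b" "b \<le> l"
      let ?I = "\<integral>\<^sup>+\<tau>\<in>{a..b}. (g (\<gamma>' \<tau>) + ennreal (L * \<bar>f \<tau>\<bar>)) \<partial>lborel"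
      have main: "ennreal \<bar>\<theta> (\<gamma>' a) * f a - \<theta> (\<gamma>' b) * f b\<bar> \<le> ?I + ennreal (\<epsilon> * (L * (b - a)))" if \<epsilon>: "0 < \<epsilon>" for \<epsilon>
      proof -
        obtain \<delta> where \<delta>: "0 < \<delta>" "\<And>s t. s \<in> {0..l} \<Longrightarrow> t \<in> {0..l} \<Longrightarrow> dist s t < \<delta> \<Longrightarrow> dist (f s) (f t) < \<epsilon>"
          using uc \<epsilon> unfolding uniformly_continuous_on_def by metis
        let ?k = "\<lambda>\<tau>. g (\<gamma>' \<tau>) + ennreal (L * (\<bar>f \<tau>\<bar> + \<epsilon>))"
        have "ennreal \<bar>\<theta> (\<gamma>' a) * f a - \<theta> (\<gamma>' b) * f b\<bar> \<le> (\<integral>\<^sup>+\<tau>\<in>{a..b}. ?k \<tau> \<partial>lborel)"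
        proof (rule increment_le_of_small_intervals[where f = "\<lambda>\<tau>. \<theta> (\<gamma>' \<tau>) * f \<tau>" and a = a and b = b and \<delta> = \<delta>])
          fix s t assume st: "a \<le> s" "s \<le> t" "t \<le> b" "t - s < \<delta>"
          have "\<bar>\<theta> (\<gamma>' s) * f s - \<theta> (\<gamma>' t) * f t\<bar> = \<bar>\<theta> (\<gamma>' s) * (f s - f t) + (\<theta> (\<gamma>' s) - \<theta> (\<gamma>' t)) * f t\<bar>"
            by (simp add: algebra_simps)
          also have "\<dots> \<le> \<bar>\<theta> (\<gamma>' s)\<bar> * \<bar>f s - f t\<bar> + \<bar>\<theta> (\<gamma>' s) - \<theta> (\<gamma>' t)\<bar> * \<bar>f t\<bar>"
            by (metis abs_mult abs_triangle_ineq)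
          also have "\<dots> \<le> 1 * \<bar>f s - f t\<bar> + (L * (t - s)) * \<bar>f t\<bar>"
            using \<theta> \<theta>L[of \<gamma> l s t] \<gamma> ab st \<gamma>'(2) by (intro add_mono mult_right_mono) auto
          finally have 1: "ennreal \<bar>\<theta> (\<gamma>' s) * f s - \<theta> (\<gamma>' t) * f t\<bar> \<le> ennreal \<bar>f s - f t\<bar> + ennreal ((L * (t - s)) * \<bar>f t\<bar>)"
            using L st by (subst ennreal_plus[symmetric]) (auto simp del: ennreal_plus intro!: ennreal_leI)
          have 2: "ennreal \<bar>f s - f t\<bar> \<le> (\<integral>\<^sup>+\<tau>\<in>{s..t}. g (\<gamma>' \<tau>) \<partial>lborel)"
            using along[unfolded upper_gradient_along_def, rule_format, of s t] eq[of s t g] \<gamma>'(2) ab st by (simp add: f_def)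
          have "ennreal ((L * (t - s)) * \<bar>f t\<bar>) = (\<integral>\<^sup>+\<tau>\<in>{s..t}. ennreal (L * \<bar>f t\<bar>) \<partial>lborel)"
            using L st by (subst nn_integral_cmult_indicator) (auto simp flip: ennreal_mult simp: mult_ac)
          also have "\<dots> \<le> (\<integral>\<^sup>+\<tau>\<in>{s..t}. ennreal (L * (\<bar>f \<tau>\<bar> + \<epsilon>)) \<partial>lborel)"
          proof (rule nn_integral_mono)
            fix \<tau>
            show "ennreal (L * \<bar>f t\<bar>) * indicator {s..t} \<tau> \<le> ennreal (L * (\<bar>f \<tau>\<bar> + \<epsilon>)) * indicator {s..t} \<tau>"
            proof (cases "\<tau> \<in> {s..t}")
              case True
              then have "dist (f t) (f \<tau>) < \<epsilon>" using ab st by (intro \<delta>(2)) (auto simp: dist_real_def)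
              then have "\<bar>f t\<bar> \<le> \<bar>f \<tau>\<bar> + \<epsilon>" by (simp add: dist_real_def)
              then show ?thesis using True L by (auto intro!: ennreal_leI mult_left_mono)
            qed simp
          qed
          finally have 3: "ennreal ((L * (t - s)) * \<bar>f t\<bar>) \<le> (\<integral>\<^sup>+\<tau>\<in>{s..t}. ennreal (L * (\<bar>f \<tau>\<bar> + \<epsilon>)) \<partial>lborel)" .
          have "(\<integral>\<^sup>+\<tau>\<in>{s..t}. ?k \<tau> \<partial>lborel) = (\<integral>\<^sup>+\<tau>\<in>{s..t}. g (\<gamma>' \<tau>) \<partial>lborel) + (\<integral>\<^sup>+\<tau>\<in>{s..t}. ennreal (L * (\<bar>f \<tau>\<bar> + \<epsilon>)) \<partial>lborel)"
            unfolding distrib_right by (rule nn_integral_add) measurable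
          then show "ennreal \<bar>\<theta> (\<gamma>' s) * f s - \<theta> (\<gamma>' t) * f t\<bar> \<le> (\<integral>\<^sup>+\<tau>\<in>{s..t}. ?k \<tau> \<partial>lborel)"
            using order_trans[OF 1 add_mono[OF 2 3]] by simp
        qed (use \<delta> ab in auto)
        also have "(\<integral>\<^sup>+\<tau>\<in>{a..b}. ?k \<tau> \<partial>lborel) = (\<integral>\<^sup>+\<tau>. (g (\<gamma>' \<tau>) + ennreal (L * \<bar>f \<tau>\<bar>)) * indicator {a..b} \<tau> + ennreal (L * \<epsilon>) * indicator {a..b} \<tau> \<partial>lborel)"
          using L \<epsilon> by (intro nn_integral_cong) (auto simp: indicator_def distrib_left add.assoc)
        also have "\<dots> = ?I + (\<integral>\<^sup>+\<tau>. ennreal (L * \<epsilon>) * indicator {a..b} \<tau> \<partial>lborel)"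
          by (rule nn_integral_add) measurable
        also have "(\<integral>\<^sup>+\<tau>. ennreal (L * \<epsilon>) * indicator {a..b} \<tau> \<partial>lborel) = ennreal (\<epsilon> * (L * (b - a)))"
          using L \<epsilon> ab by (subst nn_integral_cmult_indicator) (auto simp flip: ennreal_mult simp: mult_ac)
        finally show ?thesis .
      qed
      have "ennreal \<bar>\<theta> (\<gamma>' a) * f a - \<theta> (\<gamma>' b) * f b\<bar> \<le> ?I + ennreal e" if "0 < e" for e
      proof -
        let ?\<epsilon> = "e / (L * (b - a) + 1)"
        have pos: "0 < L * (b - a) + 1" using L ab by (simp add: add_nonneg_pos)
        then have "?\<epsilon> * (L * (b - a)) \<le> e" using that L ab by (simp add: field_simps)
        then have "?I + ennreal (?\<epsilon> * (L * (b - a))) \<le> ?I + ennreal e" by (intro add_left_mono ennreal_leI)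
        then show ?thesis using main[of ?\<epsilon>] that pos by (auto intro: order_trans)
      qed
      then have "ennreal \<bar>\<theta> (\<gamma>' a) * f a - \<theta> (\<gamma>' b) * f b\<bar> \<le> ?I" by (rule ennreal_le_epsilon)
      then show "ennreal \<bar>\<theta> (\<gamma> a) * w (\<gamma> a) - \<theta> (\<gamma> b) * w (\<gamma> b)\<bar> \<le> (\<integral>\<^sup>+\<tau>\<in>{a..b}. (g (\<gamma> \<tau>) + ennreal (L * \<bar>w (\<gamma> \<tau>)\<bar>)) \<partial>lborel)"
        using ab \<gamma>'(2) eq[of a b "\<lambda>x. g x + ennreal (L * \<bar>w x\<bar>)"] by (simp add: f_def)
    qed
  qed
  then show ?thesis using weak_upper_gradient_iff_along[OF meas] by simp
qed

end

lemma min_wug_minimal: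
  "\<exists>g. minimal_weak_upper_gradient M p u g \<Longrightarrow> minimal_weak_upper_gradient M p u (min_wug M p u)"
  unfolding min_wug_def by (elim exE) (rule someI[where P = "minimal_weak_upper_gradient M p u"])

text \<open>
  The part outside the ball of the $\rho$-neighbourhood of the topological boundary, which
  may be smaller than the corresponding metric annulus.
\<close>
definition collar :: "'a::metric_space \<Rightarrow> real \<Rightarrow> real \<Rightarrow> 'a set" where
  "collar x0 r \<rho> = {x. x \<notin> ball x0 r \<and> (\<exists>z\<in>frontier (ball x0 r). dist x z < \<rho>)}"

context metric_measure begin

lemma weak_upper_gradient_shift:
  assumes g: "g \<in> borel_measurable borel" and "real_gradient w g"
    and "\<And>x y. w x - w y = w' x - w' y"
  shows "weak_upper_gradient M p (\<lambda>x. ereal (w' x)) g"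
  using assms(2) unfolding weak_upper_gradient_iff_along[OF g] upper_gradient_along_def assms(3) .

lemma newtonianD:
  assumes "u \<in> newtonian M' p"
  shows "u \<in> borel_measurable M'" "(\<integral>\<^sup>+x. epow (eabs (u x)) p \<partial>M') < \<infinity>"
    "\<exists>g. weak_upper_gradient M' p u g \<and> (\<integral>\<^sup>+x. epow (g x) p \<partial>M') < \<infinity>"
proof -
  have "newtonian_norm M' p u < \<infinity>" and m: "u \<in> borel_measurable M'" using assms by (auto simp: newtonian_def)
  then have "(\<integral>\<^sup>+x. epow (eabs (u x)) p \<partial>M') + (INF g \<in> {g. weak_upper_gradient M' p u g}. \<integral>\<^sup>+x. epow (g x) p \<partial>M') < \<infinity>"
    unfolding newtonian_norm_def epow_less_top_iff by simp
  then show "(\<integral>\<^sup>+x. epow (eabs (u x)) p \<partial>M') < \<infinity>"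
    "\<exists>g. weak_upper_gradient M' p u g \<and> (\<integral>\<^sup>+x. epow (g x) p \<partial>M') < \<infinity>"
    by (auto simp: ennreal_add_less_top INF_less_iff)
  show "u \<in> borel_measurable M'" by (rule m)
qed

lemma nn_integral_restrict_ball:
  "(\<integral>\<^sup>+x. f x \<partial>restrict_space M (ball x r)) = (\<integral>\<^sup>+x\<in>ball x r. f x \<partial>M)"
  by (subst nn_integral_restrict_space) auto

lemma emeasure_ball_finite: "emeasure M (ball x r) < \<infinity>"
proof (cases "0 < r")
  case True then show ?thesis using mms by (simp add: metric_measure_space_def)
next
  case False then have "ball x r = {}" by (simp add: ball_empty)
  then show ?thesis by (simp only: emeasure_empty) simp
qed

lemma quasiharmonic_Lp_ball:
  assumes "quasiharmonic M p u"
  shows "(\<integral>\<^sup>+y\<in>ball x r. epow (ennreal \<bar>u y - c\<bar>) p \<partial>M) < \<infinity>"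
proof -
  have [measurable]: "u \<in> borel_measurable M"
    using assms by (auto simp: quasiharmonic_def intro: borel_imp_measurable_M borel_measurable_continuous_onI)
  have "(\<lambda>x. ereal (u x)) \<in> newtonian (restrict_space M (ball x r)) p"
    using assms by (simp add: quasiharmonic_def quasiminimizer_def)
  from newtonianD(2)[OF this]
  have 1: "(\<integral>\<^sup>+y\<in>ball x r. epow (ennreal \<bar>u y\<bar>) p \<partial>M) < \<infinity>" by (simp add: nn_integral_restrict_ball)
  have "(\<integral>\<^sup>+y\<in>ball x r. epow (ennreal \<bar>u y - c\<bar>) p \<partial>M) \<le>
     (\<integral>\<^sup>+y. ennreal (2 powr p) * (epow (ennreal \<bar>u y\<bar>) p * indicator (ball x r) y + epow (ennreal \<bar>c\<bar>) p * indicator (ball x r) y) \<partial>M)"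
  proof (rule nn_integral_mono)
    fix y
    have "epow (ennreal \<bar>u y - c\<bar>) p \<le> epow (ennreal \<bar>u y\<bar> + ennreal \<bar>c\<bar>) p"
      by (intro epow_mono) (auto simp flip: ennreal_plus intro!: ennreal_leI)
    also have "\<dots> \<le> ennreal (2 powr p) * (epow (ennreal \<bar>u y\<bar>) p + epow (ennreal \<bar>c\<bar>) p)" by (intro epow_add_le) simp
    finally show "epow (ennreal \<bar>u y - c\<bar>) p * indicator (ball x r) y \<le> ennreal (2 powr p) * (epow (ennreal \<bar>u y\<bar>) p * indicator (ball x r) y + epow (ennreal \<bar>c\<bar>) p * indicator (ball x r) y)"
      by (auto simp: indicator_def)
  qed
  also have "\<dots> = ennreal (2 powr p) * ((\<integral>\<^sup>+y\<in>ball x r. epow (ennreal \<bar>u y\<bar>) p \<partial>M) + epow (ennreal \<bar>c\<bar>) p * emeasure M (ball x r))"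
    by (simp add: nn_integral_cmult nn_integral_add nn_integral_cmult_indicator)
  also have "\<dots> < \<infinity>" using 1 emeasure_ball_finite[of x r]
    by (simp add: ennreal_mult_less_top ennreal_add_less_top epow_less_top_iff[simplified])
  finally show ?thesis .
qed

lemma quasiharmonic_minimal_gradient:
  fixes x0 :: 'a
  assumes D: "countable D" "closure D = (UNIV :: 'a set)" and u: "quasiharmonic M p u"
  obtains g where "g \<in> borel_measurable borel" "real_gradient u g"
    "AE x in M. g x = min_wug M p (\<lambda>x. ereal (u x)) x"
proof -
  have "\<exists>g. weak_upper_gradient (restrict_space M (ball x0 (real n))) p (\<lambda>x. ereal (u x)) g \<and>
      (\<integral>\<^sup>+x. epow (g x) p \<partial>restrict_space M (ball x0 (real n))) < \<infinity>" for n
    using u by (intro newtonianD(3)) (simp add: quasiharmonic_def quasiminimizer_def)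
  then obtain g0 where g0: "g0 \<in> borel_measurable borel" "real_gradient u g0"
    "\<And>n::nat. (\<integral>\<^sup>+x\<in>ball x0 (real n). epow (g0 x) p \<partial>M) < \<infinity>"
    using weak_upper_gradient_glue[of x0 u] by blast
  let ?m = "min_wug M p (\<lambda>x. ereal (u x))"
  have "minimal_weak_upper_gradient M p (\<lambda>x. ereal (u x)) ?m"
    by (rule min_wug_minimal[OF minimal_weak_upper_gradient_exists[OF D g0]])
  then have m: "real_gradient u ?m" by (simp add: minimal_weak_upper_gradient_def)
  then have "?m \<in> borel_measurable M" by (simp add: weak_upper_gradient_def)
  then obtain g where g: "g \<in> borel_measurable borel" "\<And>x. ?m x \<le> g x" "AE x in M. ?m x = g x"
    using ex_borel_majorant by metis
  show thesis
    by (rule that[OF g(1) weak_upper_gradient_majorant[OF m g(1,2)]]) (use g(3) in auto)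
qed

text \<open>
  Seen as a function on $X$, $\eta$ may fail to be Lipschitz, as one of two points close to each other can
  lie in the ball and the other outside it, far from its boundary. But a curve that passes from the ball to its
  complement meets the boundary, where the formula for the outside also gives $1$.
  The case of an empty boundary is separated because \<open>infdist\<close> to the empty set is $0$.
\<close>
lemma ex_cutoff:
  fixes x0 :: 'a and r \<rho> :: real
  assumes \<rho>: "0 < \<rho>"
  obtains \<eta> :: "'a \<Rightarrow> real" where "\<eta> \<in> borel_measurable borel" "\<And>x. 0 \<le> \<eta> x" "\<And>x. \<eta> x \<le> 1"
    "\<And>x. x \<in> ball x0 r \<Longrightarrow> \<eta> x = 1" "\<And>x. x \<notin> ball x0 r \<Longrightarrow> x \<notin> collar x0 r \<rho> \<Longrightarrow> \<eta> x = 0"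
    "\<And>\<gamma> l s t. arc_length_curve UNIV \<gamma> l \<Longrightarrow> 0 \<le> s \<Longrightarrow> s \<le> t \<Longrightarrow> t \<le> l \<Longrightarrow> \<bar>\<eta> (\<gamma> s) - \<eta> (\<gamma> t)\<bar> \<le> 1 / \<rho> * (t - s)"
proof -
  let ?B = "ball x0 r" let ?F = "frontier ?B"
  define \<eta> where "\<eta> x = (if x \<in> ?B then 1 else if ?F = {} then 0 else max 0 (1 - infdist x ?F / \<rho>))" for x
  have m: "\<eta> \<in> borel_measurable borel"
  proof -
    have [measurable]: "(\<lambda>x. infdist x ?F) \<in> borel_measurable borel"
      by (intro borel_measurable_continuous_onI continuous_intros)
    have [measurable]: "?B \<in> sets borel" by simp
    show ?thesis unfolding \<eta>_def by measurable
  qed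
  have 01: "0 \<le> \<eta> x" "\<eta> x \<le> 1" for x unfolding \<eta>_def using \<rho> by (auto simp: infdist_nonneg)
  have zero: "\<eta> x = 0" if "x \<notin> ?B" "x \<notin> collar x0 r \<rho>" for x
  proof (cases "?F = {}")
    case False
    have "\<rho> \<le> infdist x ?F"
      using that False unfolding collar_def infdist_notempty[OF False] by (intro cINF_greatest) (auto simp: not_less)
    then have "1 - infdist x ?F / \<rho> \<le> 0" using \<rho> by simp
    then show ?thesis unfolding \<eta>_def using that(1) by (auto simp: max_def)
  qed (use that in \<open>simp add: \<eta>_def\<close>)
  have mixed: "\<bar>\<eta> (\<gamma> a) - \<eta> (\<gamma> b)\<bar> \<le> 1 / \<rho> * \<bar>b - a\<bar>"
    if \<gamma>: "arc_length_curve UNIV \<gamma> l" and ab: "a \<in> {0..l}" "b \<in> {0..l}" and io: "\<gamma> a \<in> ?B" "\<gamma> b \<notin> ?B" for \<gamma> l a b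
  proof -
    obtain \<gamma>' where \<gamma>': "continuous_on UNIV \<gamma>'" "\<And>t. t \<in> {0..l} \<Longrightarrow> \<gamma>' t = \<gamma> t"
      using arc_length_curve_extend[OF \<gamma>] by metis
    let ?S = "closed_segment a b"
    have S: "?S \<subseteq> {0..l}" using ab by (auto simp: closed_segment_eq_real_ivl)
    have "connected (\<gamma>' ` ?S)" by (intro connected_continuous_image continuous_on_subset[OF \<gamma>'(1)]) auto
    moreover have "\<gamma>' ` ?S \<inter> ?B \<noteq> {}" using io \<gamma>'(2)[OF ab(1)] by force
    moreover have "\<gamma>' ` ?S - ?B \<noteq> {}" using io \<gamma>'(2)[OF ab(2)] by force
    ultimately have "\<gamma>' ` ?S \<inter> ?F \<noteq> {}" by (rule connected_Int_frontier)
    then obtain \<tau> where \<tau>: "\<tau> \<in> ?S" "\<gamma> \<tau> \<in> ?F" using S \<gamma>'(2) by force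
    have ne: "?F \<noteq> {}" using \<tau> by auto
    have "infdist (\<gamma> b) ?F \<le> dist (\<gamma> b) (\<gamma> \<tau>)" by (rule infdist_le[OF \<tau>(2)])
    also have "\<dots> \<le> \<bar>b - \<tau>\<bar>"
      using arc_length_curve_dist_le[OF \<gamma>, of b \<tau>] arc_length_curve_dist_le[OF \<gamma>, of \<tau> b] S \<tau>(1) ab
      by (cases "b \<le> \<tau>") (auto simp: dist_commute)
    also have "\<dots> \<le> \<bar>b - a\<bar>" using \<tau>(1) by (auto simp: closed_segment_eq_real_ivl split: if_splits)
    finally have "infdist (\<gamma> b) ?F / \<rho> \<le> \<bar>b - a\<bar> / \<rho>" using \<rho> by (simp add: divide_right_mono)
    moreover have "\<eta> (\<gamma> a) = 1" "1 - infdist (\<gamma> b) ?F / \<rho> \<le> \<eta> (\<gamma> b)" using io ne by (auto simp: \<eta>_def)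
    ultimately show ?thesis using 01[of "\<gamma> b"] by simp
  qed
  have "\<bar>\<eta> (\<gamma> s) - \<eta> (\<gamma> t)\<bar> \<le> 1 / \<rho> * (t - s)" if \<gamma>: "arc_length_curve UNIV \<gamma> l" and st: "0 \<le> s" "s \<le> t" "t \<le> l" for \<gamma> l s t
  proof -
    consider "\<gamma> s \<in> ?B" "\<gamma> t \<notin> ?B" | "\<gamma> t \<in> ?B" "\<gamma> s \<notin> ?B" | "\<gamma> s \<in> ?B" "\<gamma> t \<in> ?B" | "\<gamma> s \<notin> ?B" "\<gamma> t \<notin> ?B" by blast
    then show ?thesis
    proof cases
      case 1 then show ?thesis using mixed[OF \<gamma>, of s t] st by simp
    next
      case 2 then show ?thesis using mixed[OF \<gamma>, of t s] st by (simp add: abs_minus_commute)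
    next
      case 3 then show ?thesis using st \<rho> by (simp add: \<eta>_def)
    next
      case 4
      have "\<bar>infdist (\<gamma> s) ?F - infdist (\<gamma> t) ?F\<bar> \<le> dist (\<gamma> s) (\<gamma> t)"
        using infdist_triangle[of "\<gamma> s" ?F "\<gamma> t"] infdist_triangle[of "\<gamma> t" ?F "\<gamma> s"] by (simp add: dist_commute)
      also have "\<dots> \<le> t - s" by (rule arc_length_curve_dist_le[OF \<gamma> st])
      finally have "\<bar>infdist (\<gamma> s) ?F / \<rho> - infdist (\<gamma> t) ?F / \<rho>\<bar> \<le> 1 / \<rho> * (t - s)"
        using \<rho> by (simp add: diff_divide_distrib[symmetric] divide_right_mono)
      then show ?thesis using 4 st \<rho> by (auto simp: \<eta>_def)
    qed
  qed
  then show thesis using that[of \<eta>] m 01 zero by (auto simp: \<eta>_def)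
qed

text \<open>
  The test function $\varphi = -\eta(u - c)$ replaces $u$ by the constant $c$ in the ball. Where
  $\varphi = 0$ the quasiminimizing inequality says nothing, so $u = c$ may hold only on a
  null subset of the ball.
\<close>
theorem quasiminimizer_energy_ball_le_collar:
  fixes x0 :: 'a
  assumes D: "countable D" "closure D = (UNIV :: 'a set)" and u: "quasiharmonic M p u"
    and Q: "\<And>\<phi>. \<phi> \<in> newtonian_bounded_support_closure M p \<Longrightarrow>
          (\<integral>\<^sup>+x\<in>{x. \<phi> x \<noteq> 0}. epow (min_wug M p (\<lambda>x. ereal (u x)) x) p \<partial>M)
          \<le> ennreal Q * (\<integral>\<^sup>+x\<in>{x. \<phi> x \<noteq> 0}. epow (min_wug M p (\<lambda>y. ereal (u y) + \<phi> y) x) p \<partial>M)"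
    and g: "g \<in> borel_measurable borel" and wug: "real_gradient u g"
    and g_min: "AE x in M. g x = min_wug M p (\<lambda>x. ereal (u x)) x"
    and g_fin: "(\<integral>\<^sup>+x. epow (g x) p \<partial>M) < \<infinity>"
    and \<rho>: "0 < \<rho>" and c: "AE x in M. x \<in> ball x0 r \<longrightarrow> u x \<noteq> c"
  shows "(\<integral>\<^sup>+x\<in>ball x0 r. epow (g x) p \<partial>M) \<le> ennreal Q * (\<integral>\<^sup>+x\<in>collar x0 r \<rho>. epow (g x + ennreal (1 / \<rho> * \<bar>u x - c\<bar>)) p \<partial>M)"
proof -
  obtain \<eta> :: "'a \<Rightarrow> real" where \<eta>: "\<eta> \<in> borel_measurable borel" "\<And>x. 0 \<le> \<eta> x" "\<And>x. \<eta> x \<le> 1"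
    "\<And>x. x \<in> ball x0 r \<Longrightarrow> \<eta> x = 1" "\<And>x. x \<notin> ball x0 r \<Longrightarrow> x \<notin> collar x0 r \<rho> \<Longrightarrow> \<eta> x = 0"
    "\<And>\<gamma> l s t. arc_length_curve UNIV \<gamma> l \<Longrightarrow> 0 \<le> s \<Longrightarrow> s \<le> t \<Longrightarrow> t \<le> l \<Longrightarrow> \<bar>\<eta> (\<gamma> s) - \<eta> (\<gamma> t)\<bar> \<le> 1 / \<rho> * (t - s)"
    using ex_cutoff[OF \<rho>, of x0 r] by blast
  have cont: "continuous_on UNIV u" using u by (simp add: quasiharmonic_def)
  then have u_b: "u \<in> borel_measurable borel" by (rule borel_measurable_continuous_onI)
  note [measurable] = g u_b g[THEN borel_imp_measurable_M] u_b[THEN borel_imp_measurable_M] \<eta>(1) \<eta>(1)[THEN borel_imp_measurable_M]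
  define h where "h x = g x + ennreal (1 / \<rho> * \<bar>u x - c\<bar>)" for x
  have h[measurable]: "h \<in> borel_measurable borel" unfolding h_def by measurable
  have h_fin: "(\<integral>\<^sup>+x\<in>ball x0 R. epow (h x) p \<partial>M) < \<infinity>" for R
  proof -
    have "(\<integral>\<^sup>+x\<in>ball x0 R. epow (h x) p \<partial>M) \<le> (\<integral>\<^sup>+x. ennreal (2 powr p) *
       (epow (g x) p + ennreal ((1 / \<rho>) powr p) * (epow (ennreal \<bar>u x - c\<bar>) p * indicator (ball x0 R) x)) \<partial>M)"
    proof (rule nn_integral_mono)
      fix x
      have "epow (h x) p \<le> ennreal (2 powr p) * (epow (g x) p + epow (ennreal (1 / \<rho> * \<bar>u x - c\<bar>)) p)"
        unfolding h_def by (intro epow_add_le) simp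
      also have "epow (ennreal (1 / \<rho> * \<bar>u x - c\<bar>)) p = ennreal ((1 / \<rho>) powr p) * epow (ennreal \<bar>u x - c\<bar>) p"
        using \<rho> by (subst ennreal_mult) (auto intro!: epow_mult_ennreal)
      finally show "epow (h x) p * indicator (ball x0 R) x \<le> ennreal (2 powr p) *
         (epow (g x) p + ennreal ((1 / \<rho>) powr p) * (epow (ennreal \<bar>u x - c\<bar>) p * indicator (ball x0 R) x))"
        by (auto simp: indicator_def)
    qed
    also have "\<dots> = ennreal (2 powr p) * ((\<integral>\<^sup>+x. epow (g x) p \<partial>M) +
        ennreal ((1 / \<rho>) powr p) * (\<integral>\<^sup>+x\<in>ball x0 R. epow (ennreal \<bar>u x - c\<bar>) p \<partial>M))"
      by (simp add: nn_integral_cmult nn_integral_add)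
    also have "\<dots> < \<infinity>" using g_fin quasiharmonic_Lp_ball[OF u, where x = x0 and r = R and c = c]
      by (simp add: ennreal_mult_less_top ennreal_add_less_top)
    finally show ?thesis .
  qed
  have h_curve: "ae_curve (\<lambda>\<gamma> l. curve_integral \<gamma> l h < \<infinity>)"
    by (intro almost_every_curve_finite_integral_Lp_loc[OF D h] Lp_loc_of_balls[of _ x0] h_fin borel_imp_measurable_M h)
  have wug_c: "weak_upper_gradient M p (\<lambda>x. ereal (u x - c)) g"
    by (rule weak_upper_gradient_shift[OF g wug]) simp
  have cont_c: "continuous_on UNIV (\<lambda>x. u x - c)" using cont by (intro continuous_intros)
  have prod: "weak_upper_gradient M p (\<lambda>x. ereal (\<theta> x * (u x - c))) h"
    if "\<And>x. \<bar>\<theta> x\<bar> \<le> 1" "\<And>x y. \<bar>\<theta> x - \<theta> y\<bar> = \<bar>\<eta> x - \<eta> y\<bar>" for \<theta>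
    unfolding h_def[abs_def] using \<rho> \<eta>(6) that by (intro weak_upper_gradient_product[OF g wug_c cont_c]) auto
  define R where "R = r + \<rho>"
  have collar_sub: "dist x0 x < R" if x: "x \<in> collar x0 r \<rho>" for x
  proof -
    obtain z where z: "z \<in> frontier (ball x0 r)" "dist x z < \<rho>" using x by (auto simp: collar_def)
    have "closure (ball x0 r) \<subseteq> cball x0 r" by (simp add: closure_minimal ball_subset_cball)
    then have "dist x0 z \<le> r" using z(1) by (auto simp: frontier_def)
    then show ?thesis using z(2) dist_triangle[of x0 x z] by (simp add: R_def dist_commute)
  qed
  have \<eta>_out: "\<eta> x = 0" if "\<not> dist x0 x < R" for x
    using \<eta>(5)[of x] collar_sub[of x] that \<rho> by (force simp: R_def)
  define \<phi>' where "\<phi>' x = - \<eta> x * (u x - c)" for x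
  define \<phi> where "\<phi> x = ereal (\<phi>' x)" for x
  have \<phi>_m: "\<phi> \<in> borel_measurable M" unfolding \<phi>_def \<phi>'_def by measurable
  have "weak_upper_gradient M p (\<lambda>x. ereal (\<phi>' x)) h"
    unfolding \<phi>'_def by (rule prod) (use \<eta>(2,3) in \<open>auto simp: abs_le_iff\<close>)
  then have \<phi>_wug: "weak_upper_gradient M p \<phi> (\<lambda>x. if x \<in> - cball x0 R then 0 else h x)"
    unfolding \<phi>_def[abs_def] using h_curve
    by (intro weak_upper_gradient_zero_on_open[where c = 0] h) (auto simp: \<phi>'_def \<eta>_out)
  have \<phi>_g_fin: "(\<integral>\<^sup>+x. epow (if x \<in> - cball x0 R then 0 else h x) p \<partial>M) < \<infinity>"
  proof -
    have "(\<integral>\<^sup>+x. epow (if x \<in> - cball x0 R then 0 else h x) p \<partial>M) \<le> (\<integral>\<^sup>+x\<in>ball x0 (R + 1). epow (h x) p \<partial>M)"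
      by (intro nn_integral_mono) (auto simp: indicator_def)
    then show ?thesis using h_fin by (rule le_less_trans)
  qed
  have \<phi>_fin: "(\<integral>\<^sup>+x. epow (eabs (\<phi> x)) p \<partial>M) < \<infinity>"
  proof -
    have "(\<integral>\<^sup>+x. epow (eabs (\<phi> x)) p \<partial>M) \<le> (\<integral>\<^sup>+x\<in>ball x0 R. epow (ennreal \<bar>u x - c\<bar>) p \<partial>M)"
    proof (rule nn_integral_mono)
      fix x
      show "epow (eabs (\<phi> x)) p \<le> epow (ennreal \<bar>u x - c\<bar>) p * indicator (ball x0 R) x"
      proof (cases "dist x0 x < R")
        case True
        have "\<bar>\<phi>' x\<bar> \<le> 1 * \<bar>u x - c\<bar>" unfolding \<phi>'_def abs_mult using \<eta>(2,3)[of x] by (intro mult_right_mono) auto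
        then show ?thesis using True by (auto simp: \<phi>_def intro!: epow_mono ennreal_leI)
      qed (simp add: \<phi>_def \<phi>'_def \<eta>_out)
    qed
    then show ?thesis using quasiharmonic_Lp_ball[OF u] by (rule le_less_trans)
  qed
  have \<phi>_newt: "\<phi> \<in> newtonian M p"
  proof -
    have "(INF g \<in> {g. weak_upper_gradient M p \<phi> g}. \<integral>\<^sup>+x. epow (g x) p \<partial>M) < \<infinity>"
      unfolding INF_less_iff using \<phi>_wug by (intro bexI[of _ "\<lambda>x. if x \<in> - cball x0 R then 0 else h x"] \<phi>_g_fin) simp
    then show ?thesis using \<phi>_m \<phi>_fin by (auto simp: newtonian_def newtonian_norm_def epow_less_top_iff[simplified] ennreal_add_less_top)
  qed
  \<comment> \<open>The test function vanishes outside a bounded set, so it approximates itself.\<close>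
  have norm0: "newtonian_norm M p (\<lambda>x. \<phi> x - \<phi> x) = 0"
  proof -
    have eq: "(\<lambda>x. \<phi> x - \<phi> x) = (\<lambda>x. ereal 0)" by (rule ext) (simp add: \<phi>_def)
    have "weak_upper_gradient M p (\<lambda>x. ereal 0) (\<lambda>x. 0)"
      using h_curve by (subst weak_upper_gradient_iff_along) (auto simp: upper_gradient_along_def elim!: almost_every_curve_mono)
    then have "(INF g \<in> {g. weak_upper_gradient M p (\<lambda>x. ereal 0) g}. \<integral>\<^sup>+x. epow (g x) p \<partial>M) \<le> (\<integral>\<^sup>+x. epow 0 p \<partial>M)"
      by (intro INF_lower) auto
    then show ?thesis unfolding newtonian_norm_def eq by simp
  qed
  have \<phi>_clos: "\<phi> \<in> newtonian_bounded_support_closure M p"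
    unfolding newtonian_bounded_support_closure_def
  proof (intro CollectI conjI \<phi>_newt allI impI bexI[of _ \<phi>])
    show "\<exists>G. open G \<and> bounded G \<and> (\<forall>x. x \<notin> G \<longrightarrow> \<phi> x = 0)"
      by (intro exI[of _ "ball x0 R"]) (auto simp: \<phi>_def \<phi>'_def \<eta>_out zero_ereal_def)
    show "newtonian_norm M p (\<lambda>x. \<phi> x - \<phi> x) < ennreal \<epsilon>" if "0 < \<epsilon>" for \<epsilon> using that norm0 by simp
  qed
  define v where "v x = u x + \<phi>' x" for x
  have v_alt: "v x = (1 - \<eta> x) * (u x - c) + c" for x by (simp add: v_def \<phi>'_def algebra_simps)
  have v_eq: "(\<lambda>y. ereal (u y) + \<phi> y) = (\<lambda>y. ereal (v y))" by (simp add: \<phi>_def v_def)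
  have "weak_upper_gradient M p (\<lambda>x. ereal ((1 - \<eta> x) * (u x - c))) h"
    by (rule prod) (use \<eta>(2,3) in \<open>auto simp: abs_le_iff abs_minus_commute\<close>)
  then have v_wug: "real_gradient v h"
    by (rule weak_upper_gradient_shift[OF h]) (simp add: v_alt)
  \<comment> \<open>The gain: the competitor is constant in the ball.\<close>
  define h3 where "h3 x = (if x \<in> ball x0 r then 0 else h x)" for x
  have v_wug3: "real_gradient v h3"
    unfolding h3_def using h_curve
    by (intro weak_upper_gradient_zero_on_open[where c = c] h v_wug) (auto simp: v_alt \<eta>(4))
  have "Lp_loc M p h3"
  proof (rule Lp_loc_of_balls[of _ x0])
    show "h3 \<in> borel_measurable M" using v_wug3 by (simp add: weak_upper_gradient_def)
    fix n :: nat
    have "(\<integral>\<^sup>+x\<in>ball x0 (real n). epow (h3 x) p \<partial>M) \<le> (\<integral>\<^sup>+x\<in>ball x0 (real n). epow (h x) p \<partial>M)"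
      by (intro nn_integral_mono) (auto simp: indicator_def h3_def)
    then show "(\<integral>\<^sup>+x\<in>ball x0 (real n). epow (h3 x) p \<partial>M) < \<infinity>" using h_fin by (rule le_less_trans)
  qed
  moreover have "minimal_weak_upper_gradient M p (\<lambda>x. ereal (v x)) (min_wug M p (\<lambda>x. ereal (v x)))"
    by (rule min_wug_minimal[OF minimal_weak_upper_gradient_exists[OF D h v_wug h_fin]])
  ultimately have v_min: "AE x in M. min_wug M p (\<lambda>x. ereal (v x)) x \<le> h3 x"
    using v_wug3 unfolding minimal_weak_upper_gradient_def by blast
  have "(\<integral>\<^sup>+x\<in>ball x0 r. epow (g x) p \<partial>M) \<le> (\<integral>\<^sup>+x\<in>{x. \<phi> x \<noteq> 0}. epow (min_wug M p (\<lambda>x. ereal (u x)) x) p \<partial>M)"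
  proof (rule nn_integral_mono_AE)
    show "AE x in M. epow (g x) p * indicator (ball x0 r) x \<le> epow (min_wug M p (\<lambda>x. ereal (u x)) x) p * indicator {x. \<phi> x \<noteq> 0} x"
      using g_min c by eventually_elim (auto simp: indicator_def \<phi>_def \<phi>'_def \<eta>(4))
  qed
  also have "\<dots> \<le> ennreal Q * (\<integral>\<^sup>+x\<in>{x. \<phi> x \<noteq> 0}. epow (min_wug M p (\<lambda>y. ereal (v y)) x) p \<partial>M)"
    using Q[OF \<phi>_clos] unfolding v_eq .
  also have "\<dots> \<le> ennreal Q * (\<integral>\<^sup>+x\<in>collar x0 r \<rho>. epow (h x) p \<partial>M)"
  proof (intro mult_left_mono nn_integral_mono_AE)
    show "AE x in M. epow (min_wug M p (\<lambda>y. ereal (v y)) x) p * indicator {x. \<phi> x \<noteq> 0} x \<le> epow (h x) p * indicator (collar x0 r \<rho>) x"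
      using v_min
    proof eventually_elim
      case (elim x)
      have le: "epow (min_wug M p (\<lambda>y. ereal (v y)) x) p \<le> epow (h3 x) p" using elim by (intro epow_mono) auto
      show ?case
      proof (cases "x \<in> ball x0 r")
        case True then show ?thesis using le by (simp add: h3_def)
      next
        case False
        then show ?thesis using le \<eta>(5)[OF False] by (cases "x \<in> collar x0 r \<rho>") (auto simp: h3_def \<phi>_def \<phi>'_def indicator_def)
      qed
    qed
  qed auto
  finally show ?thesis unfolding h_def .
qed

end

section \<open>Chains without shortcuts\<close>

text \<open>
  Cutting out the part between two related nonadjacent entries shortens the list and
  preserves its ends.
\<close>
lemma successively_without_shortcuts:
  assumes "successively P xs" "xs \<noteq> []"
  obtains ys where "ys \<noteq> []" "hd ys = hd xs" "last ys = last xs" "set ys \<subseteq> set xs" "successively P ys"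
    "\<And>a b. Suc a < b \<Longrightarrow> b < length ys \<Longrightarrow> \<not> P (ys ! a) (ys ! b)"
proof -
  have "\<exists>ys. ys \<noteq> [] \<and> hd ys = hd xs \<and> last ys = last xs \<and> set ys \<subseteq> set xs \<and> successively P ys \<and>
    (\<forall>a b. Suc a < b \<and> b < length ys \<longrightarrow> \<not> P (ys ! a) (ys ! b))"
    using assms
  proof (induction "length xs" arbitrary: xs rule: less_induct)
    case less
    show ?case
    proof (cases "\<exists>a b. Suc a < b \<and> b < length xs \<and> P (xs ! a) (xs ! b)")
      case True
      then obtain a b where ab: "Suc a < b" "b < length xs" "P (xs ! a) (xs ! b)" by blast
      let ?ys = "take (Suc a) xs @ drop b xs"
      have t: "last (take (Suc a) xs) = xs ! a" "take (Suc a) xs \<noteq> []" using ab less.prems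
        by (auto simp: take_Suc_conv_app_nth)
      have d: "hd (drop b xs) = xs ! b" "drop b xs \<noteq> []" using ab by (auto simp: hd_drop_conv_nth)
      have "successively P (take (Suc a) xs)" "successively P (drop b xs)"
        using less.prems(1) by (metis append_take_drop_id successively_append_iff)+
      then have "successively P ?ys" using ab t d by (simp add: successively_append_iff)
      moreover have "length ?ys < length xs" using ab by auto
      moreover have "?ys \<noteq> []" using t by simp
      ultimately obtain zs where zs: "zs \<noteq> []" "hd zs = hd ?ys" "last zs = last ?ys" "set zs \<subseteq> set ?ys" "successively P zs"
         "\<forall>a b. Suc a < b \<and> b < length zs \<longrightarrow> \<not> P (zs ! a) (zs ! b)"
        using less.hyps[of ?ys] by blast
      moreover have "hd ?ys = hd xs" using t by simp
      moreover have "last ?ys = last xs" using d ab by (simp add: last_append)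
      moreover have "set ?ys \<subseteq> set xs" by (auto dest: in_set_takeD in_set_dropD)
      ultimately show ?thesis by (intro exI[of _ zs]) auto
    next
      case False
      then show ?thesis using less.prems by (intro exI[of _ xs]) auto
    qed
  qed
  then show thesis using that by metis
qed

lemma successively_abs_diff_le:
  fixes f :: "'b \<Rightarrow> real"
  assumes "xs \<noteq> []" "successively P xs" "\<And>p q. p \<in> set xs \<Longrightarrow> q \<in> set xs \<Longrightarrow> P p q \<Longrightarrow> \<bar>f p - f q\<bar> \<le> \<beta>"
  shows "\<bar>f (hd xs) - f (last xs)\<bar> \<le> real (length xs - 1) * \<beta>"
  using assms
proof (induction xs)
  case (Cons x xs)
  show ?case
  proof (cases xs)
    case (Cons y ys)
    have "P x y" "successively P xs" using Cons.prems(2) Cons by auto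
    then have 1: "\<bar>f x - f y\<bar> \<le> \<beta>" using Cons.prems(3)[of x y] Cons by auto
    have "\<bar>f (hd xs) - f (last xs)\<bar> \<le> real (length xs - 1) * \<beta>"
      using \<open>successively P xs\<close> Cons Cons.prems(3) by (intro Cons.IH) auto
    then show ?thesis using 1 Cons by (auto simp: algebra_simps)
  qed simp
qed simp

text \<open>
  In a chain without shortcuts the entries with even index are $\rho$-separated, so the number
  of steps is at most twice the size of a separated set, however long the given chain is.
\<close>
lemma chain_oscillation:
  fixes f :: "'a::metric_space \<Rightarrow> real"
  assumes n: "\<And>F. F \<subseteq> S \<Longrightarrow> finite F \<Longrightarrow> (\<And>a b. a \<in> F \<Longrightarrow> b \<in> F \<Longrightarrow> a \<noteq> b \<Longrightarrow> \<rho> \<le> dist a b) \<Longrightarrow> card F \<le> n"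
    and \<rho>: "0 < \<rho>" and \<beta>: "0 \<le> \<beta>"
    and step: "\<And>a b. a \<in> S \<Longrightarrow> b \<in> S \<Longrightarrow> dist a b < \<rho> \<Longrightarrow> \<bar>f a - f b\<bar> \<le> \<beta>"
    and xs: "xs \<noteq> []" "set xs \<subseteq> S" "successively (\<lambda>a b. dist a b < \<rho>) xs"
  shows "\<bar>f (hd xs) - f (last xs)\<bar> \<le> real (2 * n) * \<beta>"
proof -
  obtain ys where ys: "ys \<noteq> []" "hd ys = hd xs" "last ys = last xs" "set ys \<subseteq> set xs" "successively (\<lambda>a b. dist a b < \<rho>) ys"
    "\<And>a b. Suc a < b \<Longrightarrow> b < length ys \<Longrightarrow> \<not> dist (ys ! a) (ys ! b) < \<rho>"
    using successively_without_shortcuts[OF xs(3,1)] by metis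
  let ?I = "{i. 2 * i < length ys}"
  have sep: "\<rho> \<le> dist (ys ! (2 * i)) (ys ! (2 * j))" if "i \<in> ?I" "j \<in> ?I" "i \<noteq> j" for i j
    using ys(6)[of "2 * i" "2 * j"] ys(6)[of "2 * j" "2 * i"] that by (cases "i < j") (auto simp: dist_commute)
  have inj: "inj_on (\<lambda>i. ys ! (2 * i)) ?I" 
    using sep \<rho> by (intro inj_onI) (metis dist_self linorder_not_less)
  have I: "?I = {..<(length ys + 1) div 2}" by auto
  have "card ?I = card ((\<lambda>i. ys ! (2 * i)) ` ?I)" using inj by (simp add: card_image)
  also have "\<dots> \<le> n"
  proof (rule n)
    show "(\<lambda>i. ys ! (2 * i)) ` ?I \<subseteq> S" using ys(4) xs(2) nth_mem by fastforce
    show "finite ((\<lambda>i. ys ! (2 * i)) ` ?I)" unfolding I by simp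
    show "\<rho> \<le> dist a b" if "a \<in> (\<lambda>i. ys ! (2 * i)) ` ?I" "b \<in> (\<lambda>i. ys ! (2 * i)) ` ?I" "a \<noteq> b" for a b
      using that sep by blast
  qed
  finally have len: "length ys \<le> 2 * n" unfolding I by simp
  have "\<bar>f (hd ys) - f (last ys)\<bar> \<le> real (length ys - 1) * \<beta>"
    using ys(4) xs(2) by (intro successively_abs_diff_le[OF ys(1,5)] step) auto
  also have "\<dots> \<le> real (2 * n) * \<beta>" using len \<beta> by (intro mult_right_mono) auto
  finally show ?thesis using ys by simp
qed

section \<open>Separated sets in doubling spaces\<close>

locale doubling_space = metric_measure +
  fixes Cd :: real
  assumes doubling: "\<And>x r. 0 < r \<Longrightarrow> measure M (ball x (2 * r)) \<le> Cd * measure M (ball x r)"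
begin

lemma emeasure_ball: "emeasure M (ball (x :: 'a) r) = ennreal (measure M (ball x r))"
  using emeasure_ball_finite[of x r] by (intro emeasure_eq_ennreal_measure) simp

abbreviation vol :: "'a \<Rightarrow> real \<Rightarrow> real" where "vol x r \<equiv> measure M (ball x r)"

lemma measure_ball_pos: "0 < r \<Longrightarrow> 0 < vol x r"
  using mms emeasure_ball[of x r] unfolding metric_measure_space_def by (metis ennreal_less_zero_iff)

lemma measure_ball_mono: "ball x r \<subseteq> ball y s \<Longrightarrow> vol x r \<le> vol y s"
  using emeasure_ball_finite[of y s] by (intro measure_mono_fmeasurable) (auto simp: fmeasurable_def)

lemma Cd_ge_1: "1 \<le> Cd"
proof -
  have "vol x 1 \<le> Cd * vol x 1" for x
    using doubling[of 1 x] measure_ball_mono[of x 1 x 2] subset_ball[of 1 2 x] by simp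
  from this[of undefined] show ?thesis using measure_ball_pos[of 1 undefined] by simp
qed

lemma measure_ball_power: "0 < r \<Longrightarrow> vol x (2 ^ k * r) \<le> Cd ^ k * vol x r"
proof (induction k)
  case (Suc k)
  have "vol x (2 ^ Suc k * r) \<le> Cd * vol x (2 ^ k * r)"
    using doubling[of "2 ^ k * r" x] Suc.prems by (simp add: mult.assoc)
  also have "\<dots> \<le> Cd * (Cd ^ k * vol x r)"
    using Suc Cd_ge_1 by (intro mult_left_mono) auto
  finally show ?case by (simp add: mult.assoc)
qed simp

lemma measure_ball_le:
  assumes "0 < s" "dist x y + r \<le> 2 ^ k * s"
  shows "vol y r \<le> Cd ^ k * vol x s"
proof -
  have "ball y r \<subseteq> ball x (2 ^ k * s)"
  proof
    fix z assume "z \<in> ball y r"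
    then show "z \<in> ball x (2 ^ k * s)" using dist_triangle[of x z y] assms by simp
  qed
  then show ?thesis using measure_ball_mono measure_ball_power[OF assms(1)] by (meson order_trans)
qed

text \<open>
  The disjoint balls of radius $\sigma/2$ around the points of $F$ lie in one ball whose measure is at most
  $C_d^k$ times the measure of each of them.
\<close>
lemma card_separated_le:
  fixes q :: 'a
  assumes F: "F \<subseteq> ball q R" and \<sigma>: "0 < \<sigma>" and sep: "\<And>a b. a \<in> F \<Longrightarrow> b \<in> F \<Longrightarrow> a \<noteq> b \<Longrightarrow> \<sigma> \<le> dist a b"
    and k: "2 * R + \<sigma> / 2 \<le> 2 ^ k * (\<sigma> / 2)"
  shows "finite F" "real (card F) \<le> Cd ^ k"
proof -
  have bd: "real (card G) \<le> Cd ^ k" if "G \<subseteq> F" "finite G" for G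
  proof (cases "G = {}")
    case True then show ?thesis using Cd_ge_1 by simp
  next
    case False
    let ?m = "vol q (R + \<sigma> / 2)"
    have disj: "disjoint_family_on (\<lambda>y. ball y (\<sigma> / 2)) G"
      unfolding disjoint_family_on_def
    proof (intro ballI impI equals0I)
      fix a b z assume "a \<in> G" "b \<in> G" "a \<noteq> b" "z \<in> ball a (\<sigma> / 2) \<inter> ball b (\<sigma> / 2)"
      then show False using sep[of a b] \<open>G \<subseteq> F\<close> dist_triangle[of a b z] by (auto simp: dist_commute)
    qed
    have each: "?m \<le> Cd ^ k * vol y (\<sigma> / 2)" if "y \<in> G" for y
    proof (rule measure_ball_le)
      have "dist y q < R" using that \<open>G \<subseteq> F\<close> F by (auto simp: dist_commute)
      then show "dist y q + (R + \<sigma> / 2) \<le> 2 ^ k * (\<sigma> / 2)" using k by simp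
    qed (use \<sigma> in simp)
    have "real (card G) * ?m = (\<Sum>y\<in>G. ?m)" by simp
    also have "\<dots> \<le> (\<Sum>y\<in>G. Cd ^ k * vol y (\<sigma> / 2))" by (intro sum_mono each)
    also have "\<dots> = Cd ^ k * measure M (\<Union>y\<in>G. ball y (\<sigma> / 2))"
      unfolding sum_distrib_left[symmetric]
      using disj \<open>finite G\<close> emeasure_ball_finite by (subst measure_finite_Union) (auto simp: less_top[symmetric])
    also have "\<dots> \<le> Cd ^ k * ?m"
    proof (intro mult_left_mono measure_mono_fmeasurable)
      show "(\<Union>y\<in>G. ball y (\<sigma> / 2)) \<subseteq> ball q (R + \<sigma> / 2)"
      proof clarsimp
        fix y z assume "y \<in> G" "dist y z * 2 < \<sigma>"
        moreover have "dist q y < R" using \<open>y \<in> G\<close> \<open>G \<subseteq> F\<close> F by auto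
        ultimately show "dist q z < R + \<sigma> / 2" using dist_triangle[of q z y] by simp
      qed
      show "(\<Union>y\<in>G. ball y (\<sigma> / 2)) \<in> sets M" using \<open>finite G\<close> by (intro sets.finite_UN) auto
      show "ball q (R + \<sigma> / 2) \<in> fmeasurable M" using emeasure_ball_finite by (auto simp: fmeasurable_def)
    qed (use Cd_ge_1 in auto)
    finally have "real (card G) * ?m \<le> Cd ^ k * ?m" .
    moreover have "0 < ?m"
    proof (rule measure_ball_pos)
      obtain y where "y \<in> G" using False by blast
      then have "dist q y < R" using \<open>G \<subseteq> F\<close> F by auto
      then show "0 < R + \<sigma> / 2" using zero_le_dist[of q y] \<sigma> by linarith
    qed
    ultimately show ?thesis by simp
  qed
  then have "card G \<le> nat \<lfloor>Cd ^ k\<rfloor>" if "G \<subseteq> F" "finite G" for G using that by (simp add: le_nat_floor)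
  then show "finite F" using finite_if_finite_subsets_card_bdd by blast
  then show "real (card F) \<le> Cd ^ k" using bd by blast
qed

lemma ex_separated_net:
  assumes W: "bounded (W :: 'a set)" and \<sigma>: "0 < \<sigma>"
  obtains F where "finite F" "F \<subseteq> W" "\<And>a b. a \<in> F \<Longrightarrow> b \<in> F \<Longrightarrow> a \<noteq> b \<Longrightarrow> \<sigma> \<le> dist a b" "W \<subseteq> (\<Union>y\<in>F. ball y \<sigma>)"
proof -
  obtain q e where e: "\<And>x. x \<in> W \<Longrightarrow> dist q x \<le> e" using W by (auto simp: bounded_def)
  have WR: "W \<subseteq> ball q (e + 1)" using e by force
  obtain k where "(2 * (e + 1) + \<sigma> / 2) / (\<sigma> / 2) < 2 ^ k" using real_arch_pow[of 2] by auto
  then have k: "2 * (e + 1) + \<sigma> / 2 \<le> 2 ^ k * (\<sigma> / 2)" using \<sigma> by (simp add: field_simps)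
  define sep where "sep F \<longleftrightarrow> F \<subseteq> W \<and> (\<forall>a\<in>F. \<forall>b\<in>F. a \<noteq> b \<longrightarrow> \<sigma> \<le> dist a b)" for F
  have fin: "finite F" "card F \<le> nat \<lfloor>Cd ^ k\<rfloor>" if "sep F" for F
    using that card_separated_le[of F q "e + 1" \<sigma> k] WR \<sigma> k by (auto simp: sep_def le_nat_floor)
  have "sep {}" by (simp add: sep_def)
  then obtain F where F: "sep F" "\<And>G. sep G \<Longrightarrow> card G \<le> card F"
    using ex_has_greatest_nat[of sep "{}" card "Suc (nat \<lfloor>Cd ^ k\<rfloor>)"] fin(2) by (metis less_Suc_eq_le)
  have "W \<subseteq> (\<Union>y\<in>F. ball y \<sigma>)"
  proof (rule ccontr)
    assume "\<not> ?thesis"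
    then obtain x where x: "x \<in> W" "\<And>y. y \<in> F \<Longrightarrow> \<sigma> \<le> dist y x" by (meson UN_I linorder_not_less mem_ball subsetI)
    then have "x \<notin> F" using \<sigma> by force
    have "sep (insert x F)" using F(1) x by (auto simp: sep_def dist_commute)
    then have "card (insert x F) \<le> card F" by (rule F(2))
    then show False using \<open>x \<notin> F\<close> fin(1)[OF F(1)] by simp
  qed
  then show thesis using that[of F] F(1) fin(1) by (auto simp: sep_def)
qed

lemma ex_countable_dense: "\<exists>D. countable D \<and> closure D = (UNIV :: 'a set)"
proof -
  fix x0 :: 'a
  have "\<exists>F. finite F \<and> ball x0 (real n) \<subseteq> (\<Union>y\<in>F. ball y (1 / real (Suc k)))" for n k
    using ex_separated_net[OF bounded_ball, of "1 / real (Suc k)" x0 "real n"] by (metis divide_pos_pos of_nat_0_less_iff zero_less_Suc zero_less_one)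
  then obtain F where F: "\<And>n k. finite (F n k)" "\<And>n k. ball x0 (real n) \<subseteq> (\<Union>y\<in>F n k. ball y (1 / real (Suc k)))"
    by metis
  let ?D = "\<Union>n k. F n k"
  have "countable ?D" using F(1) by (intro countable_UN) (auto intro: countable_finite)
  moreover have "x \<in> closure ?D" for x
    unfolding closure_approachable
  proof (intro allI impI)
    fix e :: real assume "0 < e"
    obtain k where k: "1 / real (Suc k) < e" using nat_approx_posE[OF \<open>0 < e\<close>] by auto
    obtain n where "dist x0 x < real n" using reals_Archimedean2 by blast
    then obtain y where "y \<in> F n k" "dist y x < 1 / real (Suc k)" using F(2)[of n k] by auto
    then show "\<exists>y\<in>?D. dist y x < e" using k by (intro bexI[of _ y]) auto
  qed
  ultimately show ?thesis by blast
qed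

text \<open>
  A discrete form of Fubini's theorem for the double integral of $f(y)$ over $d(x,y) < \sigma$. In the
  $\sigma$-ball around a point of a $\sigma$-separated net, all averages are bounded in terms of the integral over
  one ball of radius $2\sigma$, and these larger balls have bounded overlap. The majorant is a finite
  combination of indicators, hence measurable in the centre $x$.
\<close>
lemma ball_averages_majorant:
  fixes f :: "'a \<Rightarrow> ennreal"
  assumes f[measurable]: "f \<in> borel_measurable M" and W: "bounded (W :: 'a set)" and \<sigma>: "0 < \<sigma>"
    and A[measurable]: "A \<in> sets M" and WA: "\<And>x y. x \<in> W \<Longrightarrow> dist x y < 2 * \<sigma> \<Longrightarrow> y \<in> A"
  obtains \<psi> where "\<psi> \<in> borel_measurable M"
    "\<forall>x\<in>W. (\<integral>\<^sup>+y\<in>ball x \<sigma>. f y \<partial>M) * ennreal (1 / vol x \<sigma>) \<le> \<psi> x"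
    "(\<integral>\<^sup>+x. \<psi> x \<partial>M) \<le> ennreal (Cd ^ 5) * (\<integral>\<^sup>+x\<in>A. f x \<partial>M)"
proof -
  obtain F where F: "finite F" "F \<subseteq> W" "\<And>a b. a \<in> F \<Longrightarrow> b \<in> F \<Longrightarrow> a \<noteq> b \<Longrightarrow> \<sigma> \<le> dist a b" "W \<subseteq> (\<Union>y\<in>F. ball y \<sigma>)"
    using ex_separated_net[OF W \<sigma>] by metis
  let ?I = "\<lambda>y. \<integral>\<^sup>+z\<in>ball y (2 * \<sigma>). f z \<partial>M"
  define \<psi> where "\<psi> x = (\<Sum>y\<in>F. ennreal (Cd / vol y \<sigma>) * ?I y * indicator (ball y \<sigma>) x)" for x
  have m: "\<psi> \<in> borel_measurable M" unfolding \<psi>_def by measurable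
  have le: "(\<integral>\<^sup>+y\<in>ball x \<sigma>. f y \<partial>M) * ennreal (1 / vol x \<sigma>) \<le> \<psi> x" if "x \<in> W" for x
  proof -
    obtain y where y: "y \<in> F" "x \<in> ball y \<sigma>" using F(4) \<open>x \<in> W\<close> by blast
    have d: "dist y x < \<sigma>" using y by simp
    have "ball x \<sigma> \<subseteq> ball y (2 * \<sigma>)"
    proof
      fix z assume "z \<in> ball x \<sigma>"
      then show "z \<in> ball y (2 * \<sigma>)" using dist_triangle[of y z x] d by simp
    qed
    then have 1: "(\<integral>\<^sup>+y\<in>ball x \<sigma>. f y \<partial>M) \<le> ?I y" by (intro nn_integral_mono) (auto simp: indicator_def)
    have "vol y \<sigma> \<le> Cd ^ 1 * vol x \<sigma>"
      using d \<sigma> by (intro measure_ball_le) (auto simp: dist_commute)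
    then have 2: "1 / vol x \<sigma> \<le> Cd / vol y \<sigma>"
      using measure_ball_pos[OF \<sigma>, of x] measure_ball_pos[OF \<sigma>, of y] by (simp add: field_simps)
    have "(\<integral>\<^sup>+y\<in>ball x \<sigma>. f y \<partial>M) * ennreal (1 / vol x \<sigma>) \<le> ?I y * ennreal (Cd / vol y \<sigma>)"
      using 1 2 by (intro mult_mono ennreal_leI) auto
    also have "\<dots> = ennreal (Cd / vol y \<sigma>) * ?I y * indicator (ball y \<sigma>) x" using y by (simp add: mult.commute)
    also have "\<dots> \<le> \<psi> x" unfolding \<psi>_def using y F(1) by (intro member_le_sum) auto
    finally show ?thesis .
  qed
  have overlap: "(\<Sum>y\<in>F. indicator (ball y (2 * \<sigma>)) z) \<le> ennreal (Cd ^ 4) * indicator A z" for z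
  proof (cases "\<exists>y\<in>F. dist y z < 2 * \<sigma>")
    case True
    then have zA: "z \<in> A" using WA F(2) by auto
    let ?G = "{y \<in> F. dist y z < 2 * \<sigma>}"
    have "real (card ?G) \<le> Cd ^ 4"
      using F(3) \<sigma> by (intro card_separated_le(2)[of ?G z "2 * \<sigma>" \<sigma>]) (auto simp: dist_commute)
    have "(\<Sum>y\<in>F. indicator (ball y (2 * \<sigma>)) z :: ennreal) = (\<Sum>y\<in>?G. 1)"
      using F(1) by (intro sum.mono_neutral_cong_right) (auto simp: indicator_def)
    also have "\<dots> = ennreal (real (card ?G))" by (simp add: ennreal_of_nat_eq_real_of_nat)
    also have "\<dots> \<le> ennreal (Cd ^ 4)" using \<open>real (card ?G) \<le> Cd ^ 4\<close> by (intro ennreal_leI)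
    finally show ?thesis using zA by simp
  next
    case False
    then have "(\<Sum>y\<in>F. indicator (ball y (2 * \<sigma>)) z :: ennreal) = 0" by (intro sum.neutral) auto
    then show ?thesis by simp
  qed
  have "(\<integral>\<^sup>+x. \<psi> x \<partial>M) = (\<Sum>y\<in>F. ennreal (Cd / vol y \<sigma>) * ?I y * emeasure M (ball y \<sigma>))"
    unfolding \<psi>_def by (simp add: nn_integral_sum nn_integral_cmult_indicator)
  also have "\<dots> = (\<Sum>y\<in>F. ennreal Cd * ?I y)"
  proof (intro sum.cong refl)
    fix y
    have "ennreal (Cd / vol y \<sigma>) * emeasure M (ball y \<sigma>) = ennreal Cd"
      unfolding emeasure_ball using measure_ball_pos[OF \<sigma>, of y] Cd_ge_1 by (subst ennreal_mult[symmetric]) auto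
    then show "ennreal (Cd / vol y \<sigma>) * ?I y * emeasure M (ball y \<sigma>) = ennreal Cd * ?I y"
      by (metis mult.assoc mult.commute)
  qed
  also have "\<dots> = ennreal Cd * (\<integral>\<^sup>+z. (\<Sum>y\<in>F. f z * indicator (ball y (2 * \<sigma>)) z) \<partial>M)"
    by (subst nn_integral_sum) (simp_all add: sum_distrib_left)
  also have "\<dots> \<le> ennreal Cd * (\<integral>\<^sup>+z. ennreal (Cd ^ 4) * (f z * indicator A z) \<partial>M)"
  proof (intro mult_left_mono nn_integral_mono)
    fix z
    show "(\<Sum>y\<in>F. f z * indicator (ball y (2 * \<sigma>)) z) \<le> ennreal (Cd ^ 4) * (f z * indicator A z)"
      using mult_left_mono[OF overlap[of z], of "f z"] by (simp add: sum_distrib_left mult_ac)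
  qed simp
  also have "\<dots> = ennreal (Cd ^ 5) * (\<integral>\<^sup>+x\<in>A. f x \<partial>M)"
  proof -
    have "ennreal (Cd ^ 5) = ennreal Cd * ennreal (Cd ^ 4)"
      using Cd_ge_1 by (simp flip: ennreal_mult power_Suc)
    then show ?thesis by (simp add: nn_integral_cmult mult.assoc)
  qed
  finally show thesis using that[OF m] le by blast
qed

end

section \<open>The Poincare inequality on annuli\<close>

definition set_average :: "'a measure \<Rightarrow> 'a set \<Rightarrow> ('a \<Rightarrow> real) \<Rightarrow> real" where
  "set_average M A u = (LINT x:A|M. u x) / measure M A"

definition annular_chains :: "'a::metric_space \<Rightarrow> real \<Rightarrow> real \<Rightarrow> real \<Rightarrow> bool" where
  "annular_chains x0 r \<Lambda> \<rho> \<longleftrightarrow> (\<forall>x \<in> frontier (ball x0 r). \<forall>y \<in> frontier (ball x0 r).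
     \<exists>xs. xs \<noteq> [] \<and> hd xs = x \<and> last xs = y \<and> set xs \<subseteq> ball x0 (\<Lambda> * r) - ball x0 (r / \<Lambda>) \<and>
       (\<forall>k. Suc k < length xs \<longrightarrow> dist (xs ! k) (xs ! Suc k) < \<rho>))"

text \<open>
  In the application $f = g_u^p$; the Poincare inequality enters only in the form below.
\<close>
locale poincare_function = doubling_space M p Cd for M :: "'a::metric_space measure" and p Cd +
  fixes Cp lam :: real and u :: "'a \<Rightarrow> real" and f :: "'a \<Rightarrow> ennreal"
  assumes lam: "1 \<le> lam" and Cp: "0 < Cp" and u_cont: "continuous_on UNIV u"
    and f_meas: "f \<in> borel_measurable M" and f_fin: "(\<integral>\<^sup>+x. f x \<partial>M) < \<infinity>"
    and u_int: "\<And>x s. set_integrable M (ball x s) u"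
    and poincare: "\<And>x s. 0 < s \<Longrightarrow>
      (LINT y:ball x s|M. \<bar>u y - set_average M (ball x s) u\<bar>) / vol x s \<le>
      Cp * s * (enn2real (\<integral>\<^sup>+y\<in>ball x (lam * s). f y \<partial>M) / vol x (lam * s)) powr (1 / p)"
begin

lemma p_nonneg [simp]: "0 \<le> p" "p \<noteq> 0" using p_gt_1 by auto

abbreviation avg :: "'a \<Rightarrow> real \<Rightarrow> real" where "avg x s \<equiv> set_average M (ball x s) u"

definition energy :: "'a set \<Rightarrow> real" where "energy A = enn2real (\<integral>\<^sup>+x\<in>A. f x \<partial>M)"

definition energy_density :: "'a \<Rightarrow> real \<Rightarrow> real" where "energy_density x s = energy (ball x s) / vol x s"

lemma nn_energy: "(\<integral>\<^sup>+x\<in>A. f x \<partial>M) = ennreal (energy A)"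
proof -
  have "(\<integral>\<^sup>+x\<in>A. f x \<partial>M) \<le> (\<integral>\<^sup>+x. f x \<partial>M)" by (intro nn_integral_mono) (auto simp: indicator_def)
  then have "(\<integral>\<^sup>+x\<in>A. f x \<partial>M) < top" using f_fin by (simp add: le_less_trans)
  then show ?thesis by (simp add: energy_def)
qed

lemma energy_nonneg: "0 \<le> energy A" by (simp add: energy_def)

lemma energy_mono: "A \<subseteq> B \<Longrightarrow> energy A \<le> energy B"
proof -
  assume "A \<subseteq> B"
  then have "ennreal (energy A) \<le> ennreal (energy B)"
    unfolding nn_energy[symmetric] by (intro nn_integral_mono) (auto simp: indicator_def)
  then show ?thesis using energy_nonneg by (simp add: ennreal_le_iff)
qed

lemma energy_density_nonneg: "0 \<le> energy_density x s" by (simp add: energy_density_def energy_nonneg)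

lemma integrable_const_ball: "set_integrable M (ball x s) (\<lambda>_. c :: real)"
  using emeasure_ball_finite[of x s] by (auto simp: set_integrable_def less_top)

lemma integrable_diff_ball: "set_integrable M (ball x s) (\<lambda>y. u y - c)"
  by (intro set_integral_diff u_int integrable_const_ball)

lemma avg_minus:
  assumes "0 < s" shows "avg x s - c = (LINT y:ball x s|M. u y - c) / vol x s"
proof -
  have "(LINT y:ball x s|M. u y - c) = (LINT y:ball x s|M. u y) - (LINT y:ball x s|M. c)"
    by (intro set_integral_diff u_int integrable_const_ball)
  also have "(LINT y:ball x s|M. c) = c * vol x s"
    by (simp add: set_lebesgue_integral_def)
  finally show ?thesis using measure_ball_pos[OF assms, of x] by (simp add: set_average_def field_simps)
qed

lemma abs_avg_minus_le:
  assumes "0 < s" shows "\<bar>avg x s - c\<bar> \<le> (LINT y:ball x s|M. \<bar>u y - c\<bar>) / vol x s"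
proof -
  have "\<bar>LINT y:ball x s|M. u y - c\<bar> \<le> (LINT y:ball x s|M. \<bar>u y - c\<bar>)"
    using set_integral_norm_bound[OF integrable_diff_ball[of x s c]] by simp
  then show ?thesis unfolding avg_minus[OF assms] using measure_ball_pos[OF assms, of x]
    by (simp add: divide_right_mono)
qed

lemma avg_nested_ball:
  assumes "0 < t" "0 < s" and sub: "ball y t \<subseteq> ball x s" and K: "vol x s \<le> K * vol y t"
  shows "\<bar>avg y t - avg x s\<bar> \<le> K * (Cp * s * energy_density x (lam * s) powr (1 / p))"
proof -
  let ?a = "avg x s"
  have my: "0 < vol y t" and mx: "0 < vol x s" using assms measure_ball_pos by auto
  have K0: "0 < K" using my mx K by (metis less_le_trans linorder_not_less mult_nonpos_nonneg less_imp_le)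
  have i: "set_integrable M (ball x s) (\<lambda>z. \<bar>u z - ?a\<bar>)"
    by (intro set_integrable_abs integrable_diff_ball)
  have nonneg: "0 \<le> (LINT z:ball x s|M. \<bar>u z - ?a\<bar>)"
    unfolding set_lebesgue_integral_def by (intro integral_nonneg_AE) auto
  have "\<bar>avg y t - ?a\<bar> \<le> (LINT z:ball y t|M. \<bar>u z - ?a\<bar>) / vol y t"
    by (rule abs_avg_minus_le[OF assms(1)])
  also have "\<dots> \<le> (LINT z:ball x s|M. \<bar>u z - ?a\<bar>) / vol y t"
  proof (intro divide_right_mono)
    show "(LINT z:ball y t|M. \<bar>u z - ?a\<bar>) \<le> (LINT z:ball x s|M. \<bar>u z - ?a\<bar>)"
      using i set_integrable_abs[OF integrable_diff_ball[of y t ?a]] sub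
      unfolding set_lebesgue_integral_def set_integrable_def
      by (intro integral_mono) (auto simp: indicator_def)
  qed simp
  also have "\<dots> \<le> K * ((LINT z:ball x s|M. \<bar>u z - ?a\<bar>) / vol x s)"
  proof -
    have "1 / vol y t \<le> K / vol x s" using K my mx by (simp add: field_simps)
    from mult_left_mono[OF this nonneg] show ?thesis by (simp add: mult_ac)
  qed
  also have "\<dots> \<le> K * (Cp * s * energy_density x (lam * s) powr (1 / p))"
    using poincare[OF assms(2), of x] K0 unfolding energy_density_def energy_def by (intro mult_left_mono) auto
  finally show ?thesis .
qed

lemma avg_tendsto:
  assumes r: "\<And>i::nat. 0 < r i" "r \<longlonglongrightarrow> 0"
  shows "(\<lambda>i. avg x (r i)) \<longlonglongrightarrow> u x"
proof (rule LIMSEQ_I)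
  fix e :: real assume "0 < e"
  then obtain d where d: "0 < d" "\<And>y. dist y x < d \<Longrightarrow> dist (u y) (u x) < e / 2"
    using u_cont unfolding continuous_on_iff by (metis UNIV_I half_gt_zero)
  obtain n where n: "\<And>i. n \<le> i \<Longrightarrow> r i < d" using LIMSEQ_D[OF r(2) d(1)] by fastforce
  have "norm (avg x (r i) - u x) < e" if "n \<le> i" for i
  proof -
    have m: "0 < vol x (r i)" by (rule measure_ball_pos[OF r(1)])
    have "(LINT y:ball x (r i)|M. \<bar>u y - u x\<bar>) \<le> (LINT y:ball x (r i)|M. e / 2)"
      using n[OF that] d(2)
      by (intro set_integral_mono set_integrable_abs integrable_diff_ball integrable_const_ball)
        (auto simp: dist_real_def dist_commute less_imp_le)
    also have "\<dots> = e / 2 * vol x (r i)" by (simp add: set_lebesgue_integral_def)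
    finally have "(LINT y:ball x (r i)|M. \<bar>u y - u x\<bar>) / vol x (r i) \<le> e / 2"
      using m by (simp add: divide_le_eq)
    then show ?thesis using abs_avg_minus_le[OF r(1), of x i "u x"] \<open>0 < e\<close> unfolding real_norm_def by linarith
  qed
  then show "\<exists>no. \<forall>i\<ge>no. norm (avg x (r i) - u x) < e" by blast
qed

text \<open>
  Telescoping over the radii $4^{-i}\rho$ gives increments of order $4^{-i} \rho D_i^{1/p}$, where $D_i$
  is the energy density at scale $\lambda 4^{-i}\rho$. If $t$ is the sum of the series, then $2^{-i} D_i \le t$, so
  $D_i^{1/p} \le 2^i t^{1/p}$ and the increments are dominated by a geometric series with ratio $1/2$.
  The ratio $1/4$ of the radii leaves room for this crude bound.
\<close>
lemma pointwise_average_bound: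
  assumes \<rho>: "0 < \<rho>"
  shows "epow (ennreal \<bar>u x - avg x \<rho>\<bar>) p \<le> ennreal ((2 * (Cd\<^sup>2 * Cp) * \<rho>) powr p) *
     (\<Sum>i. ennreal ((1/2) ^ i * energy_density x (lam * ((1/4) ^ i * \<rho>))))" (is "_ \<le> _ * ?T")
proof (cases "?T = \<infinity>")
  case True
  have "(2 * (Cd\<^sup>2 * Cp) * \<rho>) powr p > 0" using \<rho> Cp Cd_ge_1 by simp
  then show ?thesis using True by (simp add: ennreal_mult_top)
next
  case False
  define t where "t = enn2real ?T"
  have t: "?T = ennreal t" "0 \<le> t" using False by (simp_all add: t_def less_top)
  define K where "K = Cd\<^sup>2 * Cp"
  have K: "0 < K" using Cp Cd_ge_1 by (simp add: K_def)
  define a where "a i = avg x ((1/4) ^ i * \<rho>)" for i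
  define q where "q = t powr (1 / p)"
  have q0: "0 \<le> q" by (simp add: q_def)
  have inc: "\<bar>a (Suc i) - a i\<bar> \<le> K * \<rho> * q * (1/2) ^ i" for i
  proof -
    let ?s = "(1/4) ^ i * \<rho>" 
    let ?d = "energy_density x (lam * ?s)"
    have s: "0 < ?s" using \<rho> by simp
    have "\<bar>a (Suc i) - a i\<bar> \<le> Cd\<^sup>2 * (Cp * ?s * ?d powr (1 / p))"
      unfolding a_def
    proof (rule avg_nested_ball)
      show "ball x ((1/4) ^ Suc i * \<rho>) \<subseteq> ball x ?s" using \<rho> by (intro subset_ball) simp
      show "vol x ?s \<le> Cd\<^sup>2 * vol x ((1/4) ^ Suc i * \<rho>)"
        using \<rho> by (intro measure_ball_le) auto
    qed (use \<rho> in auto)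
    also have "?d powr (1 / p) \<le> 2 ^ i * q"
    proof -
      have "ennreal ((1/2) ^ i * ?d) = (\<Sum>k\<in>{i}. ennreal ((1/2) ^ k * energy_density x (lam * ((1/4) ^ k * \<rho>))))" by simp
      also have "\<dots> \<le> ?T" by (rule sum_le_suminf) auto
      finally have "(1/2) ^ i * ?d \<le> t" unfolding t(1) using t(2) by (simp add: ennreal_le_iff)
      then have "?d \<le> 2 ^ i * t" by (simp add: field_simps power_divide)
      then have "?d powr (1 / p) \<le> (2 ^ i * t) powr (1 / p)" using energy_density_nonneg p_pos by (intro powr_mono2) auto
      also have "\<dots> = (2 ^ i) powr (1 / p) * q" using t(2) by (simp add: powr_mult q_def)
      also have "\<dots> \<le> 2 ^ i * q"
      proof (intro mult_right_mono q0)
        have "(2 ^ i :: real) powr (1 / p) \<le> (2 ^ i) powr 1" using p_gt_1 by (intro powr_mono) auto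
        then show "(2 ^ i :: real) powr (1 / p) \<le> 2 ^ i" by simp
      qed
      finally show ?thesis .
    qed
    then have "Cd\<^sup>2 * (Cp * ?s * ?d powr (1 / p)) \<le> Cd\<^sup>2 * (Cp * ?s * (2 ^ i * q))"
      using Cp s by (intro mult_left_mono) auto
    also have "\<dots> = K * \<rho> * q * ((1/4) ^ i * 2 ^ i)" by (simp add: K_def mult_ac)
    also have "(1/4::real) ^ i * 2 ^ i = (1/2) ^ i" by (simp flip: power_mult_distrib)
    finally show ?thesis by simp
  qed
  have part: "\<bar>a n - a 0\<bar> \<le> K * \<rho> * q * (2 - 2 * (1/2) ^ n)" for n
  proof (induction n)
    case (Suc n)
    have "\<bar>a (Suc n) - a 0\<bar> \<le> \<bar>a (Suc n) - a n\<bar> + \<bar>a n - a 0\<bar>" by simp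
    also have "\<dots> \<le> K * \<rho> * q * (1/2) ^ n + K * \<rho> * q * (2 - 2 * (1/2) ^ n)" using inc[of n] Suc by simp
    also have "\<dots> = K * \<rho> * q * (2 - 2 * (1/2) ^ Suc n)" by (simp add: algebra_simps)
    finally show ?case .
  qed simp
  have "a \<longlonglongrightarrow> u x"
    unfolding a_def
  proof (rule avg_tendsto)
    show "(\<lambda>i. (1/4) ^ i * \<rho>) \<longlonglongrightarrow> 0" by (rule tendsto_mult_left_zero) (simp add: LIMSEQ_power_zero)
  qed (use \<rho> in simp)
  then have "(\<lambda>n. \<bar>a n - a 0\<bar>) \<longlonglongrightarrow> \<bar>u x - a 0\<bar>" by (intro tendsto_intros)
  moreover have "\<bar>a n - a 0\<bar> \<le> 2 * K * \<rho> * q" for n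
  proof -
    have "K * \<rho> * q * (2 - 2 * (1/2) ^ n) \<le> K * \<rho> * q * 2" using K \<rho> q0 by (intro mult_left_mono) auto
    then show ?thesis using part[of n] by simp
  qed
  ultimately have "\<bar>u x - a 0\<bar> \<le> 2 * K * \<rho> * q" by (intro LIMSEQ_le_const2) auto
  then have "\<bar>u x - avg x \<rho>\<bar> powr p \<le> (2 * K * \<rho> * q) powr p"
    by (intro powr_mono2) (auto simp: a_def)
  also have "\<dots> = (2 * K * \<rho>) powr p * t"
    using K \<rho> q0 t(2) p_gt_1 by (simp add: powr_mult q_def powr_powr)
  finally show ?thesis
    using t(2) unfolding t(1) by (simp add: epow_ennreal ennreal_mult[symmetric] K_def ennreal_leI)
qed

text \<open>
  The first summand comes from the oscillation of $u$ within balls of radius $\rho$, the second from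
  the change of the means along chains, with \<open>n\<close> bounding the size of $\rho$-separated sets.
\<close>
definition annular_constant :: "nat \<Rightarrow> nat \<Rightarrow> real" where
  "annular_constant n k1 = 2 powr p * (2 * (2 * (Cd\<^sup>2 * Cp)) powr p * Cd ^ 5 +
       ((4 * real n + 2) * (2 * (Cd\<^sup>2 * Cp))) powr p * Cd ^ (k1 + 1))"

text \<open>
  All balls used stay outside $B(x_0, r/(2\Lambda))$, which explains the choice of $\rho$; those of radius
  $2\lambda\rho$ have measure comparable to that of $B(x_0,r)$, with a constant governed by \<open>k1\<close>, while
  \<open>k2\<close> bounds the size of $\rho$-separated subsets of the annulus. The bound holds for all constants in
  an interval of positive length, even when the energy outside the ball vanishes, because it is
  stated with a positive \<open>\<tau>\<close>; this is the freedom that the test function needs.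
\<close>
theorem annular_poincare:
  fixes x0 :: 'a and r \<Lambda> \<tau> :: real and k1 k2 :: nat
  assumes \<Lambda>: "1 < \<Lambda>" and r: "0 < r" and k1: "4 * \<Lambda> * (\<Lambda> + 1) \<le> 2 ^ k1" and k2: "32 * lam * \<Lambda>\<^sup>2 + 1 \<le> 2 ^ k2"
    and \<tau>: "0 < \<tau>" and en: "energy (- ball x0 (r / (2 * \<Lambda>))) \<le> \<tau>"
    and n: "n = nat \<lfloor>Cd ^ k2\<rfloor>" and \<rho>: "\<rho> = r / (8 * lam * \<Lambda>)"
    and chain: "annular_chains x0 r \<Lambda> \<rho>"
  shows "\<exists>c0 \<delta>. 0 < \<delta> \<and> (\<forall>c. \<bar>c - c0\<bar> \<le> \<delta> \<longrightarrow>
     (\<integral>\<^sup>+x\<in>collar x0 r \<rho>. epow (ennreal (1 / \<rho> * \<bar>u x - c\<bar>)) p \<partial>M) \<le>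
     ennreal (annular_constant n k1 * \<tau>))"
proof -
  let ?S = "ball x0 (\<Lambda> * r) - ball x0 (r / \<Lambda>)"
  let ?m = "vol x0 r"
  define K where "K = Cd\<^sup>2 * Cp"
  have K: "0 < K" using Cp Cd_ge_1 by (simp add: K_def)
  have m: "0 < ?m" by (rule measure_ball_pos[OF r])
  have \<rho>0: "0 < \<rho>" using r lam \<Lambda> by (simp add: \<rho>)
  have lr: "lam * (2 * \<rho>) = r / (4 * \<Lambda>)" using lam \<Lambda> by (simp add: \<rho> field_simps)
  have \<rho>r: "\<rho> < r"
  proof -
    have "1 \<le> lam * \<Lambda>" using lam \<Lambda> by (metis less_imp_le mult_mono mult_1 zero_le_one order_trans)
    then show ?thesis using r lam \<Lambda> by (simp add: \<rho> field_simps)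
  qed
  have quarter: "r / (4 * \<Lambda>) + r / (2 * \<Lambda>) \<le> r / \<Lambda>" "r / \<Lambda> \<le> r" using r \<Lambda> by (simp_all add: field_simps)
  define b where "b = Cd ^ k1 * \<tau> / ?m"
  have b0: "0 < b" using Cd_ge_1 \<tau> m by (simp add: b_def)
  \<comment> \<open>The oscillation of the means over one ball of radius \<open>2 * \<rho>\<close>, and also the admissible deviation of \<open>c\<close> from \<open>c0\<close>.\<close>
  define \<delta> where "\<delta> = K * (2 * \<rho>) * b powr (1 / p)"
  have \<delta>0: "0 < \<delta>" using K \<rho>0 b0 by (simp add: \<delta>_def)
  have dens: "energy_density a (lam * (2 * \<rho>)) \<le> b" if a: "a \<in> ?S" for a
  proof -
    have "ball a (lam * (2 * \<rho>)) \<subseteq> - ball x0 (r / (2 * \<Lambda>))"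
    proof
      fix z assume "z \<in> ball a (lam * (2 * \<rho>))"
      then show "z \<in> - ball x0 (r / (2 * \<Lambda>))"
        using a dist_triangle[of x0 a z] quarter unfolding lr by (auto simp: dist_commute)
    qed
    then have "energy (ball a (lam * (2 * \<rho>))) \<le> \<tau>" using energy_mono en by (meson order_trans)
    moreover have "?m \<le> Cd ^ k1 * vol a (lam * (2 * \<rho>))"
      unfolding lr
    proof (rule measure_ball_le)
      have "dist a x0 + r \<le> (\<Lambda> + 1) * r" using a by (auto simp: dist_commute algebra_simps)
      also have "\<dots> = 4 * \<Lambda> * (\<Lambda> + 1) * (r / (4 * \<Lambda>))" using \<Lambda> by (simp add: field_simps)
      also have "\<dots> \<le> 2 ^ k1 * (r / (4 * \<Lambda>))" using k1 r \<Lambda> by (intro mult_right_mono) auto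
      finally show "dist a x0 + r \<le> 2 ^ k1 * (r / (4 * \<Lambda>))" .
    qed (use r \<Lambda> in auto)
    moreover have "0 < vol a (lam * (2 * \<rho>))" using lam \<rho>0 by (intro measure_ball_pos) auto
    ultimately show ?thesis unfolding energy_density_def b_def using m \<tau>
      by (simp add: divide_le_eq le_divide_eq mult_ac)
        (metis (no_types, opaque_lifting) mult.commute mult_mono less_imp_le energy_nonneg measure_nonneg)
  qed
  have near: "\<bar>avg y \<rho> - avg a (2 * \<rho>)\<bar> \<le> \<delta>" if a: "a \<in> ?S" and y: "dist a y < \<rho>" for a y
  proof -
    have "\<bar>avg y \<rho> - avg a (2 * \<rho>)\<bar> \<le> Cd\<^sup>2 * (Cp * (2 * \<rho>) * energy_density a (lam * (2 * \<rho>)) powr (1 / p))"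
    proof (rule avg_nested_ball)
      show "ball y \<rho> \<subseteq> ball a (2 * \<rho>)"
      proof
        fix z assume "z \<in> ball y \<rho>"
        then show "z \<in> ball a (2 * \<rho>)" using y dist_triangle[of a z y] by simp
      qed
      show "vol a (2 * \<rho>) \<le> Cd\<^sup>2 * vol y \<rho>"
        using \<rho>0 y by (intro measure_ball_le) (auto simp: dist_commute)
    qed (use \<rho>0 in auto)
    also have "\<dots> \<le> Cd\<^sup>2 * (Cp * (2 * \<rho>) * b powr (1 / p))"
      using dens[OF a] energy_density_nonneg Cp \<rho>0 by (intro mult_left_mono powr_mono2) auto
    also have "\<dots> = \<delta>" by (simp add: \<delta>_def K_def)
    finally show ?thesis .
  qed
  have step: "\<bar>avg a (2 * \<rho>) - avg a' (2 * \<rho>)\<bar> \<le> 2 * \<delta>" if "a \<in> ?S" "a' \<in> ?S" "dist a a' < \<rho>" for a a'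
    using near[of a a'] near[of a' a'] that \<rho>0 by simp
  have card: "card F \<le> n" if F: "F \<subseteq> ?S" "\<And>a b. a \<in> F \<Longrightarrow> b \<in> F \<Longrightarrow> a \<noteq> b \<Longrightarrow> \<rho> \<le> dist a b" for F
  proof -
    have "2 * (\<Lambda> * r) + \<rho> / 2 = (32 * lam * \<Lambda>\<^sup>2 + 1) * (\<rho> / 2)"
      using lam \<Lambda> by (simp add: \<rho> field_simps power2_eq_square)
    also have "\<dots> \<le> 2 ^ k2 * (\<rho> / 2)" using k2 \<rho>0 by (intro mult_right_mono) auto
    finally have "real (card F) \<le> Cd ^ k2" using F \<rho>0 by (intro card_separated_le(2)[of F x0 "\<Lambda> * r" \<rho>]) auto
    then show ?thesis unfolding n by (rule le_nat_floor)
  qed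
  have osc: "\<bar>avg y (2 * \<rho>) - avg z (2 * \<rho>)\<bar> \<le> real (2 * n) * (2 * \<delta>)"
    if yz: "y \<in> frontier (ball x0 r)" "z \<in> frontier (ball x0 r)" for y z
  proof -
    obtain xs where xs: "xs \<noteq> []" "hd xs = y" "last xs = z" "set xs \<subseteq> ?S"
      "\<forall>k. Suc k < length xs \<longrightarrow> dist (xs ! k) (xs ! Suc k) < \<rho>"
      using chain yz unfolding annular_chains_def by blast
    have "successively (\<lambda>a b. dist a b < \<rho>) xs" using xs(5) by (auto simp: successively_conv_nth)
    from chain_oscillation[where f = "\<lambda>a. avg a (2 * \<rho>)", OF card \<rho>0 _ step xs(1,4) this] \<delta>0
    show ?thesis using xs(2,3) by simp
  qed
  obtain c0 where c0: "\<And>z. z \<in> frontier (ball x0 r) \<Longrightarrow> \<bar>avg z (2 * \<rho>) - c0\<bar> \<le> real (2 * n) * (2 * \<delta>)"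
    using osc by (metis all_not_in_conv)
  have frontier_dist: "dist x0 z = r" if z: "z \<in> frontier (ball x0 r)" for z
  proof -
    have "closure (ball x0 r) \<subseteq> cball x0 r" by (simp add: closure_minimal ball_subset_cball)
    then show ?thesis using z by (force simp: frontier_def)
  qed
  have frontier_S: "z \<in> ?S" if "z \<in> frontier (ball x0 r)" for z
    using frontier_dist[OF that] r \<Lambda> quarter by auto
  let ?N = "collar x0 r \<rho>"
  have N_avg: "\<bar>avg x \<rho> - c0\<bar> \<le> (4 * real n + 1) * \<delta>" if x: "x \<in> ?N" for x
  proof -
    obtain z where z: "z \<in> frontier (ball x0 r)" "dist x z < \<rho>" using x by (auto simp: collar_def)
    then show ?thesis using c0[OF z(1)] near[OF frontier_S[OF z(1)], of x] by (simp add: dist_commute algebra_simps)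
  qed
  have N_dist: "r \<le> dist x0 x" "dist x0 x < 2 * r" if x: "x \<in> ?N" for x
  proof -
    obtain z where z: "z \<in> frontier (ball x0 r)" "dist x z < \<rho>" using x by (auto simp: collar_def)
    show "dist x0 x < 2 * r" using frontier_dist[OF z(1)] z(2) \<rho>r dist_triangle[of x0 x z] by (simp add: dist_commute)
    show "r \<le> dist x0 x" using x by (simp add: collar_def)
  qed
  have N_bdd: "bounded ?N" by (rule bounded_subset[OF bounded_ball[of x0 "2 * r"]]) (use N_dist in auto)
  let ?A = "- ball x0 (r / (2 * \<Lambda>))"
  let ?\<sigma> = "\<lambda>i. lam * ((1/4) ^ i * \<rho>)"
  have \<sigma>0: "0 < ?\<sigma> i" for i using lam \<rho>0 by simp
  define maj where "maj i \<psi> \<longleftrightarrow> \<psi> \<in> borel_measurable M \<and> (\<forall>x\<in>?N. ennreal (energy_density x (?\<sigma> i)) \<le> \<psi> x) \<and>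
     (\<integral>\<^sup>+x. \<psi> x \<partial>M) \<le> ennreal (Cd ^ 5 * \<tau>)" for i \<psi>
  have "\<exists>\<psi>. maj i \<psi>" for i
  proof -
    have A: "?A \<in> sets M" by (rule sets_M_borel) simp
    have in_A: "y \<in> ?A" if "x \<in> ?N" "dist x y < 2 * ?\<sigma> i" for x y
    proof -
      have "?\<sigma> i \<le> lam * \<rho>" using lam \<rho>0 by (intro mult_left_mono) (auto simp: power_le_one mult_le_cancel_right1)
      then have "dist x y < r / (4 * \<Lambda>)" using that(2) lr by linarith
      then have "r / (2 * \<Lambda>) \<le> dist x0 y" using N_dist(1)[OF that(1)] dist_triangle[of x0 x y] quarter
        by (simp add: dist_commute)
      then show ?thesis by simp
    qed
    obtain \<psi> where \<psi>: "\<psi> \<in> borel_measurable M"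
      "\<forall>x\<in>?N. (\<integral>\<^sup>+y\<in>ball x (?\<sigma> i). f y \<partial>M) * ennreal (1 / vol x (?\<sigma> i)) \<le> \<psi> x"
      "(\<integral>\<^sup>+x. \<psi> x \<partial>M) \<le> ennreal (Cd ^ 5) * (\<integral>\<^sup>+x\<in>?A. f x \<partial>M)"
      by (rule ball_averages_majorant[OF f_meas N_bdd \<sigma>0[of i] A in_A]) blast
    have "ennreal (energy_density x (?\<sigma> i)) \<le> \<psi> x" if "x \<in> ?N" for x
      using \<psi>(2)[rule_format, OF that] energy_nonneg unfolding nn_energy energy_density_def by (simp flip: ennreal_mult)
    moreover have "(\<integral>\<^sup>+x. \<psi> x \<partial>M) \<le> ennreal (Cd ^ 5 * \<tau>)"
    proof -
      have "ennreal (Cd ^ 5) * (\<integral>\<^sup>+x\<in>?A. f x \<partial>M) \<le> ennreal (Cd ^ 5) * ennreal \<tau>"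
        unfolding nn_energy by (intro mult_left_mono ennreal_leI en) simp
      also have "\<dots> = ennreal (Cd ^ 5 * \<tau>)" using Cd_ge_1 \<tau> by (simp add: ennreal_mult)
      finally show ?thesis using \<psi>(3) by (rule order_trans[rotated])
    qed
    ultimately show ?thesis using \<psi>(1) unfolding maj_def by blast
  qed
  then obtain \<psi> where "\<And>i. maj i (\<psi> i)" by metis
  then have \<psi>[measurable]: "\<And>i. \<psi> i \<in> borel_measurable M" and \<psi>_ge: "\<And>i x. x \<in> ?N \<Longrightarrow> ennreal (energy_density x (?\<sigma> i)) \<le> \<psi> i x"
    and \<psi>_int: "\<And>i. (\<integral>\<^sup>+x. \<psi> i x \<partial>M) \<le> ennreal (Cd ^ 5 * \<tau>)" unfolding maj_def by auto
  define a1 where "a1 = (2 * K) powr p"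
  define a2 where "a2 = ((4 * real n + 2) * (2 * K)) powr p"
  have a0: "0 \<le> a1" "0 \<le> a2" by (simp_all add: a1_def a2_def)
  define e where "e = (4 * real n + 2) * (2 * K) * b powr (1 / p)"
  have e0: "0 \<le> e" using K by (simp add: e_def)
  define \<Psi> where "\<Psi> x = (\<Sum>i. ennreal ((1/2) ^ i) * \<psi> i x)" for x
  define H where "H x = ennreal (2 powr p) * (ennreal a1 * \<Psi> x +
     ennreal (a2 * b) * indicator (ball x0 (2 * r)) x)" for x
  have H_int: "(\<integral>\<^sup>+x. H x \<partial>M) \<le> ennreal (2 powr p * (2 * a1 * Cd ^ 5 + a2 * Cd ^ (k1 + 1)) * \<tau>)"
  proof -
    have "(\<integral>\<^sup>+x. H x \<partial>M) = ennreal (2 powr p) * (ennreal a1 * (\<Sum>i. ennreal ((1/2) ^ i) * (\<integral>\<^sup>+x. \<psi> i x \<partial>M)) +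
       ennreal (a2 * b) * emeasure M (ball x0 (2 * r)))"
      unfolding H_def \<Psi>_def by (simp add: nn_integral_cmult nn_integral_add nn_integral_suminf nn_integral_cmult_indicator)
    also have "\<dots> \<le> ennreal (2 powr p) * (ennreal a1 * ennreal (2 * Cd ^ 5 * \<tau>) + ennreal (a2 * b) * ennreal (Cd * ?m))"
    proof (intro mult_left_mono add_mono)
      have "(\<Sum>i. ennreal ((1/2) ^ i) * (\<integral>\<^sup>+x. \<psi> i x \<partial>M)) \<le> (\<Sum>i. ennreal ((1/2) ^ i) * ennreal (Cd ^ 5 * \<tau>))"
        by (intro suminf_le mult_left_mono \<psi>_int) auto
      also have "\<dots> = (\<Sum>i. ennreal ((1/2) ^ i)) * ennreal (Cd ^ 5 * \<tau>)" by (rule ennreal_suminf_multc)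
      also have "(\<Sum>i. ennreal ((1/2) ^ i)) = ennreal 2"
        by (subst suminf_ennreal2) (auto simp: suminf_geometric)
      also have "ennreal 2 * ennreal (Cd ^ 5 * \<tau>) = ennreal (2 * Cd ^ 5 * \<tau>)"
        using Cd_ge_1 \<tau> by (subst ennreal_mult[symmetric]) (auto simp: mult.assoc)
      finally show "(\<Sum>i. ennreal ((1/2) ^ i) * (\<integral>\<^sup>+x. \<psi> i x \<partial>M)) \<le> ennreal (2 * Cd ^ 5 * \<tau>)" .
      show "emeasure M (ball x0 (2 * r)) \<le> ennreal (Cd * ?m)"
        unfolding emeasure_ball using doubling[OF r, of x0] by (rule ennreal_leI)
    qed auto
    also have "\<dots> = ennreal (2 powr p * (a1 * (2 * Cd ^ 5 * \<tau>) + a2 * b * (Cd * ?m)))"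
      using a0 b0 Cd_ge_1 \<tau> by (simp add: ennreal_mult ennreal_plus)
    also have "2 powr p * (a1 * (2 * Cd ^ 5 * \<tau>) + a2 * b * (Cd * ?m)) = 2 powr p * (2 * a1 * Cd ^ 5 + a2 * Cd ^ (k1 + 1)) * \<tau>"
      using m by (simp add: b_def field_simps)
    finally show ?thesis .
  qed
  have "(\<integral>\<^sup>+x\<in>?N. epow (ennreal (1 / \<rho> * \<bar>u x - c\<bar>)) p \<partial>M) \<le>
      ennreal (2 powr p * (2 * a1 * Cd ^ 5 + a2 * Cd ^ (k1 + 1)) * \<tau>)" if c: "\<bar>c - c0\<bar> \<le> \<delta>" for c
  proof -
    have "(\<integral>\<^sup>+x\<in>?N. epow (ennreal (1 / \<rho> * \<bar>u x - c\<bar>)) p \<partial>M) \<le> (\<integral>\<^sup>+x. H x \<partial>M)"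
    proof (rule nn_integral_mono)
      fix x
      show "epow (ennreal (1 / \<rho> * \<bar>u x - c\<bar>)) p * indicator ?N x \<le> H x"
      proof (cases "x \<in> ?N")
        case True
        have "\<bar>u x - c\<bar> \<le> \<bar>u x - avg x \<rho>\<bar> + (4 * real n + 2) * \<delta>"
          using N_avg[OF True] c by (simp add: algebra_simps)
        then have "1 / \<rho> * \<bar>u x - c\<bar> \<le> 1 / \<rho> * (\<bar>u x - avg x \<rho>\<bar> + (4 * real n + 2) * \<delta>)"
          using \<rho>0 by (intro mult_left_mono) auto
        also have "\<dots> = 1 / \<rho> * \<bar>u x - avg x \<rho>\<bar> + e"
          using \<rho>0 by (simp add: \<delta>_def e_def field_simps)
        finally have "ennreal (1 / \<rho> * \<bar>u x - c\<bar>) \<le> ennreal (1 / \<rho> * \<bar>u x - avg x \<rho>\<bar>) + ennreal e"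
          using \<rho>0 e0 by (subst ennreal_plus[symmetric]) (auto simp del: ennreal_plus intro!: ennreal_leI)
        then have "epow (ennreal (1 / \<rho> * \<bar>u x - c\<bar>)) p \<le> epow (ennreal (1 / \<rho> * \<bar>u x - avg x \<rho>\<bar>) + ennreal e) p"
          by (rule epow_mono[rotated]) simp
        also have "\<dots> \<le> ennreal (2 powr p) * (epow (ennreal (1 / \<rho> * \<bar>u x - avg x \<rho>\<bar>)) p + epow (ennreal e) p)"
          by (rule epow_add_le) simp
        also have "\<dots> \<le> H x"
          unfolding H_def
        proof (intro mult_left_mono add_mono)
          have "epow (ennreal (1 / \<rho> * \<bar>u x - avg x \<rho>\<bar>)) p = ennreal ((1 / \<rho>) powr p) * epow (ennreal \<bar>u x - avg x \<rho>\<bar>) p"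
            using \<rho>0 by (subst ennreal_mult) (auto intro!: epow_mult_ennreal)
          also have "\<dots> \<le> ennreal ((1 / \<rho>) powr p) * (ennreal ((2 * K * \<rho>) powr p) * \<Psi> x)"
          proof (intro mult_left_mono)
            have "(\<Sum>i. ennreal ((1/2) ^ i * energy_density x (?\<sigma> i))) \<le> \<Psi> x"
              unfolding \<Psi>_def using \<psi>_ge[OF True] energy_density_nonneg by (intro suminf_le) (auto simp: ennreal_mult intro!: mult_left_mono)
            then have "ennreal ((2 * K * \<rho>) powr p) * (\<Sum>i. ennreal ((1/2) ^ i * energy_density x (?\<sigma> i))) \<le> 
               ennreal ((2 * K * \<rho>) powr p) * \<Psi> x"
              by (rule mult_left_mono) simp
            then show "epow (ennreal \<bar>u x - avg x \<rho>\<bar>) p \<le> ennreal ((2 * K * \<rho>) powr p) * \<Psi> x"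
              using pointwise_average_bound[OF \<rho>0, of x] unfolding K_def by (rule order_trans[rotated])
          qed simp
          also have "\<dots> = ennreal ((1 / \<rho>) powr p * (2 * K * \<rho>) powr p) * \<Psi> x"
            by (simp add: ennreal_mult mult.assoc)
          also have "(1 / \<rho>) powr p * (2 * K * \<rho>) powr p = a1"
            using \<rho>0 K by (simp add: a1_def flip: powr_mult)
          finally show "epow (ennreal (1 / \<rho> * \<bar>u x - avg x \<rho>\<bar>)) p \<le> ennreal a1 * \<Psi> x" .
          have "epow (ennreal e) p = ennreal (a2 * b)"
            using K b0 e0 by (simp add: epow_ennreal) (simp add: e_def a2_def powr_mult powr_powr)
          then show "epow (ennreal e) p \<le> ennreal (a2 * b) * indicator (ball x0 (2 * r)) x"
            using N_dist(2)[OF True] by simp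
        qed simp
        finally show ?thesis using True by simp
      qed simp
    qed
    then show ?thesis using H_int by (rule order_trans)
  qed
  then show ?thesis using \<delta>0 unfolding a1_def a2_def K_def annular_constant_def by blast
qed

lemma constant_of_zero_energy:
  assumes "energy UNIV = 0"
  shows "u x = u y"
proof -
  define s where "s = dist x y + 1"
  have s: "0 < s" unfolding s_def by (simp add: add_nonneg_pos)
  let ?B = "ball x s" let ?a = "avg x s"
  have "energy (ball x (lam * s)) = 0" using energy_mono[of "ball x (lam * s)" UNIV] assms energy_nonneg by (simp add: antisym)
  then have "(LINT z:?B|M. \<bar>u z - ?a\<bar>) / measure M ?B \<le> 0" using poincare[OF s, of x] by (simp add: energy_def)
  then have le: "(LINT z:?B|M. \<bar>u z - ?a\<bar>) \<le> 0" using measure_ball_pos[OF s, of x] by (simp add: divide_le_0_iff)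
  have i: "integrable M (\<lambda>z. indicator ?B z *\<^sub>R \<bar>u z - ?a\<bar>)"
    using set_integrable_abs[OF integrable_diff_ball[of x s ?a]] by (simp add: set_integrable_def)
  have "(LINT z|M. indicator ?B z *\<^sub>R \<bar>u z - ?a\<bar>) = 0"
    using le unfolding set_lebesgue_integral_def by (intro antisym integral_nonneg_AE) auto
  then have "AE z in M. indicator ?B z *\<^sub>R \<bar>u z - ?a\<bar> = 0"
    by (subst (asm) integral_nonneg_eq_0_iff_AE[OF i]) auto
  then have ae: "AE z in M. z \<in> ?B \<longrightarrow> u z = ?a" by eventually_elim (auto simp: indicator_def)
  have eq: "u w = ?a" if w: "w \<in> ?B" for w
  proof (rule ccontr)
    assume "u w \<noteq> ?a"
    let ?U = "{z. u z \<noteq> ?a} \<inter> ?B"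
    have "open {z. u z \<noteq> ?a}" using u_cont by (intro open_Collect_neq) auto
    then have "open ?U" by auto
    then obtain e where e: "0 < e" "ball w e \<subseteq> ?U" using \<open>u w \<noteq> ?a\<close> w by (metis (mono_tags, lifting) Int_iff mem_Collect_eq openE)
    have "AE z in M. z \<notin> ball w e" using ae by eventually_elim (use e in auto)
    then have "emeasure M (ball w e) = 0" by (subst (asm) AE_iff_measurable[OF ball_sets]) auto
    then show False using measure_ball_pos[OF e(1), of w] by (simp add: emeasure_ball)
  qed
  show ?thesis using eq[of x] eq[of y] s by (simp add: s_def)
qed

lemma energy_complement_ball_tendsto_0:
  fixes x0 :: 'a
  assumes R: "filterlim R at_top sequentially"
  shows "(\<lambda>j::nat. energy (- ball x0 (R j))) \<longlonglongrightarrow> 0"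
proof -
  note f_meas[measurable]
  let ?\<nu> = "density M f"
  have em: "emeasure ?\<nu> A = ennreal (energy A)" if "A \<in> sets M" for A
    using that by (subst emeasure_density) (auto simp: nn_energy)
  interpret \<nu>: finite_measure ?\<nu> by standard (use em[of UNIV] space_M sets.top[of M] in simp)
  have me: "measure ?\<nu> A = energy A" if "A \<in> sets M" for A using em[OF that] energy_nonneg by (simp add: measure_def)
  have cs: "- ball x0 s \<in> sets M" for s by (rule sets_M_borel) simp
  have "(\<lambda>n. measure ?\<nu> (- ball x0 (real n))) \<longlonglongrightarrow> measure ?\<nu> (\<Inter>n. - ball x0 (real n))"
    by (rule \<nu>.finite_Lim_measure_decseq) (use cs in \<open>auto simp: decseq_def\<close>)
  moreover have "(\<Inter>n. - ball x0 (real n)) = {}"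
  proof (intro equals0I)
    fix z assume z: "z \<in> (\<Inter>n. - ball x0 (real n))"
    obtain n where "dist x0 z < real n" using reals_Archimedean2 by blast
    then show False using z by auto
  qed
  ultimately have lim: "(\<lambda>n. energy (- ball x0 (real n))) \<longlonglongrightarrow> 0" using me cs by simp
  show ?thesis
  proof (rule LIMSEQ_I)
    fix e :: real assume "0 < e"
    then obtain n where n: "energy (- ball x0 (real n)) < e" using LIMSEQ_D[OF lim] energy_nonneg by fastforce
    obtain j0 where j0: "\<And>j. j0 \<le> j \<Longrightarrow> real n \<le> R j"
      using R unfolding filterlim_at_top eventually_sequentially by metis
    have "energy (- ball x0 (R j)) \<le> energy (- ball x0 (real n))" if "j0 \<le> j" for j
      using j0[OF that] by (intro energy_mono) auto
    then show "\<exists>no. \<forall>j\<ge>no. norm (energy (- ball x0 (R j)) - 0) < e"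
      using n energy_nonneg by (intro exI[of _ j0]) (auto intro: le_less_trans)
  qed
qed

end

section \<open>Energy in a ball and energy far away\<close>

text \<open>
  The image measure of a finite measure has at most countably many atoms.
\<close>
lemma (in metric_measure) ex_level_of_measure_zero:
  fixes u :: "'a \<Rightarrow> real"
  assumes u[measurable]: "u \<in> borel_measurable M" and ab: "a < b"
  obtains c where "c \<in> {a..b}" "AE x in M. x \<in> ball x0 r \<longrightarrow> u x \<noteq> c"
proof -
  let ?N = "distr (restrict_space M (ball x0 r)) borel u"
  have m[measurable]: "u \<in> borel_measurable (restrict_space M (ball x0 r))" by (rule measurable_restrict_space1[OF u])
  have em: "emeasure ?N A = emeasure M (u -` A \<inter> ball x0 r)" if "A \<in> sets borel" for A
    using that by (simp add: emeasure_distr space_restrict_space emeasure_restrict_space)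
  interpret N: finite_measure ?N
    by standard (use em[of UNIV] emeasure_ball_finite[of x0 r] in \<open>simp add: less_top[symmetric]\<close>)
  have "countable {c. measure ?N {c} \<noteq> 0}" by (rule N.countable_support)
  then have "\<not> {a..b} \<subseteq> {c. measure ?N {c} \<noteq> 0}"
    using ab uncountable_closed_interval countable_subset by blast
  then obtain c where c: "c \<in> {a..b}" "measure ?N {c} = 0" by blast
  have "emeasure M (u -` {c} \<inter> ball x0 r) = 0"
    using c(2) em[of "{c}"] by (simp add: N.emeasure_eq_measure)
  moreover have "u -` {c} \<inter> ball x0 r \<in> sets M"
    using measurable_sets[OF u, of "{c}"] by auto
  ultimately have "AE x in M. x \<notin> u -` {c} \<inter> ball x0 r" by (intro AE_not_in) auto
  then have "AE x in M. x \<in> ball x0 r \<longrightarrow> u x \<noteq> c" by eventually_elim auto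
  then show thesis using that c by blast
qed

lemma (in metric_measure) quasiharmonic_integrable_ball:
  assumes u: "quasiharmonic M p u"
  shows "set_integrable M (ball x r) u" "integrable_ereal_on M (ball x r) (\<lambda>y. ereal (u y))"
proof -
  have um[measurable]: "u \<in> borel_measurable M"
    using u by (auto simp: quasiharmonic_def intro: borel_imp_measurable_M borel_measurable_continuous_onI)
  have "(\<integral>\<^sup>+y\<in>ball x r. ennreal \<bar>u y\<bar> \<partial>M) \<le> (\<integral>\<^sup>+y. indicator (ball x r) y + epow (ennreal \<bar>u y - 0\<bar>) p * indicator (ball x r) y \<partial>M)"
  proof (rule nn_integral_mono)
    fix y
    have "\<bar>u y\<bar> \<le> 1 + \<bar>u y\<bar> powr p"
    proof (cases "\<bar>u y\<bar> \<le> 1")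
      case False
      then have "\<bar>u y\<bar> powr 1 \<le> \<bar>u y\<bar> powr p" using p_gt_1 by (intro powr_mono) auto
      then show ?thesis using False by simp
    qed (simp add: add_increasing2)
    then have "ennreal \<bar>u y\<bar> \<le> 1 + epow (ennreal \<bar>u y - 0\<bar>) p"
      by (simp add: epow_ennreal ennreal_leI flip: ennreal_plus ennreal_1)
    then show "ennreal \<bar>u y\<bar> * indicator (ball x r) y \<le> indicator (ball x r) y + epow (ennreal \<bar>u y - 0\<bar>) p * indicator (ball x r) y"
      by (auto simp: indicator_def)
  qed
  also have "\<dots> = emeasure M (ball x r) + (\<integral>\<^sup>+y\<in>ball x r. epow (ennreal \<bar>u y - 0\<bar>) p \<partial>M)"
    by (subst nn_integral_add) auto
  also have "\<dots> < \<infinity>" using emeasure_ball_finite[of x r] quasiharmonic_Lp_ball[OF u, where x = x and r = r and c = 0]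
    by (simp add: ennreal_add_less_top)
  finally have fin: "(\<integral>\<^sup>+y\<in>ball x r. ennreal \<bar>u y\<bar> \<partial>M) < \<infinity>" .
  then show "integrable_ereal_on M (ball x r) (\<lambda>y. ereal (u y))"
    by (auto simp: integrable_ereal_on_def intro!: measurable_restrict_space1)
  show "set_integrable M (ball x r) u"
    unfolding set_integrable_def
  proof (rule integrableI_bounded)
    have "(\<integral>\<^sup>+y. ennreal (norm (indicator (ball x r) y *\<^sub>R u y)) \<partial>M) = (\<integral>\<^sup>+y\<in>ball x r. ennreal \<bar>u y\<bar> \<partial>M)"
      by (intro nn_integral_cong) (auto simp: indicator_def)
    then show "(\<integral>\<^sup>+y. ennreal (norm (indicator (ball x r) y *\<^sub>R u y)) \<partial>M) < \<infinity>" using fin by simp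
  qed measurable
qed

text \<open>
  The step from the collar to the energy far away: $c$ is taken from the interval provided by
  \<open>annular_poincare\<close>, at a level of $u$ that has measure zero in the ball.
\<close>
lemma (in poincare_function) energy_ball_le_energy_complement:
  fixes x0 :: 'a and r \<Lambda> \<tau> :: real and k1 k2 :: nat
  assumes \<Lambda>: "1 < \<Lambda>" and r: "0 < r" and k1: "4 * \<Lambda> * (\<Lambda> + 1) \<le> 2 ^ k1" and k2: "32 * lam * \<Lambda>\<^sup>2 + 1 \<le> 2 ^ k2"
    and \<tau>: "0 < \<tau>" and en: "energy (- ball x0 (r / (2 * \<Lambda>))) \<le> \<tau>"
    and n: "n = nat \<lfloor>Cd ^ k2\<rfloor>" and \<rho>: "\<rho> = r / (8 * lam * \<Lambda>)"
    and chain: "annular_chains x0 r \<Lambda> \<rho>"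
    and B: "B = annular_constant n k1"
    and g: "g \<in> borel_measurable M" and f: "\<And>x. f x = epow (g x) p" and Q: "0 \<le> Q"
    and caccioppoli: "\<And>c. (AE x in M. x \<in> ball x0 r \<longrightarrow> u x \<noteq> c) \<Longrightarrow> (\<integral>\<^sup>+x\<in>ball x0 r. f x \<partial>M) \<le>
        ennreal Q * (\<integral>\<^sup>+x\<in>collar x0 r \<rho>. epow (g x + ennreal (1 / \<rho> * \<bar>u x - c\<bar>)) p \<partial>M)"
  shows "energy (ball x0 r) \<le> Q * (2 powr p * (1 + B)) * \<tau>"
proof -
  obtain c\<^sub>0 \<delta> where \<delta>: "0 < \<delta>" "\<And>c. \<bar>c - c\<^sub>0\<bar> \<le> \<delta> \<Longrightarrow>
     (\<integral>\<^sup>+x\<in>collar x0 r \<rho>. epow (ennreal (1 / \<rho> * \<bar>u x - c\<bar>)) p \<partial>M) \<le> ennreal (B * \<tau>)"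
    using annular_poincare[OF \<Lambda> r k1 k2 \<tau> en n \<rho> chain] unfolding B by blast
  have um: "u \<in> borel_measurable M" using u_cont by (intro borel_imp_measurable_M borel_measurable_continuous_onI)
  note [measurable] = um g
  obtain c where c: "c \<in> {c\<^sub>0..c\<^sub>0 + \<delta>}" "AE x in M. x \<in> ball x0 r \<longrightarrow> u x \<noteq> c"
    using ex_level_of_measure_zero[OF um, of c\<^sub>0 "c\<^sub>0 + \<delta>"] \<delta>(1) by (metis less_add_same_cancel1)
  have B0: "0 \<le> B" using Cd_ge_1 by (simp add: B annular_constant_def)
  let ?N = "collar x0 r \<rho>" and ?A = "- ball x0 (r / (2 * \<Lambda>))"
  have NA: "?N \<subseteq> ?A"
  proof
    fix x assume "x \<in> ?N"
    then have "r \<le> dist x0 x" by (simp add: collar_def)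
    moreover have "r / (2 * \<Lambda>) \<le> r" using r \<Lambda> by (simp add: field_simps)
    ultimately show "x \<in> ?A" by simp
  qed
  have N_sets: "?N \<in> sets M"
  proof (rule sets_M_borel)
    have "?N = - ball x0 r \<inter> (\<Union>z\<in>frontier (ball x0 r). ball z \<rho>)" by (auto simp: collar_def dist_commute)
    then show "?N \<in> sets borel" by (simp only:) (intro sets.Int borel_closed borel_open, auto)
  qed
  note [measurable] = N_sets
  have "ennreal (energy (ball x0 r)) \<le> ennreal Q * (\<integral>\<^sup>+x\<in>?N. epow (g x + ennreal (1 / \<rho> * \<bar>u x - c\<bar>)) p \<partial>M)"
    using caccioppoli[OF c(2)] by (simp add: nn_energy)
  also have "\<dots> \<le> ennreal Q * (\<integral>\<^sup>+x. ennreal (2 powr p) * (f x * indicator ?N x + epow (ennreal (1 / \<rho> * \<bar>u x - c\<bar>)) p * indicator ?N x) \<partial>M)"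
  proof (intro mult_left_mono nn_integral_mono)
    fix x
    show "epow (g x + ennreal (1 / \<rho> * \<bar>u x - c\<bar>)) p * indicator ?N x \<le>
      ennreal (2 powr p) * (f x * indicator ?N x + epow (ennreal (1 / \<rho> * \<bar>u x - c\<bar>)) p * indicator ?N x)"
      unfolding f using epow_add_le[OF p_pos, of "g x" "ennreal (1 / \<rho> * \<bar>u x - c\<bar>)"] by (auto simp: indicator_def)
  qed simp
  also have "\<dots> = ennreal Q * (ennreal (2 powr p) * ((\<integral>\<^sup>+x\<in>?N. f x \<partial>M) + (\<integral>\<^sup>+x\<in>?N. epow (ennreal (1 / \<rho> * \<bar>u x - c\<bar>)) p \<partial>M)))"
    using f_meas by (simp add: nn_integral_cmult nn_integral_add)
  also have "\<dots> \<le> ennreal Q * (ennreal (2 powr p) * (ennreal \<tau> + ennreal (B * \<tau>)))"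
  proof (intro mult_left_mono add_mono)
    show "(\<integral>\<^sup>+x\<in>?N. f x \<partial>M) \<le> ennreal \<tau>"
      unfolding nn_energy using energy_mono[OF NA] en by (intro ennreal_leI) simp
    show "(\<integral>\<^sup>+x\<in>?N. epow (ennreal (1 / \<rho> * \<bar>u x - c\<bar>)) p \<partial>M) \<le> ennreal (B * \<tau>)"
      using c(1) by (intro \<delta>(2)) auto
  qed auto
  also have "\<dots> = ennreal (Q * (2 powr p * (1 + B)) * \<tau>)"
    using Q B0 \<tau> by (simp add: ennreal_mult[symmetric] ennreal_plus[symmetric] algebra_simps del: ennreal_plus)
  finally show ?thesis using Q B0 \<tau> by (subst (asm) ennreal_le_iff) auto
qed

theorem theorem5p3:
  fixes M :: "'a::metric_space measure" and p lam :: real and x\<^sub>0 :: 'a and u :: "'a \<Rightarrow> real"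
  assumes "1 < p"
    and "metric_measure_space M"
    and "\<not> bounded (UNIV :: 'a set)"
    and "globally_doubling M"
    and "global_poincare M p lam"
    and "sequentially_annularly_chainable lam x\<^sub>0"
    and "quasiharmonic M p u"
    and "finite_energy M p u"
  shows "u constant_on UNIV"
proof -
  interpret metric_measure M p using assms(1,2) by unfold_locales
  note u = assms(7)
  obtain Cd where Cd: "0 < Cd" "\<And>x r. 0 < r \<Longrightarrow> emeasure M (ball x (2 * r)) \<le> ennreal Cd * emeasure M (ball x r)"
    using assms(4) unfolding globally_doubling_def by blast
  have em: "emeasure M (ball x r) = ennreal (measure M (ball x r))" for x r
    using emeasure_ball_finite[of x r] by (intro emeasure_eq_ennreal_measure) simp
  interpret doubling_space M p Cd
  proof unfold_locales
    fix x :: 'a and r :: real assume "0 < r"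
    from Cd(2)[OF this, of x] show "measure M (ball x (2 * r)) \<le> Cd * measure M (ball x r)"
      unfolding em using Cd(1) by (simp flip: ennreal_mult)
  qed
  obtain D where D: "countable D" "closure D = (UNIV :: 'a set)" using ex_countable_dense by blast
  obtain g where g: "g \<in> borel_measurable borel" and wug: "weak_upper_gradient M p (\<lambda>x. ereal (u x)) g"
    and g_min: "AE x in M. g x = min_wug M p (\<lambda>x. ereal (u x)) x"
    using quasiharmonic_minimal_gradient[OF D u] by blast
  note gM[measurable] = g[THEN borel_imp_measurable_M]
  have "(\<integral>\<^sup>+x. epow (g x) p \<partial>M) = (\<integral>\<^sup>+x. epow (min_wug M p (\<lambda>x. ereal (u x)) x) p \<partial>M)"
    using g_min by (intro nn_integral_cong_AE) auto
  then have g_fin: "(\<integral>\<^sup>+x. epow (g x) p \<partial>M) < \<infinity>" using assms(8) by (simp add: finite_energy_def)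
  obtain Cp where lam: "1 \<le> lam" and Cp: "0 < Cp"
    and PI: "\<And>x r u g. 0 < r \<and> integrable_ereal_on M (ball x (lam * r)) u \<and> weak_upper_gradient M p u g \<Longrightarrow>
          (\<integral>\<^sup>+y\<in>ball x r. eabs (u y - ereal (mean_value M (ball x r) u)) \<partial>M) / emeasure M (ball x r)
          \<le> ennreal (Cp * r) *
            epow ((\<integral>\<^sup>+y\<in>ball x (lam * r). epow (g y) p \<partial>M) / emeasure M (ball x (lam * r))) (1 / p)"
    using assms(5) unfolding global_poincare_def by blast
  interpret poincare_function M p Cd Cp lam u "\<lambda>x. epow (g x) p"
  proof unfold_locales
    show "1 \<le> lam" "0 < Cp" by (fact lam, fact Cp)
    show "continuous_on UNIV u" using u by (simp add: quasiharmonic_def)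
    show "(\<lambda>x. epow (g x) p) \<in> borel_measurable M" by measurable
    show "(\<integral>\<^sup>+x. epow (g x) p \<partial>M) < \<infinity>" by (rule g_fin)
    show "set_integrable M (ball x s) u" for x s by (rule quasiharmonic_integrable_ball[OF u])
    fix x :: 'a and s :: real assume s: "0 < s"
    let ?a = "set_average M (ball x s) u"
    let ?E = "\<integral>\<^sup>+y\<in>ball x (lam * s). epow (g y) p \<partial>M"
    have a: "mean_value M (ball x s) (\<lambda>y. ereal (u y)) = ?a" by (simp add: mean_value_def set_average_def)
    have ms: "0 < measure M (ball x s)" "0 < measure M (ball x (lam * s))" using s lam by (auto intro!: measure_ball_pos)
    have "?E \<le> (\<integral>\<^sup>+x. epow (g x) p \<partial>M)" by (intro nn_integral_mono) (auto simp: indicator_def)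
    then have E: "?E = ennreal (enn2real ?E)" using g_fin by (simp add: le_less_trans)
    have "set_integrable M (ball x s) (\<lambda>y. u y - ?a)"
      using emeasure_ball_finite[of x s]
      by (intro set_integral_diff quasiharmonic_integrable_ball[OF u]) (auto simp: set_integrable_def less_top)
    then have i: "integrable M (\<lambda>y. indicator (ball x s) y *\<^sub>R \<bar>u y - ?a\<bar>)"
      using set_integrable_abs by (force simp: set_integrable_def)
    have "(\<integral>\<^sup>+y\<in>ball x s. eabs (ereal (u y) - ereal ?a) \<partial>M) = (\<integral>\<^sup>+y. ennreal (indicator (ball x s) y *\<^sub>R \<bar>u y - ?a\<bar>) \<partial>M)"
      by (intro nn_integral_cong) (auto simp: indicator_def)
    also have "\<dots> = ennreal (LINT y:ball x s|M. \<bar>u y - ?a\<bar>)"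
      unfolding set_lebesgue_integral_def by (rule nn_integral_eq_integral[OF i]) auto
    finally have L: "(\<integral>\<^sup>+y\<in>ball x s. eabs (ereal (u y) - ereal ?a) \<partial>M) = ennreal (LINT y:ball x s|M. \<bar>u y - ?a\<bar>)" .
    have L0: "0 \<le> (LINT y:ball x s|M. \<bar>u y - ?a\<bar>)"
      unfolding set_lebesgue_integral_def by (intro integral_nonneg_AE) auto
    have "ennreal (LINT y:ball x s|M. \<bar>u y - ?a\<bar>) / emeasure M (ball x s) \<le> ennreal (Cp * s) * epow (?E / emeasure M (ball x (lam * s))) (1 / p)"
      using PI[of s x "\<lambda>y. ereal (u y)" g] s wug quasiharmonic_integrable_ball(2)[OF u] unfolding a L[symmetric] by simp
    then have "ennreal ((LINT y:ball x s|M. \<bar>u y - ?a\<bar>) / measure M (ball x s)) \<le>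
       ennreal (Cp * s * (enn2real ?E / measure M (ball x (lam * s))) powr (1 / p))"
      unfolding em using ms L0 Cp s
      by (subst (asm) E) (simp add: divide_ennreal epow_ennreal ennreal_mult)
    then show "(LINT y:ball x s|M. \<bar>u y - ?a\<bar>) / measure M (ball x s) \<le> Cp * s * (enn2real ?E / measure M (ball x (lam * s))) powr (1 / p)"
      using Cp s by (subst (asm) ennreal_le_iff) auto
  qed
  obtain \<Lambda> r where \<Lambda>: "1 < \<Lambda>" and r: "\<And>j::nat. 0 < r j" "filterlim r at_top sequentially"
    and chain: "\<And>j. annular_chains x\<^sub>0 (r j) \<Lambda> (r j / (8 * lam * \<Lambda>))"
    using assms(6) unfolding annular_chains_def sequentially_annularly_chainable_def by blast
  obtain Q where Q: "1 \<le> Q" "\<And>\<phi>. \<phi> \<in> newtonian_bounded_support_closure M p \<Longrightarrow>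
          (\<integral>\<^sup>+x\<in>{x. \<phi> x \<noteq> 0}. epow (min_wug M p (\<lambda>x. ereal (u x)) x) p \<partial>M)
          \<le> ennreal Q * (\<integral>\<^sup>+x\<in>{x. \<phi> x \<noteq> 0}. epow (min_wug M p (\<lambda>y. ereal (u y) + \<phi> y) x) p \<partial>M)"
    using u unfolding quasiharmonic_def quasiminimizer_def by blast
  obtain k1 where k1: "4 * \<Lambda> * (\<Lambda> + 1) \<le> 2 ^ k1" using real_arch_pow[of 2 "4 * \<Lambda> * (\<Lambda> + 1)"] by (auto intro: less_imp_le)
  obtain k2 where k2: "32 * lam * \<Lambda>\<^sup>2 + 1 \<le> 2 ^ k2" using real_arch_pow[of 2 "32 * lam * \<Lambda>\<^sup>2 + 1"] by (auto intro: less_imp_le)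
  define n where "n = nat \<lfloor>Cd ^ k2\<rfloor>"
  define B where "B = annular_constant n k1"
  define K where "K = Q * (2 powr p * (1 + B))"
  \<comment> \<open>The second summand only keeps \<open>\<tau> j\<close> positive.\<close>
  define \<tau> where "\<tau> j = energy (- ball x\<^sub>0 (r j / (2 * \<Lambda>))) + inverse (real (Suc j))" for j
  have main: "energy (ball x\<^sub>0 (r j)) \<le> K * \<tau> j" for j
    unfolding K_def
  proof (rule energy_ball_le_energy_complement[OF \<Lambda> r(1) k1 k2 _ _ n_def refl chain B_def gM refl])
    show "0 < \<tau> j" using energy_nonneg by (simp add: \<tau>_def add_nonneg_pos)
    show "energy (- ball x\<^sub>0 (r j / (2 * \<Lambda>))) \<le> \<tau> j" by (simp add: \<tau>_def)
    show "0 \<le> Q" using Q by simp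
    fix c assume c: "AE x in M. x \<in> ball x\<^sub>0 (r j) \<longrightarrow> u x \<noteq> c"
    have "0 < r j / (8 * lam * \<Lambda>)" using r(1)[of j] lam \<Lambda> by simp
    then show "(\<integral>\<^sup>+x\<in>ball x\<^sub>0 (r j). epow (g x) p \<partial>M) \<le> ennreal Q * (\<integral>\<^sup>+x\<in>collar x\<^sub>0 (r j) (r j / (8 * lam * \<Lambda>)).
          epow (g x + ennreal (1 / (r j / (8 * lam * \<Lambda>)) * \<bar>u x - c\<bar>)) p \<partial>M)"
      using Q(2) c by (intro quasiminimizer_energy_ball_le_collar[OF D u _ g wug g_min g_fin])
  qed
  have "filterlim (\<lambda>j. r j * (1 / (2 * \<Lambda>))) at_top sequentially"
    using \<Lambda> by (intro filterlim_at_top_mult_tendsto_pos[OF tendsto_const _ r(2)]) auto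
  then have "filterlim (\<lambda>j. r j / (2 * \<Lambda>)) at_top sequentially" by simp
  then have "(\<lambda>j. energy (- ball x\<^sub>0 (r j / (2 * \<Lambda>)))) \<longlonglongrightarrow> 0" by (rule energy_complement_ball_tendsto_0)
  then have "\<tau> \<longlonglongrightarrow> 0 + 0" unfolding \<tau>_def by (intro tendsto_add LIMSEQ_inverse_real_of_nat)
  then have lim: "(\<lambda>j. K * \<tau> j + energy (- ball x\<^sub>0 (r j))) \<longlonglongrightarrow> K * 0 + 0"
    by (intro tendsto_intros energy_complement_ball_tendsto_0 r(2)) simp
  have "energy UNIV \<le> K * \<tau> j + energy (- ball x\<^sub>0 (r j))" for j
  proof -
    have "ennreal (energy UNIV) = (\<integral>\<^sup>+x. epow (g x) p * indicator (ball x\<^sub>0 (r j)) x + epow (g x) p * indicator (- ball x\<^sub>0 (r j)) x \<partial>M)"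
      unfolding nn_energy[symmetric] by (intro nn_integral_cong) (auto simp: indicator_def)
    also have "\<dots> = ennreal (energy (ball x\<^sub>0 (r j))) + ennreal (energy (- ball x\<^sub>0 (r j)))"
      unfolding nn_energy[symmetric] using sets_M_borel[of "- ball x\<^sub>0 (r j)"] by (intro nn_integral_add) auto
    also have "\<dots> = ennreal (energy (ball x\<^sub>0 (r j)) + energy (- ball x\<^sub>0 (r j)))" using energy_nonneg by simp
    finally have "energy UNIV = energy (ball x\<^sub>0 (r j)) + energy (- ball x\<^sub>0 (r j))"
      using energy_nonneg by (subst (asm) ennreal_inj) auto
    then show ?thesis using main[of j] by simp
  qed
  then have "energy UNIV \<le> 0" using LIMSEQ_le_const[OF lim] by auto
  then have "energy UNIV = 0" using energy_nonneg[of UNIV] by simp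
  then have "u x = u x\<^sub>0" for x by (rule constant_of_zero_energy)
  then show ?thesis unfolding constant_on_def by blast
qed

end
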